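(* Let $G$ be a countable discrete group with 2-cocycle $c$. Suppose $S$ is maximal among abelian subgroups of $G$ on which $c$ is symmetric, and assume further that $S$ is normal and immediately centralizing. Let $\Sigma$ denote the Weyl twist associated to the Cartan pair $(A,B)=(C^*_r(G,c),C^*_r(S,c))$, let $\alpha$ be the action of $G/S$ on $\widehat B$ given by $\alpha_{[g]}=\alpha_{\delta_g}$, and let $\mathcal{K}=(G/S)\,{}_\alpha\!\ltimes\widehat B$ be the transformation groupoid. Let $R(S)$ be a choice of coset representatives for $G/S$, and write $r_{[g]}\in R(S)$ for the chosen representative of $[g]$. If the action $\alpha$ on $\widehat B$ is topologically free, then the map $\psi:\mathcal{K}\times\mathbb{T}\to\Sigma$ given by $$\psi\bigl([g],x,\lambda\bigr):=\llbracket\alpha_{[g]}(x),\lambda\delta_{r_{[g]}},x\rrbracket\qquad(\lambda\in\mathbb{T})$$ is a homeomorphism of topological spaces.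
   Context: 2-cocycles. A 2-cocycle on a group $G$ is $c:G\times G\to\mathbb{T}$ with $c(g,e)=c(e,g)=1$ and $c(g,hk)c(h,k)=c(gh,k)c(g,h)$; it is symmetric on $S$ if $c(s,t)=c(t,s)$ for all $s,t\in S$. $C^*_r(G,c)$ is the completion of $C_c(G)$, with $\delta_g\delta_h=c(g,h)\delta_{gh}$ and $\delta_g^*=\overline{c(g,g^{-1})}\delta_{g^{-1}}$, in the operator norm of its left regular representation on $\ell^2(G)$, $\delta_g\,e_h=c(g,h)e_{gh}$. $C^*_r(S,c)$ is viewed as the closure of $C_c(S)$ in $C^*_r(G,c)$. Immediately centralizing. $\nu\in G$ is $k$-centralizing for $S$ if for every $t\in S$ there is $j\in\{1,\dots,k\}$ with $\nu t^j=t^j\nu$; $S$ is immediately centralizing if for every $k\ge1$ each $k$-centralizing element is $1$-centralizing. (Under these hypotheses $(A,B)$ is a Cartan pair: $B$ is maximal abelian in $A$, is the range of a faithful conditional expectation, has normalizer $N(B)=\{n\in A:nbn^*,n^*bn\in B\ \forall b\in B\}$ generating $A$, and contains an approximate identity for $A$.) Weyl groupoid and twist. For a separable Cartan pair $(A,B)$ identify $B\cong C_0(\widehat B)$. For $n\in N(B)$ let $\mathrm{dom}(n)=\{x\in\widehat B:n^*n(x)>0\}$ and let $\alpha_n:\mathrm{dom}(n)\to\mathrm{dom}(n^* )$ be the unique homeomorphism with $n^*bn=(b\circ\alpha_n)\cdot n^*n$ for all $b\in B$. The Weyl groupoid $\mathcal{G}_{(A,B)}$ is the set of classes $[\alpha_n(x),n,x]$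 ($n\in N(B)$, $x\in\mathrm{dom}(n)$), where $(\alpha_n(x),n,x)\sim(\alpha_m(y),m,y)$ iff $x=y$ and $\alpha_n=\alpha_m$ near $x$; its basic open sets are $\{[\alpha_n(x),n,x]:\alpha_n(x)\in V,\ x\in U\}$, $U,V\subseteq\widehat B$ open. The Weyl twist $\Sigma=\Sigma_{(A,B)}$ is the set of classes $\llbracket\alpha_n(x),n,x\rrbracket$ of the same triples under $(\alpha_n(x),n,x)\approx(\alpha_m(y),m,y)$ iff $x=y$ and there are $b,b'\in B$ with $b(x),b'(x)>0$ and $nb=mb'$. Since $\approx$ refines $\sim$, $\Sigma$ maps onto $\mathcal{G}_{(A,B)}$. The topology of $\Sigma$ is such that for each $n\in N(B)$ the restriction $\Sigma|_{\mathrm{supp}'(n)}$ of $\Sigma$ over the open set $\mathrm{supp}'(n)=\{[\alpha_n(y),n,y]:y\in\mathrm{dom}(n)\}$ is open and $\mathrm{dom}(n)\times\mathbb{T}\to\Sigma|_{\mathrm{supp}'(n)}$, $(x,\lambda)\mapsto\llbracket\alpha_n(x),\lambda n,x\rrbracket$, is a homeomorphism. In the group case, each $\delta_g$ is a unitary in $N(B)$, so $\alpha_g:=\alpha_{\delta_g}$ is a homeomorphism of $\widehat B$; it depends only on $[g]\in G/S$ and $[g]\mapsto\alpha_{[g]}:=\alpha_g$ is an action. It is topologically free if for every finite $F\subseteq(G/S)\setminus\{e\}$ the set $\{x\in\widehat B:\alpha_q(x)\ne x\ \forall q\in F\}$ is dense in $\widehat B$. $\mathcal{K}=(G/S)\times\widehat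 B$ with the product topology ($G/S$ discrete), $s([g],x)=x$, $r([g],x)=\alpha_g(x)$, $([g],\alpha_h(y))([h],y)=([gh],y)$. *)

theory Defs
  imports "HOL-Analysis.Analysis" "HOL-Algebra.Coset" "HOL-Algebra.Module"
    "HOL-Library.Complex_Order"
begin

section \<open>Operators on square-summable families\<close>

text \<open>
  Vectors in the Hilbert space over an index set \<open>I\<close> are functions vanishing off \<open>I\<close>;
  operators are extensional functions on that space.
\<close>

type_synonym 'g vec = "'g \<Rightarrow> complex"
type_synonym 'g operator = "'g vec \<Rightarrow> 'g vec"

definition ell2 :: "'g set \<Rightarrow> 'g vec set" where
  "ell2 I = {f. (\<forall>k. k \<notin> I \<longrightarrow> f k = 0) \<and> (\<lambda>k. (cmod (f k))\<^sup>2) summable_on I}"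

definition ell2_norm :: "'g set \<Rightarrow> 'g vec \<Rightarrow> real" where
  "ell2_norm I f = sqrt (\<Sum>\<^sub>\<infinity>k\<in>I. (cmod (f k))\<^sup>2)"

definition ell2_inner :: "'g set \<Rightarrow> 'g vec \<Rightarrow> 'g vec \<Rightarrow> complex" where
  "ell2_inner I f h = (\<Sum>\<^sub>\<infinity>k\<in>I. f k * cnj (h k))"

definition op_add :: "'g set \<Rightarrow> 'g operator \<Rightarrow> 'g operator \<Rightarrow> 'g operator" where
  "op_add I T U = (\<lambda>f\<in>ell2 I. \<lambda>k. T f k + U f k)"

definition op_diff :: "'g set \<Rightarrow> 'g operator \<Rightarrow> 'g operator \<Rightarrow> 'g operator" where
  "op_diff I T U = (\<lambda>f\<in>ell2 I. \<lambda>k. T f k - U f k)"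

definition op_scale :: "'g set \<Rightarrow> complex \<Rightarrow> 'g operator \<Rightarrow> 'g operator" where
  "op_scale I a T = (\<lambda>f\<in>ell2 I. \<lambda>k. a * T f k)"

definition bounded_operators :: "'g set \<Rightarrow> 'g operator set" where
  "bounded_operators I =
    {T \<in> ell2 I \<rightarrow>\<^sub>E ell2 I.
       (\<forall>f\<in>ell2 I. \<forall>h\<in>ell2 I. T (\<lambda>k. f k + h k) = (\<lambda>k. T f k + T h k)) \<and>
       (\<forall>a. \<forall>f\<in>ell2 I. T (\<lambda>k. a * f k) = (\<lambda>k. a * T f k)) \<and>
       (\<exists>C. \<forall>f\<in>ell2 I. ell2_norm I (T f) \<le> C * ell2_norm I f)}"

definition op_norm :: "'g set \<Rightarrow> 'g operator \<Rightarrow> real" where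
  "op_norm I T = Sup {ell2_norm I (T f) | f. f \<in> ell2 I \<and> ell2_norm I f \<le> 1}"

definition op_adjoint :: "'g set \<Rightarrow> 'g operator \<Rightarrow> 'g operator" where
  "op_adjoint I T =
    (THE U. U \<in> bounded_operators I \<and>
       (\<forall>f\<in>ell2 I. \<forall>h\<in>ell2 I. ell2_inner I (T f) h = ell2_inner I f (U h)))"


section \<open>Star algebras and their characters\<close>

record 'b star_algebra = "(complex, 'b) module" +
  adj :: "'b \<Rightarrow> 'b"

text \<open>
  The spectrum of a commutative star subalgebra \<open>B\<close> of \<open>A\<close>: the non-zero star homomorphisms
  from \<open>B\<close> to the complex numbers with the topology of pointwise convergence.  The Gelfand
  transform of \<open>b\<close> sends \<open>x\<close> to \<open>x b\<close>, so the function value written \<open>b(x)\<close> in the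
  literature appears as \<open>x b\<close> throughout.
\<close>

definition characters ::
    "('b, 'm) star_algebra_scheme \<Rightarrow> 'b set \<Rightarrow> ('b \<Rightarrow> complex) set" where
  "characters A B =
    {x \<in> extensional B. (\<exists>b\<in>B. x b \<noteq> 0) \<and>
       (\<forall>a\<in>B. \<forall>b\<in>B. x (a \<oplus>\<^bsub>A\<^esub> b) = x a + x b) \<and>
       (\<forall>z. \<forall>b\<in>B. x (z \<odot>\<^bsub>A\<^esub> b) = z * x b) \<and>
       (\<forall>a\<in>B. \<forall>b\<in>B. x (a \<otimes>\<^bsub>A\<^esub> b) = x a * x b) \<and>
       (\<forall>b\<in>B. x (adj A b) = cnj (x b))}"

definition spectrum ::
    "('b, 'm) star_algebra_scheme \<Rightarrow> 'b set \<Rightarrow> ('b \<Rightarrow> complex) topology" where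
  "spectrum A B = subtopology (product_topology (\<lambda>_. euclidean) B) (characters A B)"


section \<open>Weyl groupoid and Weyl twist\<close>

definition normalizers :: "('b, 'm) star_algebra_scheme \<Rightarrow> 'b set \<Rightarrow> 'b set" where
  "normalizers A B =
    {n \<in> carrier A. \<forall>b\<in>B. n \<otimes>\<^bsub>A\<^esub> b \<otimes>\<^bsub>A\<^esub> adj A n \<in> B \<and> adj A n \<otimes>\<^bsub>A\<^esub> b \<otimes>\<^bsub>A\<^esub> n \<in> B}"

definition weyl_dom ::
    "('b, 'm) star_algebra_scheme \<Rightarrow> 'b set \<Rightarrow> 'b \<Rightarrow> ('b \<Rightarrow> complex) set" where
  "weyl_dom A B n = {x \<in> characters A B. x (adj A n \<otimes>\<^bsub>A\<^esub> n) > 0}"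

text \<open>
  In the equation below the right-hand factor vanishes at every character outside the domain
  of \<open>n\<close>, so the value of \<open>a\<close> there is irrelevant.
\<close>

definition weyl_map ::
    "('b, 'm) star_algebra_scheme \<Rightarrow> 'b set \<Rightarrow> 'b \<Rightarrow> ('b \<Rightarrow> complex) \<Rightarrow> ('b \<Rightarrow> complex)" where
  "weyl_map A B n =
    (THE a. a \<in> extensional (weyl_dom A B n) \<and>
       homeomorphic_map (subtopology (spectrum A B) (weyl_dom A B n))
                        (subtopology (spectrum A B) (weyl_dom A B (adj A n))) a \<and>
       (\<forall>b\<in>B. \<forall>x\<in>characters A B.
          x (adj A n \<otimes>\<^bsub>A\<^esub> b \<otimes>\<^bsub>A\<^esub> n) = a x b * x (adj A n \<otimes>\<^bsub>A\<^esub> n)))"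

type_synonym 'b weyl_triple = "('b \<Rightarrow> complex) \<times> 'b \<times> ('b \<Rightarrow> complex)"

definition weyl_triples ::
    "('b, 'm) star_algebra_scheme \<Rightarrow> 'b set \<Rightarrow> 'b weyl_triple set" where
  "weyl_triples A B = {(weyl_map A B n x, n, x) | n x. n \<in> normalizers A B \<and> x \<in> weyl_dom A B n}"

definition weyl_groupoid_rel ::
    "('b, 'm) star_algebra_scheme \<Rightarrow> 'b set \<Rightarrow> ('b weyl_triple \<times> 'b weyl_triple) set" where
  "weyl_groupoid_rel A B =
    {((y, n, x), (y', m, x')). (y, n, x) \<in> weyl_triples A B \<and> (y', m, x') \<in> weyl_triples A B \<and>
       x = x' \<and>
       (\<exists>U. openin (spectrum A B) U \<and> x \<in> U \<and> U \<subseteq> weyl_dom A B n \<inter> weyl_dom A B m \<and>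
          (\<forall>u\<in>U. weyl_map A B n u = weyl_map A B m u))}"

definition weyl_twist_rel ::
    "('b, 'm) star_algebra_scheme \<Rightarrow> 'b set \<Rightarrow> ('b weyl_triple \<times> 'b weyl_triple) set" where
  "weyl_twist_rel A B =
    {((y, n, x), (y', m, x')). (y, n, x) \<in> weyl_triples A B \<and> (y', m, x') \<in> weyl_triples A B \<and>
       x = x' \<and>
       (\<exists>b\<in>B. \<exists>b'\<in>B. x b > 0 \<and> x b' > 0 \<and> n \<otimes>\<^bsub>A\<^esub> b = m \<otimes>\<^bsub>A\<^esub> b')}"

definition weyl_groupoid_class ::
    "('b, 'm) star_algebra_scheme \<Rightarrow> 'b set \<Rightarrow> 'b weyl_triple \<Rightarrow> 'b weyl_triple set" where
  "weyl_groupoid_class A B t = weyl_groupoid_rel A B `` {t}"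

definition weyl_twist_class ::
    "('b, 'm) star_algebra_scheme \<Rightarrow> 'b set \<Rightarrow> 'b weyl_triple \<Rightarrow> 'b weyl_triple set" where
  "weyl_twist_class A B t = weyl_twist_rel A B `` {t}"

definition weyl_twist ::
    "('b, 'm) star_algebra_scheme \<Rightarrow> 'b set \<Rightarrow> 'b weyl_triple set set" where
  "weyl_twist A B = weyl_triples A B // weyl_twist_rel A B"

text \<open>
  The canonical map from the twist to the groupoid: as the twist relation refines the
  groupoid relation, the groupoid class of a twist class is its image under the latter.
\<close>

definition weyl_twist_proj ::
    "('b, 'm) star_algebra_scheme \<Rightarrow> 'b set \<Rightarrow> 'b weyl_triple set \<Rightarrow> 'b weyl_triple set" where
  "weyl_twist_proj A B \<sigma> = weyl_groupoid_rel A B `` \<sigma>"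

definition weyl_supp ::
    "('b, 'm) star_algebra_scheme \<Rightarrow> 'b set \<Rightarrow> 'b \<Rightarrow> 'b weyl_triple set set" where
  "weyl_supp A B n =
    {weyl_groupoid_class A B (weyl_map A B n y, n, y) | y. y \<in> weyl_dom A B n}"

definition weyl_twist_over ::
    "('b, 'm) star_algebra_scheme \<Rightarrow> 'b set \<Rightarrow> 'b weyl_triple set set \<Rightarrow> 'b weyl_triple set set"
  where "weyl_twist_over A B U = {\<sigma> \<in> weyl_twist A B. weyl_twist_proj A B \<sigma> \<in> U}"

abbreviation circle_top :: "complex topology" where
  "circle_top \<equiv> top_of_set (sphere 0 1)"

text \<open>The twist topology is the unique topology for which these charts are open embeddings.\<close>

definition weyl_twist_top ::
    "('b, 'm) star_algebra_scheme \<Rightarrow> 'b set \<Rightarrow> 'b weyl_triple set topology" where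
  "weyl_twist_top A B =
    (THE X. topspace X = weyl_twist A B \<and>
       (\<forall>n\<in>normalizers A B.
          openin X (weyl_twist_over A B (weyl_supp A B n)) \<and>
          homeomorphic_map
            (prod_topology (subtopology (spectrum A B) (weyl_dom A B n)) circle_top)
            (subtopology X (weyl_twist_over A B (weyl_supp A B n)))
            (\<lambda>(x, z). weyl_twist_class A B (weyl_map A B n x, z \<odot>\<^bsub>A\<^esub> n, x))))"


section \<open>Cocycles and twisted group algebras\<close>

definition two_cocycle :: "('g, 'm) monoid_scheme \<Rightarrow> ('g \<Rightarrow> 'g \<Rightarrow> complex) \<Rightarrow> bool" where
  "two_cocycle G c \<longleftrightarrow>
    (\<forall>g\<in>carrier G. \<forall>h\<in>carrier G. cmod (c g h) = 1) \<and>
    (\<forall>g\<in>carrier G. c g \<one>\<^bsub>G\<^esub> = 1 \<and> c \<one>\<^bsub>G\<^esub> g = 1) \<and>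
    (\<forall>g\<in>carrier G. \<forall>h\<in>carrier G. \<forall>k\<in>carrier G.
       c g (h \<otimes>\<^bsub>G\<^esub> k) * c h k = c (g \<otimes>\<^bsub>G\<^esub> h) k * c g h)"

definition symmetric_abelian_subgroup ::
    "('g, 'm) monoid_scheme \<Rightarrow> ('g \<Rightarrow> 'g \<Rightarrow> complex) \<Rightarrow> 'g set \<Rightarrow> bool" where
  "symmetric_abelian_subgroup G c S \<longleftrightarrow>
    subgroup S G \<and> comm_group (G\<lparr>carrier := S\<rparr>) \<and> (\<forall>s\<in>S. \<forall>t\<in>S. c s t = c t s)"

definition maximal_symmetric_abelian_subgroup ::
    "('g, 'm) monoid_scheme \<Rightarrow> ('g \<Rightarrow> 'g \<Rightarrow> complex) \<Rightarrow> 'g set \<Rightarrow> bool" where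
  "maximal_symmetric_abelian_subgroup G c S \<longleftrightarrow>
    symmetric_abelian_subgroup G c S \<and>
    (\<forall>S'. symmetric_abelian_subgroup G c S' \<and> S \<subseteq> S' \<longrightarrow> S' = S)"

definition centralizing :: "('g, 'm) monoid_scheme \<Rightarrow> 'g set \<Rightarrow> nat \<Rightarrow> 'g \<Rightarrow> bool" where
  "centralizing G S k \<nu> \<longleftrightarrow>
    (\<forall>t\<in>S. \<exists>j\<in>{1..k}. \<nu> \<otimes>\<^bsub>G\<^esub> (t [^]\<^bsub>G\<^esub> j) = (t [^]\<^bsub>G\<^esub> j) \<otimes>\<^bsub>G\<^esub> \<nu>)"

definition immediately_centralizing :: "('g, 'm) monoid_scheme \<Rightarrow> 'g set \<Rightarrow> bool" where
  "immediately_centralizing G S \<longleftrightarrow>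
    (\<forall>k\<ge>1. \<forall>\<nu>\<in>carrier G. centralizing G S k \<nu> \<longrightarrow> centralizing G S 1 \<nu>)"

text \<open>
  The left regular representation \<open>\<delta>\<^sub>g e\<^sub>h = c(g,h) e\<^bsub>gh\<^esub>\<close>, written as a formula for the
  \<open>k\<close>-th coordinate (the contribution of \<open>h = g\<^sup>-\<^sup>1k\<close>).
\<close>

definition delta ::
    "('g, 'm) monoid_scheme \<Rightarrow> ('g \<Rightarrow> 'g \<Rightarrow> complex) \<Rightarrow> 'g \<Rightarrow> 'g operator" where
  "delta G c g = (\<lambda>f\<in>ell2 (carrier G). \<lambda>k.
     if k \<in> carrier G
     then c g (inv\<^bsub>G\<^esub> g \<otimes>\<^bsub>G\<^esub> k) * f (inv\<^bsub>G\<^esub> g \<otimes>\<^bsub>G\<^esub> k) else 0)"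

definition delta_combination ::
    "('g, 'm) monoid_scheme \<Rightarrow> ('g \<Rightarrow> 'g \<Rightarrow> complex) \<Rightarrow> 'g set \<Rightarrow> ('g \<Rightarrow> complex) \<Rightarrow> 'g operator"
  where
  "delta_combination G c F a = (\<lambda>f\<in>ell2 (carrier G). \<lambda>k. \<Sum>g\<in>F. a g * delta G c g f k)"

text \<open>
  Norm closure, inside the bounded operators on the whole Hilbert space over \<open>G\<close>, of the
  finitely supported functions on a subset \<open>Y\<close> of \<open>G\<close>.  For \<open>Y = S\<close> this is the reduced
  twisted algebra of \<open>S\<close> viewed inside that of \<open>G\<close>.
\<close>

definition delta_closure ::
    "('g, 'm) monoid_scheme \<Rightarrow> ('g \<Rightarrow> 'g \<Rightarrow> complex) \<Rightarrow> 'g set \<Rightarrow> 'g operator set" where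
  "delta_closure G c Y =
    {T \<in> bounded_operators (carrier G).
       \<forall>\<epsilon>>0. \<exists>F a. finite F \<and> F \<subseteq> Y \<and>
         op_norm (carrier G) (op_diff (carrier G) T (delta_combination G c F a)) < \<epsilon>}"

definition twisted_reduced_algebra ::
    "('g, 'm) monoid_scheme \<Rightarrow> ('g \<Rightarrow> 'g \<Rightarrow> complex) \<Rightarrow> 'g operator star_algebra" where
  "twisted_reduced_algebra G c =
    \<lparr>carrier = delta_closure G c (carrier G),
     monoid.mult = compose (ell2 (carrier G)),
     one = (\<lambda>f\<in>ell2 (carrier G). f),
     zero = (\<lambda>f\<in>ell2 (carrier G). \<lambda>_. 0),
     add = op_add (carrier G),
     smult = op_scale (carrier G),
     adj = op_adjoint (carrier G)\<rparr>"


section \<open>The quotient action and its transformation groupoid\<close>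

definition coset_action ::
    "('g, 'm) monoid_scheme \<Rightarrow> ('g \<Rightarrow> 'g \<Rightarrow> complex) \<Rightarrow> 'g set \<Rightarrow> 'g set
      \<Rightarrow> ('g operator \<Rightarrow> complex) \<Rightarrow> ('g operator \<Rightarrow> complex)" where
  "coset_action G c S q =
    (THE a. \<forall>g\<in>q. a = weyl_map (twisted_reduced_algebra G c) (delta_closure G c S) (delta G c g))"

definition topologically_free ::
    "('q, 'm) monoid_scheme \<Rightarrow> 'x topology \<Rightarrow> ('q \<Rightarrow> 'x \<Rightarrow> 'x) \<Rightarrow> bool" where
  "topologically_free Q X \<alpha> \<longleftrightarrow>
    (\<forall>F. finite F \<and> F \<subseteq> carrier Q - {\<one>\<^bsub>Q\<^esub>} \<longrightarrow>
       X closure_of {x \<in> topspace X. \<forall>q\<in>F. \<alpha> q x \<noteq> x} = topspace X)"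

text \<open>The underlying space of the transformation groupoid of a discrete group \<open>Q\<close> on \<open>X\<close>.\<close>

definition transformation_groupoid_top ::
    "('q, 'm) monoid_scheme \<Rightarrow> 'x topology \<Rightarrow> ('q \<times> 'x) topology" where
  "transformation_groupoid_top Q X = prod_topology (discrete_topology (carrier Q)) X"

end

theory Submission
  imports Defs "HOL-Algebra.Generated_Groups"
begin

text \<open>
  For a normalizer \<open>n\<close> and a coset representative \<open>g\<close>, let \<open>w\<^sub>g = E(\<delta>\<^sub>g\<^sup>* n)\<close> be its Fourier coefficient in \<open>B\<close>,
  where \<open>E\<close> compresses an operator to the diagonal blocks indexed by the cosets of \<open>S\<close>.  Approximating
  \<open>n\<^sup>*\<close> by finite combinations of the \<open>\<delta>\<^sub>g\<close> shows that at every point of the domain of \<open>n\<close> some \<open>w\<^sub>g\<close> does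
  not vanish.  Since \<open>w\<^sub>g (n\<^sup>* b n) = (\<delta>\<^sub>g\<^sup>* b \<delta>\<^sub>g) w\<^sub>g n\<^sup>* n\<close>, coefficients in different cosets have
  orthogonal supports, for otherwise \<open>B\<close> would not be maximal abelian.  Hence
  \<open>n (w\<^sub>g n\<^sup>* n) = \<delta>\<^sub>g (w\<^sub>g\<^sup>2 n\<^sup>* n)\<close>: near each point of its domain, a normalizer is a function times some \<open>\<delta>\<^sub>g\<close>.
  So \<open>\<psi>\<close> is surjective, topological freeness makes it injective, and in the coordinates it provides
  every chart of the twist is locally multiplication by a continuous phase.  The topology transported
  along \<open>\<psi>\<close> therefore has the defining property of the twist topology, which determines it uniquely.
\<close>

section \<open>Square-summable families and bounded operators\<close>

text \<open>Spectrum and twist are given by algebraic data only, so elementary arguments replace the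
  usual C*-algebra theory. Characters are not assumed continuous: a Neumann series makes them
  contractive, and therefore T \<mapsto> x(E(T n)) is a bounded linear functional. If it vanished on
  every \<delta>_g it would vanish at T = n^*, where its value is x(n^* n). Positivity of x(n^* n)
  is read off from the local form of n. That B is maximal abelian is derived: the coefficients of an
  element commuting with B have constant modulus on S-conjugation orbits, so square-summability
  makes such orbits finite, and immediate centralizing together with maximality of S excludes
  coefficients off S. The coefficient w_g need not be invertible; the extra factor w_g n^* n is what
  annihilates the coefficients in all other cosets, and since the twist relation tolerates
  multipliers that are positive at the point, only the phase of w_g survives. Topological freeness
  is used a second time, to see that over the support of n the twist contains nothing but phase
  multiples of n.\<close>

lemma ell2_zero_outside: "f \<in> ell2 I \<Longrightarrow> k \<notin> I \<Longrightarrow> f k = 0"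
  by (simp add: ell2_def)

lemma ell2_norm_nonneg: "0 \<le> ell2_norm I f"
  by (simp add: ell2_norm_def infsum_nonneg)

text \<open>Reduces membership and norm estimates to finite index sets, where \<open>L2_set\<close>
  supplies the triangle and Cauchy-Schwarz inequalities. The bound for the empty set already forces
  \<open>C\<close> to be nonnegative.\<close>

lemma ell2I_bounded:
  assumes "\<And>k. k \<notin> I \<Longrightarrow> f k = 0"
    and bd: "\<And>F. finite F \<Longrightarrow> F \<subseteq> I \<Longrightarrow> L2_set (\<lambda>k. cmod (f k)) F \<le> C"
  shows "f \<in> ell2 I" and "ell2_norm I f \<le> C"
proof -
  have C: "0 \<le> C" using bd[of "{}"] by simp
  have sq: "(\<Sum>k\<in>F. (cmod (f k))\<^sup>2) \<le> C\<^sup>2" if "finite F" "F \<subseteq> I" for F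
    using bd[OF that] unfolding L2_set_def by (metis C real_sqrt_le_iff real_sqrt_unique)
  have summ: "(\<lambda>k. (cmod (f k))\<^sup>2) summable_on I"
    by (rule nonneg_bdd_above_summable_on) (auto intro!: bdd_aboveI[of _ "C\<^sup>2"] simp: sq)
  then show "f \<in> ell2 I" using assms(1) by (simp add: ell2_def)
  have "(\<Sum>\<^sub>\<infinity>k\<in>I. (cmod (f k))\<^sup>2) \<le> C\<^sup>2"
    by (rule infsum_le_finite_sums[OF summ]) (use sq in auto)
  then show "ell2_norm I f \<le> C"
    unfolding ell2_norm_def using C real_le_lsqrt by (simp add: real_le_lsqrt infsum_nonneg)
qed

lemma L2_set_le_ell2_norm:
  assumes "f \<in> ell2 I" "finite F" "F \<subseteq> I"
  shows "L2_set (\<lambda>k. cmod (f k)) F \<le> ell2_norm I f"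
  unfolding L2_set_def ell2_norm_def
  using assms by (auto simp: ell2_def intro!: finite_sum_le_infsum)

lemma cmod_le_ell2_norm:
  assumes "f \<in> ell2 I" shows "cmod (f k) \<le> ell2_norm I f"
proof (cases "k \<in> I")
  case True
  then show ?thesis using L2_set_le_ell2_norm[OF assms, of "{k}"] by simp
next
  case False
  then show ?thesis using assms by (simp add: ell2_zero_outside ell2_norm_nonneg)
qed

lemma ell2_norm_power2: "f \<in> ell2 I \<Longrightarrow> (ell2_norm I f)\<^sup>2 = (\<Sum>\<^sub>\<infinity>k\<in>I. (cmod (f k))\<^sup>2)"
  by (simp add: ell2_norm_def infsum_nonneg)

lemma ell2_zero: "(\<lambda>_. 0) \<in> ell2 I"
  by (simp add: ell2_def)

lemma ell2_norm_zero: "ell2_norm I (\<lambda>_. 0) = 0"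
  by (simp add: ell2_norm_def)

lemma
  assumes "f \<in> ell2 I" "h \<in> ell2 I"
  shows ell2_add: "(\<lambda>k. f k + h k) \<in> ell2 I"
    and ell2_norm_triangle: "ell2_norm I (\<lambda>k. f k + h k) \<le> ell2_norm I f + ell2_norm I h"
proof -
  have bd: "L2_set (\<lambda>k. cmod (f k + h k)) F \<le> ell2_norm I f + ell2_norm I h"
    if "finite F" "F \<subseteq> I" for F
  proof -
    have "L2_set (\<lambda>k. cmod (f k + h k)) F \<le> L2_set (\<lambda>k. cmod (f k) + cmod (h k)) F"
      by (rule L2_set_mono) (auto intro: norm_triangle_ineq)
    also have "\<dots> \<le> L2_set (\<lambda>k. cmod (f k)) F + L2_set (\<lambda>k. cmod (h k)) F"
      by (rule L2_set_triangle_ineq)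
    also have "\<dots> \<le> ell2_norm I f + ell2_norm I h"
      by (intro add_mono L2_set_le_ell2_norm assms that)
    finally show ?thesis .
  qed
  have z: "\<And>k. k \<notin> I \<Longrightarrow> f k + h k = 0" using assms by (simp add: ell2_zero_outside)
  show "(\<lambda>k. f k + h k) \<in> ell2 I" "ell2_norm I (\<lambda>k. f k + h k) \<le> ell2_norm I f + ell2_norm I h"
    using ell2I_bounded[OF z bd] by blast+
qed

lemma
  assumes "f \<in> ell2 I"
  shows ell2_scale: "(\<lambda>k. a * f k) \<in> ell2 I"
    and ell2_norm_scale: "ell2_norm I (\<lambda>k. a * f k) = cmod a * ell2_norm I f"
proof -
  have "(\<lambda>k. (cmod a)\<^sup>2 * (cmod (f k))\<^sup>2) summable_on I"
    using assms by (intro summable_on_cmult_right) (simp add: ell2_def)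
  then show "(\<lambda>k. a * f k) \<in> ell2 I"
    using assms by (auto simp: ell2_def norm_mult power_mult_distrib)
  have "(\<Sum>\<^sub>\<infinity>k\<in>I. (cmod (a * f k))\<^sup>2) = (cmod a)\<^sup>2 * (\<Sum>\<^sub>\<infinity>k\<in>I. (cmod (f k))\<^sup>2)"
    unfolding norm_mult power_mult_distrib by (rule infsum_cmult_right')
  then show "ell2_norm I (\<lambda>k. a * f k) = cmod a * ell2_norm I f"
    by (simp add: ell2_norm_def real_sqrt_mult)
qed

lemma ell2_diff:
  assumes "f \<in> ell2 I" "h \<in> ell2 I" shows "(\<lambda>k. f k - h k) \<in> ell2 I"
  using ell2_add[OF assms(1) ell2_scale[OF assms(2), of "-1"]] by simp

lemma ell2_norm_eq_0:
  assumes "f \<in> ell2 I" "ell2_norm I f \<le> 0" shows "f = (\<lambda>_. 0)"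
proof
  fix k show "f k = 0" using cmod_le_ell2_norm[OF assms(1), of k] assms(2)
    by (meson norm_le_zero_iff order_trans)
qed

text \<open>A Fatou argument: each finite partial norm passes to the limit, so coordinatewise
  convergence with bounded norms suffices.\<close>

lemma ell2_pointwise_limit:
  assumes f: "\<And>n. f n \<in> ell2 I" and C: "\<And>n. ell2_norm I (f n) \<le> C"
    and lim: "\<And>k. (\<lambda>n. f n k) \<longlonglongrightarrow> h k"
  shows "h \<in> ell2 I" "ell2_norm I h \<le> C"
proof -
  have z: "h k = 0" if "k \<notin> I" for k
    using lim[of k] ell2_zero_outside[OF f that] by (simp add: LIMSEQ_const_iff)
  have bd: "L2_set (\<lambda>k. cmod (h k)) F \<le> C" if "finite F" "F \<subseteq> I" for F
  proof (rule LIMSEQ_le_const2)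
    show "(\<lambda>n. L2_set (\<lambda>k. cmod (f n k)) F) \<longlonglongrightarrow> L2_set (\<lambda>k. cmod (h k)) F"
      unfolding L2_set_def by (intro tendsto_intros lim)
    show "\<exists>N. \<forall>n\<ge>N. L2_set (\<lambda>k. cmod (f n k)) F \<le> C"
      using L2_set_le_ell2_norm[OF f that] C order_trans by blast
  qed
  show "h \<in> ell2 I" "ell2_norm I h \<le> C" using ell2I_bounded[OF z bd] by blast+
qed

subsection \<open>Restrictions and basis vectors\<close>

definition restr :: "'g set \<Rightarrow> 'g vec \<Rightarrow> 'g vec" where
  "restr C f = (\<lambda>k. if k \<in> C then f k else 0)"

lemma
  assumes "f \<in> ell2 I"
  shows restr_ell2: "restr C f \<in> ell2 I"
    and restr_norm_le: "ell2_norm I (restr C f) \<le> ell2_norm I f"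
proof -
  have bd: "L2_set (\<lambda>k. cmod (restr C f k)) F \<le> ell2_norm I f" if "finite F" "F \<subseteq> I" for F
    by (rule order_trans[OF L2_set_mono L2_set_le_ell2_norm[OF assms that]]) (auto simp: restr_def)
  have z: "\<And>k. k \<notin> I \<Longrightarrow> restr C f k = 0" using assms by (simp add: restr_def ell2_zero_outside)
  show "restr C f \<in> ell2 I" "ell2_norm I (restr C f) \<le> ell2_norm I f"
    using ell2I_bounded[OF z bd] by blast+
qed

lemma restr_add: "restr C (\<lambda>k. f k + h k) = (\<lambda>k. restr C f k + restr C h k)"
  by (auto simp: restr_def)

lemma restr_scale: "restr C (\<lambda>k. a * f k) = (\<lambda>k. a * restr C f k)"
  by (auto simp: restr_def)

lemma restr_norm_power2:
  assumes "f \<in> ell2 I"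
  shows "(ell2_norm I (restr C f))\<^sup>2 = (\<Sum>\<^sub>\<infinity>k\<in>I \<inter> C. (cmod (f k))\<^sup>2)"
  unfolding ell2_norm_power2[OF restr_ell2[OF assms]]
  by (rule infsum_cong_neutral) (auto simp: restr_def)

text \<open>Pythagoras over pairwise disjoint blocks. Applied to cosets of \<open>S\<close>, it
  shows that compressing an operator to diagonal blocks does not increase its bound.\<close>

lemma sum_restr_norm_le:
  assumes f: "f \<in> ell2 I" and "finite \<C>" and disj: "disjoint \<C>"
  shows "(\<Sum>C\<in>\<C>. (ell2_norm I (restr C f))\<^sup>2) \<le> (ell2_norm I f)\<^sup>2"
proof -
  have "(\<Sum>C\<in>\<C>. (ell2_norm I (restr C f))\<^sup>2) = (ell2_norm I (restr (\<Union>\<C>) f))\<^sup>2"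
    using \<open>finite \<C>\<close> disj
  proof (induction \<C>)
    case empty
    then show ?case by (simp add: restr_def ell2_norm_zero)
  next
    case (insert C \<C>)
    have s: "(\<lambda>k. (cmod (f k))\<^sup>2) summable_on J" if "J \<subseteq> I" for J
      using f that unfolding ell2_def by (auto intro: summable_on_subset_banach)
    have d: "(I \<inter> C) \<inter> (I \<inter> \<Union>\<C>) = {}"
      using insert.prems insert.hyps by (auto simp: disjoint_def)
    have "(ell2_norm I (restr (\<Union>(insert C \<C>)) f))\<^sup>2
        = (\<Sum>\<^sub>\<infinity>k\<in>(I \<inter> C) \<union> (I \<inter> \<Union>\<C>). (cmod (f k))\<^sup>2)"
      unfolding restr_norm_power2[OF f] by (rule arg_cong2[where f=infsum]) auto
    also have "\<dots> = (ell2_norm I (restr C f))\<^sup>2 + (ell2_norm I (restr (\<Union>\<C>) f))\<^sup>2"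
      unfolding restr_norm_power2[OF f] by (rule infsum_Un_disjoint[OF s s d]) auto
    finally show ?case using insert by (auto simp: disjoint_def)
  qed
  also have "\<dots> \<le> (ell2_norm I f)\<^sup>2"
    by (intro power_mono restr_norm_le f ell2_norm_nonneg)
  finally show ?thesis .
qed

lemma restr_approx:
  assumes f: "f \<in> ell2 I" and e: "e > 0"
  obtains F where "finite F" "F \<subseteq> I" "ell2_norm I (\<lambda>k. f k - restr F f k) \<le> e"
proof -
  have summ: "(\<lambda>k. (cmod (f k))\<^sup>2) summable_on I" using f by (simp add: ell2_def)
  obtain F where F: "finite F" "F \<subseteq> I"
    and app: "dist (\<Sum>k\<in>F. (cmod (f k))\<^sup>2) (\<Sum>\<^sub>\<infinity>k\<in>I. (cmod (f k))\<^sup>2) \<le> e\<^sup>2"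
    using infsum_finite_approximation[OF summ, of "e\<^sup>2"] e by auto
  have s: "(\<lambda>k. (cmod (f k))\<^sup>2) summable_on J" if "J \<subseteq> I" for J
    using summ that by (rule summable_on_subset_banach)
  have eq: "(\<lambda>k. f k - restr F f k) = restr (- F) f" by (auto simp: restr_def)
  have "(\<Sum>\<^sub>\<infinity>k\<in>F \<union> (I \<inter> - F). (cmod (f k))\<^sup>2)
      = (\<Sum>\<^sub>\<infinity>k\<in>F. (cmod (f k))\<^sup>2) + (\<Sum>\<^sub>\<infinity>k\<in>I \<inter> - F. (cmod (f k))\<^sup>2)"
    by (rule infsum_Un_disjoint) (use F in \<open>auto intro: s\<close>)
  moreover have "F \<union> (I \<inter> - F) = I" using F by auto
  ultimately have "(\<Sum>\<^sub>\<infinity>k\<in>I. (cmod (f k))\<^sup>2) = (\<Sum>k\<in>F. (cmod (f k))\<^sup>2) + (ell2_norm I (restr (- F) f))\<^sup>2"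
    using F unfolding restr_norm_power2[OF f] by simp
  with app have "(ell2_norm I (restr (- F) f))\<^sup>2 \<le> e\<^sup>2" by (simp add: dist_real_def)
  then have "ell2_norm I (restr (- F) f) \<le> e" using e by (simp add: power2_le_iff_abs_le)
  then show ?thesis using that F eq by simp
qed

definition unit_vec :: "'g \<Rightarrow> 'g vec" where
  "unit_vec k = (\<lambda>j. if j = k then 1 else 0)"

lemma
  assumes "k \<in> I"
  shows unit_vec_ell2: "unit_vec k \<in> ell2 I" and unit_vec_norm: "ell2_norm I (unit_vec k) \<le> 1"
proof -
  have bd: "L2_set (\<lambda>j. cmod (unit_vec k j)) F \<le> 1" if "finite F" "F \<subseteq> I" for F
  proof -
    have "(\<Sum>j\<in>F. (cmod (unit_vec k j))\<^sup>2) = (\<Sum>j\<in>F. if j = k then 1 else 0)"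
      by (rule sum.cong) (auto simp: unit_vec_def)
    also have "\<dots> \<le> 1" using that by simp
    finally show ?thesis by (simp add: L2_set_def)
  qed
  have z: "\<And>j. j \<notin> I \<Longrightarrow> unit_vec k j = 0" using assms by (auto simp: unit_vec_def)
  show "unit_vec k \<in> ell2 I" "ell2_norm I (unit_vec k) \<le> 1"
    using ell2I_bounded[OF z bd] by blast+
qed

subsection \<open>The inner product\<close>

lemma
  assumes f: "f \<in> ell2 I" and h: "h \<in> ell2 I"
  shows ell2_inner_abs_summable: "(\<lambda>k. norm (f k * cnj (h k))) summable_on I"
    and ell2_inner_bound: "cmod (ell2_inner I f h) \<le> ell2_norm I f * ell2_norm I h"
proof -
  have bd: "(\<Sum>k\<in>F. norm (f k * cnj (h k))) \<le> ell2_norm I f * ell2_norm I h"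
    if "finite F" "F \<subseteq> I" for F
  proof -
    have "(\<Sum>k\<in>F. norm (f k * cnj (h k))) = (\<Sum>k\<in>F. \<bar>cmod (f k)\<bar> * \<bar>cmod (h k)\<bar>)"
      by (simp add: norm_mult)
    also have "\<dots> \<le> L2_set (\<lambda>k. cmod (f k)) F * L2_set (\<lambda>k. cmod (h k)) F"
      by (rule L2_set_mult_ineq)
    also have "\<dots> \<le> ell2_norm I f * ell2_norm I h"
      by (intro mult_mono L2_set_le_ell2_norm f h that L2_set_nonneg ell2_norm_nonneg)
    finally show ?thesis .
  qed
  show summ: "(\<lambda>k. norm (f k * cnj (h k))) summable_on I"
    by (rule nonneg_bdd_above_summable_on)
      (auto intro!: bdd_aboveI[of _ "ell2_norm I f * ell2_norm I h"] simp: bd)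
  have "cmod (ell2_inner I f h) \<le> (\<Sum>\<^sub>\<infinity>k\<in>I. norm (f k * cnj (h k)))"
    unfolding ell2_inner_def by (rule norm_infsum_bound[OF summ])
  also have "\<dots> \<le> ell2_norm I f * ell2_norm I h"
    by (rule infsum_le_finite_sums[OF summ]) (use bd in auto)
  finally show "cmod (ell2_inner I f h) \<le> ell2_norm I f * ell2_norm I h" .
qed

lemma ell2_inner_summable:
  "f \<in> ell2 I \<Longrightarrow> h \<in> ell2 I \<Longrightarrow> (\<lambda>k. f k * cnj (h k)) summable_on I"
  by (rule Infinite_Sum.abs_summable_summable[OF ell2_inner_abs_summable])

lemma ell2_inner_add_left:
  assumes "f \<in> ell2 I" "f' \<in> ell2 I" "h \<in> ell2 I"
  shows "ell2_inner I (\<lambda>k. f k + f' k) h = ell2_inner I f h + ell2_inner I f' h"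
  unfolding ell2_inner_def distrib_right
  by (intro infsum_add ell2_inner_summable assms)

lemma ell2_inner_scale_left: "ell2_inner I (\<lambda>k. a * f k) h = a * ell2_inner I f h"
  unfolding ell2_inner_def mult.assoc by (rule infsum_cmult_right')

lemma ell2_inner_cnj: "ell2_inner I h f = cnj (ell2_inner I f h)"
  unfolding ell2_inner_def infsum_cnj[symmetric] by (simp add: mult.commute)

lemma ell2_inner_add_right:
  assumes "f \<in> ell2 I" "h \<in> ell2 I" "h' \<in> ell2 I"
  shows "ell2_inner I f (\<lambda>k. h k + h' k) = ell2_inner I f h + ell2_inner I f h'"
  by (subst (1 2 3) ell2_inner_cnj) (simp add: ell2_inner_add_left assms)

lemma ell2_inner_scale_right: "ell2_inner I f (\<lambda>k. a * h k) = cnj a * ell2_inner I f h"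
  by (subst (1 2) ell2_inner_cnj) (simp add: ell2_inner_scale_left)

lemma ell2_inner_unit_left:
  assumes "k \<in> I" shows "ell2_inner I (unit_vec k) h = cnj (h k)"
proof -
  have "ell2_inner I (unit_vec k) h = (\<Sum>\<^sub>\<infinity>j\<in>{k}. cnj (h j))"
    unfolding ell2_inner_def by (rule infsum_cong_neutral) (use assms in \<open>auto simp: unit_vec_def\<close>)
  then show ?thesis by simp
qed

lemma ell2_eqI_inner:
  assumes "u \<in> ell2 I" "v \<in> ell2 I"
    and "\<And>f. f \<in> ell2 I \<Longrightarrow> ell2_inner I f u = ell2_inner I f v"
  shows "u = v"
proof
  fix k
  show "u k = v k"
  proof (cases "k \<in> I")
    case True
    then show ?thesis
      using assms(3)[OF unit_vec_ell2[OF True]] by (simp add: ell2_inner_unit_left)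
  qed (use assms in \<open>simp add: ell2_zero_outside\<close>)
qed

subsection \<open>Bounded operators\<close>

text \<open>A relation instead of the supremum in \<open>op_norm\<close>: estimates then combine
  without side conditions on boundedness. \<open>op_norm_le\<close> and
  \<open>op_bound_op_norm\<close> translate between the two.\<close>

definition op_bound :: "'g set \<Rightarrow> 'g operator \<Rightarrow> real \<Rightarrow> bool" where
  "op_bound I T C \<longleftrightarrow> (\<forall>f\<in>ell2 I. ell2_norm I (T f) \<le> C * ell2_norm I f)"

lemma bounded_operatorsI:
  assumes "\<And>f. f \<notin> ell2 I \<Longrightarrow> T f = undefined"
    and "\<And>f. f \<in> ell2 I \<Longrightarrow> T f \<in> ell2 I"
    and "\<And>f h. f \<in> ell2 I \<Longrightarrow> h \<in> ell2 I \<Longrightarrow> T (\<lambda>k. f k + h k) = (\<lambda>k. T f k + T h k)"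
    and "\<And>a f. f \<in> ell2 I \<Longrightarrow> T (\<lambda>k. a * f k) = (\<lambda>k. a * T f k)"
    and "op_bound I T C"
  shows "T \<in> bounded_operators I"
  using assms unfolding bounded_operators_def op_bound_def by (auto simp: PiE_def extensional_def)

lemma
  assumes "T \<in> bounded_operators I"
  shows bounded_operators_undefined: "f \<notin> ell2 I \<Longrightarrow> T f = undefined"
    and bounded_operators_ell2: "f \<in> ell2 I \<Longrightarrow> T f \<in> ell2 I"
    and bounded_operators_add:
      "f \<in> ell2 I \<Longrightarrow> h \<in> ell2 I \<Longrightarrow> T (\<lambda>k. f k + h k) = (\<lambda>k. T f k + T h k)"
    and bounded_operators_scale: "f \<in> ell2 I \<Longrightarrow> T (\<lambda>k. a * f k) = (\<lambda>k. a * T f k)"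
  using assms unfolding bounded_operators_def by (auto simp: PiE_def extensional_def)

lemma bounded_operators_bound:
  assumes "T \<in> bounded_operators I"
  obtains C where "0 \<le> C" "op_bound I T C"
proof -
  obtain C where "\<forall>f\<in>ell2 I. ell2_norm I (T f) \<le> C * ell2_norm I f"
    using assms unfolding bounded_operators_def by blast
  then have "op_bound I T (max 0 C)" unfolding op_bound_def
    by (meson ell2_norm_nonneg max.cobounded2 mult_right_mono order_trans)
  then show ?thesis using that[of "max 0 C"] by simp
qed

lemma bounded_operators_eqI:
  assumes "T \<in> bounded_operators I" "U \<in> bounded_operators I"
    and "\<And>f. f \<in> ell2 I \<Longrightarrow> T f = U f"
  shows "T = U"
  using assms bounded_operators_undefined by (metis ext)

lemma bounded_operators_diff:
  assumes T: "T \<in> bounded_operators I" and "f \<in> ell2 I" "h \<in> ell2 I"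
  shows "T (\<lambda>k. f k - h k) = (\<lambda>k. T f k - T h k)"
  using bounded_operators_add[OF T assms(2) ell2_scale[OF assms(3), of "-1"]]
    bounded_operators_scale[OF T assms(3), of "-1"] by simp

lemma bounded_operators_zero:
  assumes T: "T \<in> bounded_operators I" shows "T (\<lambda>_. 0) = (\<lambda>_. 0)"
  using bounded_operators_scale[OF T ell2_zero, of 0] by simp

lemma op_boundD: "op_bound I T C \<Longrightarrow> f \<in> ell2 I \<Longrightarrow> ell2_norm I (T f) \<le> C * ell2_norm I f"
  by (simp add: op_bound_def)

lemma op_bound_mono: "op_bound I T C \<Longrightarrow> C \<le> D \<Longrightarrow> op_bound I T D"
  unfolding op_bound_def by (meson ell2_norm_nonneg mult_right_mono order_trans)

lemma op_norm_le:
  assumes "op_bound I T C" "0 \<le> C" shows "op_norm I T \<le> C"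
  unfolding op_norm_def
proof (rule cSup_least)
  show "{ell2_norm I (T f) |f. f \<in> ell2 I \<and> ell2_norm I f \<le> 1} \<noteq> {}"
    using ell2_zero[of I] by (auto simp: ell2_norm_zero intro!: exI[of _ "\<lambda>_. 0"])
  fix y assume "y \<in> {ell2_norm I (T f) |f. f \<in> ell2 I \<and> ell2_norm I f \<le> 1}"
  then obtain f where f: "f \<in> ell2 I" "ell2_norm I f \<le> 1" "y = ell2_norm I (T f)" by auto
  have "y \<le> C * ell2_norm I f" using op_boundD[OF assms(1)] f by simp
  also have "\<dots> \<le> C" using f assms(2) mult_left_le by blast
  finally show "y \<le> C" .
qed

lemma op_bound_op_norm:
  assumes T: "T \<in> bounded_operators I" shows "op_bound I T (op_norm I T)"
  unfolding op_bound_def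
proof
  fix f assume f: "f \<in> ell2 I"
  obtain C where C: "0 \<le> C" "op_bound I T C" using bounded_operators_bound[OF T] .
  have bdd: "bdd_above {ell2_norm I (T f) |f. f \<in> ell2 I \<and> ell2_norm I f \<le> 1}"
  proof (rule bdd_aboveI)
    fix y assume "y \<in> {ell2_norm I (T f) |f. f \<in> ell2 I \<and> ell2_norm I f \<le> 1}"
    then obtain f where f: "f \<in> ell2 I" "ell2_norm I f \<le> 1" "y = ell2_norm I (T f)" by auto
    have "y \<le> C * ell2_norm I f" using op_boundD[OF C(2)] f by simp
    also have "\<dots> \<le> C" using f C mult_left_le by blast
    finally show "y \<le> C" .
  qed
  show "ell2_norm I (T f) \<le> op_norm I T * ell2_norm I f"
  proof (cases "ell2_norm I f = 0")
    case True
    then show ?thesis using op_boundD[OF C(2) f] by simp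
  next
    case False
    then have pos: "ell2_norm I f > 0" using ell2_norm_nonneg[of I f] by simp
    define a where "a = complex_of_real (1 / ell2_norm I f)"
    have af: "(\<lambda>k. a * f k) \<in> ell2 I" "ell2_norm I (\<lambda>k. a * f k) = 1"
      using pos by (simp_all add: ell2_scale f ell2_norm_scale, simp add: a_def norm_divide)
    have "ell2_norm I (T (\<lambda>k. a * f k)) \<le> op_norm I T"
      unfolding op_norm_def by (rule cSup_upper[OF _ bdd]) (use af in auto)
    then have "cmod a * ell2_norm I (T f) \<le> op_norm I T"
      by (simp add: bounded_operators_scale[OF T f] ell2_norm_scale bounded_operators_ell2[OF T f])
    then show ?thesis using pos by (simp add: a_def norm_divide field_simps)
  qed
qed

lemma
  assumes T: "op_bound I T C" "\<And>f. f \<in> ell2 I \<Longrightarrow> T f \<in> ell2 I"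
    and U: "op_bound I U D" "\<And>f. f \<in> ell2 I \<Longrightarrow> U f \<in> ell2 I"
  shows op_bound_add: "op_bound I (op_add I T U) (C + D)"
    and op_bound_scale: "op_bound I (op_scale I a T) (cmod a * C)"
    and op_bound_compose: "0 \<le> C \<Longrightarrow> op_bound I (compose (ell2 I) T U) (C * D)"
proof -
  show "op_bound I (op_add I T U) (C + D)" unfolding op_bound_def
  proof
    fix f assume f: "f \<in> ell2 I"
    have "ell2_norm I (op_add I T U f) \<le> ell2_norm I (T f) + ell2_norm I (U f)"
      using ell2_norm_triangle[OF T(2)[OF f] U(2)[OF f]] f by (simp add: op_add_def)
    then show "ell2_norm I (op_add I T U f) \<le> (C + D) * ell2_norm I f"
      using op_boundD[OF T(1) f] op_boundD[OF U(1) f] by (simp add: distrib_right)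
  qed
  show "op_bound I (op_scale I a T) (cmod a * C)" unfolding op_bound_def
  proof
    fix f assume f: "f \<in> ell2 I"
    show "ell2_norm I (op_scale I a T f) \<le> cmod a * C * ell2_norm I f"
      using op_boundD[OF T(1) f] f T(2)[OF f]
      by (simp add: op_scale_def ell2_norm_scale mult.assoc mult_left_mono)
  qed
  assume C: "0 \<le> C"
  show "op_bound I (compose (ell2 I) T U) (C * D)" unfolding op_bound_def
  proof
    fix f assume f: "f \<in> ell2 I"
    have "ell2_norm I (T (U f)) \<le> C * ell2_norm I (U f)" by (rule op_boundD[OF T(1) U(2)[OF f]])
    also have "\<dots> \<le> C * (D * ell2_norm I f)" by (rule mult_left_mono[OF op_boundD[OF U(1) f] C])
    finally show "ell2_norm I (compose (ell2 I) T U f) \<le> C * D * ell2_norm I f"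
      using f by (simp add: compose_def mult.assoc)
  qed
qed

lemma bounded_operators_op_add:
  assumes T: "T \<in> bounded_operators I" and U: "U \<in> bounded_operators I"
  shows "op_add I T U \<in> bounded_operators I"
proof -
  obtain C D where CD: "op_bound I T C" "op_bound I U D"
    using bounded_operators_bound[OF T] bounded_operators_bound[OF U] by metis
  note b = bounded_operators_ell2[OF T] bounded_operators_ell2[OF U]
  show ?thesis
    by (rule bounded_operatorsI[OF _ _ _ _ op_bound_add[OF CD(1) b(1) CD(2) b(2)]])
      (auto simp: op_add_def ell2_add b ell2_scale bounded_operators_add[OF T]
        bounded_operators_add[OF U] bounded_operators_scale[OF T] bounded_operators_scale[OF U]
        algebra_simps)
qed

lemma bounded_operators_op_scale:
  assumes T: "T \<in> bounded_operators I"
  shows "op_scale I a T \<in> bounded_operators I"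
proof -
  obtain C where C: "op_bound I T C" using bounded_operators_bound[OF T] by metis
  note b = bounded_operators_ell2[OF T]
  show ?thesis
    by (rule bounded_operatorsI[OF _ _ _ _ op_bound_scale[OF C b C b]])
      (auto simp: op_scale_def ell2_add b ell2_scale bounded_operators_add[OF T]
        bounded_operators_scale[OF T] algebra_simps)
qed

lemma op_diff_conv: "op_diff I T U = op_add I T (op_scale I (-1) U)"
  by (auto simp: op_diff_def op_add_def op_scale_def restrict_def fun_eq_iff)

lemma bounded_operators_op_diff:
  assumes T: "T \<in> bounded_operators I" and U: "U \<in> bounded_operators I"
  shows "op_diff I T U \<in> bounded_operators I"
  unfolding op_diff_conv by (intro bounded_operators_op_add bounded_operators_op_scale assms)

lemma bounded_operators_compose:
  assumes T: "T \<in> bounded_operators I" and U: "U \<in> bounded_operators I"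
  shows "compose (ell2 I) T U \<in> bounded_operators I"
proof -
  obtain C D where CD: "op_bound I T C" "op_bound I U D" and C: "0 \<le> C"
    using bounded_operators_bound[OF T] bounded_operators_bound[OF U] by metis
  note b = bounded_operators_ell2[OF T] bounded_operators_ell2[OF U]
  show ?thesis
    by (rule bounded_operatorsI[OF _ _ _ _ op_bound_compose[OF CD(1) b(1) CD(2) b(2) C]])
      (auto simp: compose_def ell2_add b ell2_scale bounded_operators_add[OF T]
        bounded_operators_add[OF U] bounded_operators_scale[OF T] bounded_operators_scale[OF U])
qed

lemma
  shows bounded_operators_zero_op: "(\<lambda>f\<in>ell2 I. \<lambda>_. 0) \<in> bounded_operators I"
    and op_bound_zero_op: "op_bound I (\<lambda>f\<in>ell2 I. \<lambda>_. 0) 0"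
proof -
  show *: "op_bound I (\<lambda>f\<in>ell2 I. \<lambda>_. 0) 0" by (simp add: op_bound_def ell2_norm_zero)
  show "(\<lambda>f\<in>ell2 I. \<lambda>_. 0) \<in> bounded_operators I"
    by (rule bounded_operatorsI[OF _ _ _ _ *]) (auto simp: ell2_zero ell2_add ell2_scale)
qed

lemma bounded_operators_id: "(\<lambda>f\<in>ell2 I. f) \<in> bounded_operators I"
  by (rule bounded_operatorsI[of _ _ 1]) (auto simp: ell2_add ell2_scale op_bound_def)

text \<open>Finitely supported vectors are dense.\<close>

lemma ell2_functional_eq_0:
  assumes f: "f \<in> ell2 I"
    and \<Phi>_add: "\<And>f h. f \<in> ell2 I \<Longrightarrow> h \<in> ell2 I \<Longrightarrow> \<Phi> (\<lambda>k. f k + h k) = \<Phi> f + \<Phi> h"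
    and \<Phi>_scale: "\<And>a f. f \<in> ell2 I \<Longrightarrow> \<Phi> (\<lambda>k. a * f k) = a * \<Phi> f"
    and \<Phi>_bound: "\<And>f. f \<in> ell2 I \<Longrightarrow> cmod (\<Phi> f) \<le> C * ell2_norm I f"
    and \<Phi>_unit: "\<And>k. k \<in> I \<Longrightarrow> \<Phi> (unit_vec k) = 0"
  shows "\<Phi> f = (0 :: complex)"
proof -
  have \<Phi>0: "\<Phi> (\<lambda>_. 0) = 0" using \<Phi>_scale[OF ell2_zero, of 0] by simp
  have fin: "\<Phi> (restr F f) = 0" if "finite F" "F \<subseteq> I" for F
    using that
  proof (induction F)
    case empty
    then show ?case by (simp add: restr_def \<Phi>0)
  next
    case (insert k F)
    have "restr (insert k F) f = (\<lambda>j. f k * unit_vec k j + restr F f j)"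
      using insert.hyps by (auto simp: restr_def unit_vec_def)
    then show ?case
      using insert by (simp add: \<Phi>_add \<Phi>_scale \<Phi>_unit ell2_scale unit_vec_ell2 restr_ell2[OF f])
  qed
  \<comment> \<open>The finite part contributes 0, so the error vector carries all of
    \<open>\<Phi> f\<close>. The sign of \<open>C\<close> is unknown, whence \<open>max 0 C\<close>;
    the 1 added to it below keeps the divisor positive.\<close>
  have "cmod (\<Phi> f) \<le> max 0 C * e" if e: "e > 0" for e
  proof -
    obtain F where F: "finite F" "F \<subseteq> I" "ell2_norm I (\<lambda>k. f k - restr F f k) \<le> e"
      using restr_approx[OF f e] .
    have d: "(\<lambda>k. f k - restr F f k) \<in> ell2 I" by (intro ell2_diff f restr_ell2)
    have "\<Phi> f = \<Phi> (\<lambda>k. (f k - restr F f k) + restr F f k)" by simp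
    also have "\<dots> = \<Phi> (\<lambda>k. f k - restr F f k)"
      by (subst \<Phi>_add[OF d restr_ell2[OF f]]) (simp add: fin F)
    finally have "cmod (\<Phi> f) \<le> C * ell2_norm I (\<lambda>k. f k - restr F f k)" using \<Phi>_bound[OF d] by simp
    also have "\<dots> \<le> max 0 C * e" using F(3) ell2_norm_nonneg[of I] by (intro mult_mono) auto
    finally show ?thesis .
  qed
  then have *: "cmod (\<Phi> f) \<le> max 0 C * e" if "e > 0" for e using that by blast
  have "cmod (\<Phi> f) \<le> 0"
  proof (rule field_le_epsilon)
    fix e :: real assume e: "e > 0"
    have "cmod (\<Phi> f) \<le> max 0 C * (e / (max 0 C + 1))" by (rule *) (use e in \<open>simp add: field_simps add_pos_nonneg\<close>)
    also have "\<dots> \<le> e" using e by (simp add: field_simps)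
    finally show "cmod (\<Phi> f) \<le> 0 + e" by simp
  qed
  then show ?thesis by simp
qed

lemma bounded_operators_eq_0I:
  assumes T: "T \<in> bounded_operators I" and "\<And>k. k \<in> I \<Longrightarrow> T (unit_vec k) = (\<lambda>_. 0)"
  shows "T = (\<lambda>f\<in>ell2 I. \<lambda>_. 0)"
proof (rule bounded_operators_eqI[OF T bounded_operators_zero_op])
  fix f assume f: "f \<in> ell2 I"
  obtain C where C: "op_bound I T C" using bounded_operators_bound[OF T] by metis
  have "T f k = 0" for k
    by (rule ell2_functional_eq_0[OF f, of "\<lambda>f. T f k" C])
      (auto simp: bounded_operators_add[OF T] bounded_operators_scale[OF T] assms(2)
        intro: order_trans[OF cmod_le_ell2_norm[OF bounded_operators_ell2[OF T]] op_boundD[OF C]])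
  then show "T f = (\<lambda>f\<in>ell2 I. \<lambda>_. 0) f" using f by auto
qed

subsection \<open>Adjoints\<close>

text \<open>The adjoint is written down through its matrix: its value on \<open>h\<close> has k-th
  coordinate \<open>cnj\<close> of the inner product of \<open>T (unit_vec k)\<close> with
  \<open>h\<close>. The adjoint identity then holds on unit vectors by construction and extends by
  density.\<close>

lemma op_adjoint_exists:
  assumes T: "T \<in> bounded_operators I" and C: "op_bound I T C" "0 \<le> C"
  shows "\<exists>U. U \<in> bounded_operators I \<and> op_bound I U C \<and>
    (\<forall>f\<in>ell2 I. \<forall>h\<in>ell2 I. ell2_inner I (T f) h = ell2_inner I f (U h))"
proof -
  define U where "U = (\<lambda>h\<in>ell2 I. \<lambda>k. if k \<in> I then cnj (ell2_inner I (T (unit_vec k)) h) else 0)"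
  note Tl = bounded_operators_ell2[OF T]
  have fin: "ell2_inner I (T (restr F f)) h = (\<Sum>k\<in>F. f k * cnj (U h k))"
    if "finite F" "F \<subseteq> I" "f \<in> ell2 I" "h \<in> ell2 I" for F f h
    using that(1,2)
  proof (induction F)
    case empty
    then show ?case
      using ell2_inner_scale_left[of I 0] by (simp add: restr_def bounded_operators_zero[OF T])
  next
    case (insert k F)
    have k: "k \<in> I" using insert by simp
    have "restr (insert k F) f = (\<lambda>j. f k * unit_vec k j + restr F f j)"
      using insert.hyps by (auto simp: restr_def unit_vec_def)
    then have "T (restr (insert k F) f) = (\<lambda>j. f k * T (unit_vec k) j + T (restr F f) j)"
      by (simp add: bounded_operators_add[OF T] bounded_operators_scale[OF T] ell2_scale
          unit_vec_ell2[OF k] restr_ell2[OF that(3)])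
    then have "ell2_inner I (T (restr (insert k F) f)) h
        = f k * ell2_inner I (T (unit_vec k)) h + ell2_inner I (T (restr F f)) h"
      by (simp add: ell2_inner_add_left ell2_scale Tl unit_vec_ell2[OF k] restr_ell2[OF that(3)]
          that ell2_inner_scale_left)
    then show ?case using insert k that(4) by (simp add: U_def)
  qed
  have Ubd: "U h \<in> ell2 I \<and> ell2_norm I (U h) \<le> C * ell2_norm I h" if h: "h \<in> ell2 I" for h
  proof -
    have z: "U h k = 0" if "k \<notin> I" for k using that h by (simp add: U_def)
    have "L2_set (\<lambda>k. cmod (U h k)) F \<le> C * ell2_norm I h" if F: "finite F" "F \<subseteq> I" for F
    proof -
      \<comment> \<open>Testing against the truncation of \<open>U h\<close> itself turns the inner
        product of \<open>T f\<close> with \<open>h\<close> into the squared norm of that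
        truncation; one factor then cancels.\<close>
      define f where "f = restr F (U h)"
      have bd: "L2_set (\<lambda>k. cmod (f k)) J \<le> L2_set (\<lambda>k. cmod (U h k)) F" if "finite J" "J \<subseteq> I" for J
      proof -
        have "L2_set (\<lambda>k. cmod (f k)) J = L2_set (\<lambda>k. cmod (U h k)) (J \<inter> F)"
          unfolding L2_set_def f_def restr_def
          by (intro arg_cong[of _ _ sqrt]) (auto simp: sum.inter_restrict that intro!: sum.cong)
        also have "\<dots> \<le> L2_set (\<lambda>k. cmod (U h k)) F"
          unfolding L2_set_def using F by (auto intro!: sum_mono2)
        finally show ?thesis .
      qed
      have f: "f \<in> ell2 I" "ell2_norm I f \<le> L2_set (\<lambda>k. cmod (U h k)) F"
        using ell2I_bounded[of I f, OF _ bd] F by (auto simp: f_def restr_def z)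
      have rf: "restr F f = f" by (auto simp: f_def restr_def)
      have "ell2_inner I (T f) h = (\<Sum>k\<in>F. f k * cnj (U h k))"
        using fin[OF F f(1) h] by (simp add: rf)
      also have "\<dots> = of_real ((L2_set (\<lambda>k. cmod (U h k)) F)\<^sup>2)"
        unfolding L2_set_def
        by (simp add: f_def restr_def sum_nonneg flip: complex_norm_square)
      finally have "(L2_set (\<lambda>k. cmod (U h k)) F)\<^sup>2 = cmod (ell2_inner I (T f) h)"
        by (simp add: norm_power)
      also have "\<dots> \<le> ell2_norm I (T f) * ell2_norm I h"
        by (rule ell2_inner_bound[OF Tl[OF f(1)] h])
      also have "\<dots> \<le> (C * ell2_norm I f) * ell2_norm I h"
        by (rule mult_right_mono[OF op_boundD[OF C(1) f(1)] ell2_norm_nonneg])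
      also have "\<dots> \<le> (C * L2_set (\<lambda>k. cmod (U h k)) F) * ell2_norm I h"
        by (intro mult_right_mono mult_left_mono f C ell2_norm_nonneg)
      finally have "L2_set (\<lambda>k. cmod (U h k)) F * L2_set (\<lambda>k. cmod (U h k)) F
          \<le> (C * ell2_norm I h) * L2_set (\<lambda>k. cmod (U h k)) F"
        by (simp add: power2_eq_square mult_ac)
      then show ?thesis
        by (metis L2_set_nonneg C(2) ell2_norm_nonneg mult_nonneg_nonneg mult_right_le_imp_le order_le_less)
    qed
    then show ?thesis using ell2I_bounded[of I "U h", OF z] by blast
  qed
  have UB: "op_bound I U C" using Ubd by (auto simp: op_bound_def)
  have Ubop: "U \<in> bounded_operators I"
  proof (rule bounded_operatorsI[OF _ _ _ _ UB])
    show "U f \<in> ell2 I" if "f \<in> ell2 I" for f using Ubd that by blast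
  qed (auto simp: U_def ell2_add ell2_scale ell2_inner_add_right Tl unit_vec_ell2
      ell2_inner_scale_right)
  have "ell2_inner I (T f) h = ell2_inner I f (U h)" if f: "f \<in> ell2 I" and h: "h \<in> ell2 I" for f h
  proof -
    have "ell2_inner I (T f) h - ell2_inner I f (U h) = 0"
    proof (rule ell2_functional_eq_0[OF f, where C = "2 * C * ell2_norm I h"])
      fix f assume f: "f \<in> ell2 I"
      have "cmod (ell2_inner I (T f) h) \<le> ell2_norm I (T f) * ell2_norm I h"
        by (rule ell2_inner_bound[OF Tl[OF f] h])
      also have "\<dots> \<le> C * ell2_norm I f * ell2_norm I h"
        by (rule mult_right_mono[OF op_boundD[OF C(1) f] ell2_norm_nonneg])
      finally have 1: "cmod (ell2_inner I (T f) h) \<le> C * ell2_norm I f * ell2_norm I h" .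
      have "cmod (ell2_inner I f (U h)) \<le> ell2_norm I f * ell2_norm I (U h)"
        by (rule ell2_inner_bound) (use f h Ubd in auto)
      also have "\<dots> \<le> ell2_norm I f * (C * ell2_norm I h)"
        by (intro mult_left_mono ell2_norm_nonneg) (use Ubd h in auto)
      finally have 2: "cmod (ell2_inner I f (U h)) \<le> C * ell2_norm I f * ell2_norm I h"
        by (simp add: mult_ac)
      show "cmod (ell2_inner I (T f) h - ell2_inner I f (U h)) \<le> 2 * C * ell2_norm I h * ell2_norm I f"
        using norm_triangle_ineq4[of "ell2_inner I (T f) h" "ell2_inner I f (U h)"] 1 2
        by (simp add: mult_ac)
    next
      fix k assume "k \<in> I"
      then show "ell2_inner I (T (unit_vec k)) h - ell2_inner I (unit_vec k) (U h) = 0"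
        using h by (simp add: ell2_inner_unit_left U_def)
    qed (use h Ubd in \<open>auto simp: bounded_operators_add[OF T] bounded_operators_scale[OF T]
          ell2_inner_add_left ell2_inner_scale_left Tl algebra_simps\<close>)
    then show ?thesis by simp
  qed
  then show ?thesis using Ubop UB by blast
qed

lemma op_adjoint_unique:
  assumes "U \<in> bounded_operators I" "V \<in> bounded_operators I"
    and "\<And>f h. f \<in> ell2 I \<Longrightarrow> h \<in> ell2 I \<Longrightarrow> ell2_inner I f (U h) = ell2_inner I f (V h)"
  shows "U = V"
  using assms by (intro bounded_operators_eqI ell2_eqI_inner) (auto intro: bounded_operators_ell2)

lemma op_adjoint_eqI:
  assumes "U \<in> bounded_operators I"
    and "\<And>f h. f \<in> ell2 I \<Longrightarrow> h \<in> ell2 I \<Longrightarrow> ell2_inner I (T f) h = ell2_inner I f (U h)"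
  shows "op_adjoint I T = U"
  unfolding op_adjoint_def
  by (rule the_equality) (use assms in \<open>auto intro!: op_adjoint_unique\<close>)

lemma
  assumes T: "T \<in> bounded_operators I"
  shows op_adjoint_bounded: "op_adjoint I T \<in> bounded_operators I"
    and op_adjoint_inner: "f \<in> ell2 I \<Longrightarrow> h \<in> ell2 I \<Longrightarrow>
      ell2_inner I (T f) h = ell2_inner I f (op_adjoint I T h)"
    and op_adjoint_op_bound: "op_bound I T C \<Longrightarrow> 0 \<le> C \<Longrightarrow> op_bound I (op_adjoint I T) C"
proof -
  have *: "op_adjoint I T \<in> bounded_operators I \<and> op_bound I (op_adjoint I T) C \<and>
      (\<forall>f\<in>ell2 I. \<forall>h\<in>ell2 I. ell2_inner I (T f) h = ell2_inner I f (op_adjoint I T h))"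
    if "op_bound I T C" "0 \<le> C" for C
    using op_adjoint_exists[OF T that] op_adjoint_eqI by metis
  obtain D where "op_bound I T D" "0 \<le> D" using bounded_operators_bound[OF T] by metis
  from *[OF this] show "op_adjoint I T \<in> bounded_operators I"
    and "f \<in> ell2 I \<Longrightarrow> h \<in> ell2 I \<Longrightarrow> ell2_inner I (T f) h = ell2_inner I f (op_adjoint I T h)"
    by auto
  show "op_bound I T C \<Longrightarrow> 0 \<le> C \<Longrightarrow> op_bound I (op_adjoint I T) C" using * by blast
qed

lemma op_adjoint_inner_right:
  assumes T: "T \<in> bounded_operators I" and "f \<in> ell2 I" "h \<in> ell2 I"
  shows "ell2_inner I (op_adjoint I T f) h = ell2_inner I f (T h)"
  using op_adjoint_inner[OF T assms(3,2)] ell2_inner_cnj by metis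

lemma op_adjoint_adjoint:
  assumes T: "T \<in> bounded_operators I" shows "op_adjoint I (op_adjoint I T) = T"
  by (rule op_adjoint_eqI[OF T op_adjoint_inner_right[OF T]])

lemma op_adjoint_compose:
  assumes T: "T \<in> bounded_operators I" and U: "U \<in> bounded_operators I"
  shows "op_adjoint I (compose (ell2 I) T U) = compose (ell2 I) (op_adjoint I U) (op_adjoint I T)"
  by (rule op_adjoint_eqI, blast intro: bounded_operators_compose bounded_operators_op_scale
      bounded_operators_op_add op_adjoint_bounded T U)
    (auto intro!: bounded_operators_compose op_adjoint_bounded T U
      simp: compose_def op_adjoint_inner[OF T] op_adjoint_inner[OF U]
        bounded_operators_ell2[OF U] bounded_operators_ell2[OF op_adjoint_bounded[OF T]])

lemma op_adjoint_scale:
  assumes T: "T \<in> bounded_operators I"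
  shows "op_adjoint I (op_scale I a T) = op_scale I (cnj a) (op_adjoint I T)"
  by (rule op_adjoint_eqI, blast intro: bounded_operators_compose bounded_operators_op_scale
      bounded_operators_op_add op_adjoint_bounded T)
    (auto intro!: bounded_operators_op_scale op_adjoint_bounded T
      simp: op_scale_def ell2_inner_scale_left ell2_inner_scale_right op_adjoint_inner[OF T])

lemma op_adjoint_add:
  assumes T: "T \<in> bounded_operators I" and U: "U \<in> bounded_operators I"
  shows "op_adjoint I (op_add I T U) = op_add I (op_adjoint I T) (op_adjoint I U)"
  by (rule op_adjoint_eqI, blast intro: bounded_operators_compose bounded_operators_op_scale
      bounded_operators_op_add op_adjoint_bounded T U)
    (auto intro!: bounded_operators_op_add op_adjoint_bounded T U
      simp: op_add_def ell2_inner_add_left ell2_inner_add_right op_adjoint_inner[OF T]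
        op_adjoint_inner[OF U] bounded_operators_ell2[OF T] bounded_operators_ell2[OF U]
        bounded_operators_ell2[OF op_adjoint_bounded[OF T]]
        bounded_operators_ell2[OF op_adjoint_bounded[OF U]])

subsection \<open>Completeness\<close>

text \<open>The limit is taken coordinate by coordinate; the estimate survives because
  \<open>e n\<close> does not depend on \<open>m\<close>. The rate \<open>e\<close> is kept in the
  conclusion, since the Neumann series needs it explicitly.\<close>

lemma bounded_operators_complete:
  assumes T: "\<And>n. T n \<in> bounded_operators I"
    and Cauchy: "\<And>m n. op_bound I (op_diff I (T (n + m)) (T n)) (e n)"
    and e: "e \<longlonglongrightarrow> 0"
  obtains L where "L \<in> bounded_operators I" "\<And>n. op_bound I (op_diff I L (T n)) (e n)"
proof -
  have conv: "convergent (\<lambda>n. T n f k)" if f: "f \<in> ell2 I" for f k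
  proof -
    have "Cauchy (\<lambda>n. T n f k)"
    proof (rule CauchyI')
      fix d :: real assume d: "d > 0"
      have "(\<lambda>n. e n * ell2_norm I f) \<longlonglongrightarrow> 0 * ell2_norm I f" by (intro tendsto_intros e)
      then have "eventually (\<lambda>n. e n * ell2_norm I f < d) sequentially"
        using d by (intro order_tendstoD(2)) auto
      then obtain N where N: "\<And>n. n \<ge> N \<Longrightarrow> e n * ell2_norm I f < d"
        by (auto simp: eventually_sequentially)
      show "\<exists>M. \<forall>m\<ge>M. \<forall>n>m. dist (T m f k) (T n f k) < d"
      proof (intro exI[of _ N] allI impI)
        fix m n assume mn: "m \<ge> N" "n > m"
        define p where "p = n - m"
        have n: "n = m + p" using mn by (simp add: p_def)
        have "dist (T m f k) (T n f k) = cmod ((\<lambda>k. T n f k - T m f k) k)"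
          by (simp add: dist_norm norm_minus_commute)
        also have "\<dots> \<le> ell2_norm I (\<lambda>k. T n f k - T m f k)"
          by (rule cmod_le_ell2_norm[OF ell2_diff]) (auto intro: bounded_operators_ell2 T f)
        also have "\<dots> \<le> e m * ell2_norm I f"
          using op_boundD[OF Cauchy[of m p] f] f by (simp add: n op_diff_def)
        also have "\<dots> < d" by (rule N[OF mn(1)])
        finally show "dist (T m f k) (T n f k) < d" .
      qed
    qed
    then show ?thesis by (simp add: Cauchy_convergent_iff)
  qed
  define L where "L = (\<lambda>f\<in>ell2 I. \<lambda>k. lim (\<lambda>n. T n f k))"
  have lim: "(\<lambda>n. T n f k) \<longlonglongrightarrow> L f k" if "f \<in> ell2 I" for f k
    using conv[OF that, of k] that by (simp add: L_def convergent_LIMSEQ_iff)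
  have D: "(\<lambda>k. L f k - T n f k) \<in> ell2 I \<and> ell2_norm I (\<lambda>k. L f k - T n f k) \<le> e n * ell2_norm I f"
    if f: "f \<in> ell2 I" for f n
  proof -
    have 1: "(\<lambda>k. T (n + m) f k - T n f k) \<in> ell2 I" for m
      by (intro ell2_diff bounded_operators_ell2[OF T f])
    have 2: "ell2_norm I (\<lambda>k. T (n + m) f k - T n f k) \<le> e n * ell2_norm I f" for m
      using op_boundD[OF Cauchy[of n m] f] f by (simp add: op_diff_def)
    have 3: "(\<lambda>m. T (n + m) f k - T n f k) \<longlonglongrightarrow> L f k - T n f k" for k
      by (intro tendsto_diff tendsto_const LIMSEQ_ignore_initial_segment[OF lim[OF f], of n, unfolded add.commute[of _ n]])
    show ?thesis using ell2_pointwise_limit[OF 1 2 3] by blast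
  qed
  have Ll: "L f \<in> ell2 I" if f: "f \<in> ell2 I" for f
    using ell2_add[OF conjunct1[OF D[OF f, of 0]] bounded_operators_ell2[OF T f, of 0]] by simp
  have Lb: "op_bound I (op_diff I L (T n)) (e n)" for n
    using D by (auto simp: op_bound_def op_diff_def)
  obtain C0 where C0: "op_bound I (T 0) C0" using bounded_operators_bound[OF T[of 0]] by metis
  have LB: "op_bound I L (e 0 + C0)" unfolding op_bound_def
  proof
    fix f assume f: "f \<in> ell2 I"
    have "ell2_norm I (\<lambda>k. (L f k - T 0 f k) + T 0 f k) \<le> ell2_norm I (\<lambda>k. L f k - T 0 f k) + ell2_norm I (T 0 f)"
      by (rule ell2_norm_triangle) (use D f bounded_operators_ell2[OF T f] in auto)
    also have "\<dots> \<le> e 0 * ell2_norm I f + C0 * ell2_norm I f"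
      by (intro add_mono op_boundD[OF C0 f]) (use D f in auto)
    finally show "ell2_norm I (L f) \<le> (e 0 + C0) * ell2_norm I f" by (simp add: distrib_right)
  qed
  have "L \<in> bounded_operators I"
  proof (rule bounded_operatorsI[OF _ Ll _ _ LB])
    fix f h assume f: "f \<in> ell2 I" and h: "h \<in> ell2 I"
    show "L (\<lambda>k. f k + h k) = (\<lambda>k. L f k + L h k)"
    proof
      fix k
      have "(\<lambda>n. T n f k + T n h k) \<longlonglongrightarrow> L (\<lambda>k. f k + h k) k"
        using lim[OF ell2_add[OF f h], of k] by (simp add: bounded_operators_add[OF T f h])
      moreover have "(\<lambda>n. T n f k + T n h k) \<longlonglongrightarrow> L f k + L h k" by (intro tendsto_add lim f h)
      ultimately show "L (\<lambda>k. f k + h k) k = L f k + L h k" by (rule LIMSEQ_unique)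
    qed
  next
    fix a f assume f: "f \<in> ell2 I"
    show "L (\<lambda>k. a * f k) = (\<lambda>k. a * L f k)"
    proof
      fix k
      have "(\<lambda>n. a * T n f k) \<longlonglongrightarrow> L (\<lambda>k. a * f k) k"
        using lim[OF ell2_scale[OF f], of a k] by (simp add: bounded_operators_scale[OF T f])
      moreover have "(\<lambda>n. a * T n f k) \<longlonglongrightarrow> a * L f k" by (intro tendsto_mult tendsto_const lim f)
      ultimately show "L (\<lambda>k. a * f k) k = a * L f k" by (rule LIMSEQ_unique)
    qed
  qed (auto simp: L_def)
  then show ?thesis using that Lb by blast
qed

section \<open>Weyl twists of unital star algebras with a commutative star subalgebra\<close>

text \<open>Products, adjoints and characters are all that the Weyl construction uses, so it is
  carried out without a norm. Properties of the reduced group algebra enter through later extensions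
  of this locale.\<close>

locale star_pair = monoid A
  for A :: "('b, 'm) star_algebra_scheme" (structure) +
  fixes B :: "'b set"
  assumes B_sub: "B \<subseteq> carrier A"
    and one_B: "\<one> \<in> B"
    and add_B: "a \<in> B \<Longrightarrow> b \<in> B \<Longrightarrow> a \<oplus> b \<in> B"
    and mult_B: "a \<in> B \<Longrightarrow> b \<in> B \<Longrightarrow> a \<otimes> b \<in> B"
    and smult_B: "b \<in> B \<Longrightarrow> z \<odot> b \<in> B"
    and adj_B: "b \<in> B \<Longrightarrow> adj A b \<in> B"
    and comm_B: "a \<in> B \<Longrightarrow> b \<in> B \<Longrightarrow> a \<otimes> b = b \<otimes> a"
    and smult_closed: "a \<in> carrier A \<Longrightarrow> z \<odot> a \<in> carrier A"
    and adj_closed: "a \<in> carrier A \<Longrightarrow> adj A a \<in> carrier A"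
    and smult_mult: "a \<in> carrier A \<Longrightarrow> b \<in> carrier A \<Longrightarrow> (z \<odot> a) \<otimes> b = z \<odot> (a \<otimes> b)"
    and mult_smult: "a \<in> carrier A \<Longrightarrow> b \<in> carrier A \<Longrightarrow> a \<otimes> (z \<odot> b) = z \<odot> (a \<otimes> b)"
    and smult_smult: "a \<in> carrier A \<Longrightarrow> z \<odot> (w \<odot> a) = (z * w) \<odot> a"
    and smult_one: "a \<in> carrier A \<Longrightarrow> 1 \<odot> a = a"
    and mult_add: "a \<in> carrier A \<Longrightarrow> b \<in> carrier A \<Longrightarrow> d \<in> carrier A \<Longrightarrow>
      d \<otimes> (a \<oplus> b) = d \<otimes> a \<oplus> d \<otimes> b"
    and add_mult: "a \<in> carrier A \<Longrightarrow> b \<in> carrier A \<Longrightarrow> d \<in> carrier A \<Longrightarrow>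
      (a \<oplus> b) \<otimes> d = a \<otimes> d \<oplus> b \<otimes> d"
    and adj_mult: "a \<in> carrier A \<Longrightarrow> b \<in> carrier A \<Longrightarrow> adj A (a \<otimes> b) = adj A b \<otimes> adj A a"
    and adj_adj: "a \<in> carrier A \<Longrightarrow> adj A (adj A a) = a"
    and adj_smult: "a \<in> carrier A \<Longrightarrow> adj A (z \<odot> a) = cnj z \<odot> adj A a"
begin

abbreviation "X \<equiv> characters A B"
abbreviation "N \<equiv> normalizers A B"
abbreviation "D \<equiv> weyl_dom A B"
abbreviation "Sp \<equiv> spectrum A B"

lemma B_carrier [simp]: "b \<in> B \<Longrightarrow> b \<in> carrier A" using B_sub by blast

declare adj_closed [simp] smult_closed [simp] one_B [simp] mult_B [simp] adj_B [simp]
  smult_B [simp] add_B [simp] adj_adj [simp]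

subsection \<open>Characters\<close>

lemma
  assumes "x \<in> X"
  shows char_add: "a \<in> B \<Longrightarrow> b \<in> B \<Longrightarrow> x (a \<oplus> b) = x a + x b"
    and char_smult: "b \<in> B \<Longrightarrow> x (z \<odot> b) = z * x b"
    and char_mult: "a \<in> B \<Longrightarrow> b \<in> B \<Longrightarrow> x (a \<otimes> b) = x a * x b"
    and char_adj: "b \<in> B \<Longrightarrow> x (adj A b) = cnj (x b)"
    and char_ext: "x \<in> extensional B"
  using assms unfolding characters_def by blast+

lemma char_one: assumes "x \<in> X" shows "x \<one> = 1"
proof -
  obtain b where b: "b \<in> B" "x b \<noteq> 0" using assms unfolding characters_def by blast
  have "x b = x b * x \<one>" using char_mult[OF assms b(1) one_B] b by simp
  then show ?thesis using b by simp
qed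

lemma char_eqI: "x \<in> X \<Longrightarrow> y \<in> X \<Longrightarrow> (\<And>b. b \<in> B \<Longrightarrow> x b = y b) \<Longrightarrow> x = y"
  using char_ext by (metis extensionalityI)

lemma topspace_spectrum: "topspace Sp = X"
  by (auto simp: spectrum_def characters_def PiE_def)

lemma spectrum_eval: "b \<in> B \<Longrightarrow> continuous_map Sp euclidean (\<lambda>x. x b)"
  unfolding spectrum_def
  by (intro continuous_map_from_subtopology continuous_map_product_projection)

lemma continuous_map_into_spectrum:
  assumes "\<And>z. z \<in> topspace Z \<Longrightarrow> f z \<in> X"
    and "\<And>b. b \<in> B \<Longrightarrow> continuous_map Z euclidean (\<lambda>z. f z b)"
  shows "continuous_map Z Sp f"
  unfolding spectrum_def continuous_map_in_subtopology continuous_map_componentwise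
  using assms char_ext by auto

lemma openin_char_neq_0: assumes "b \<in> B" shows "openin Sp {x \<in> X. x b \<noteq> 0}"
  using openin_continuous_map_preimage[OF spectrum_eval[OF assms], of "- {0}"]
  by (simp add: topspace_spectrum open_Compl)

subsection \<open>Normalizers\<close>

lemma
  assumes "n \<in> N"
  shows norm_carrier: "n \<in> carrier A"
    and norm_left: "b \<in> B \<Longrightarrow> n \<otimes> b \<otimes> adj A n \<in> B"
    and norm_right: "b \<in> B \<Longrightarrow> adj A n \<otimes> b \<otimes> n \<in> B"
  using assms unfolding normalizers_def by blast+

lemma
  assumes "n \<in> N"
  shows norm_mult_adj: "n \<otimes> adj A n \<in> B" and norm_adj_mult: "adj A n \<otimes> n \<in> B"
  using norm_left[OF assms one_B] norm_right[OF assms one_B] norm_carrier[OF assms] by auto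

lemma norm_adj: "n \<in> N \<Longrightarrow> adj A n \<in> N"
  unfolding normalizers_def by auto

lemma norm_smult:
  assumes n: "n \<in> N" shows "z \<odot> n \<in> N"
  using norm_left[OF n] norm_right[OF n] norm_carrier[OF n]
  unfolding normalizers_def by (auto simp: adj_smult smult_mult mult_smult)

text \<open>The closed form of \<open>\<alpha>\<^sub>n(x)\<close>; a junk value when \<open>x (n\<^sup>* n) = 0\<close>.\<close>

definition wmap :: "'b \<Rightarrow> ('b \<Rightarrow> complex) \<Rightarrow> ('b \<Rightarrow> complex)" where
  "wmap n x = (\<lambda>b\<in>B. x (adj A n \<otimes> b \<otimes> n) / x (adj A n \<otimes> n))"

text \<open>The element n n^* between the two conjugates lies in the commutative algebra
  \<open>B\<close> and can be moved past \<open>b\<close>. This makes \<alpha>_n(x)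
  multiplicative.\<close>

lemma norm_conj_mult:
  assumes n: "n \<in> N" and a: "a \<in> B" and b: "b \<in> B"
  shows "(adj A n \<otimes> a \<otimes> n) \<otimes> (adj A n \<otimes> b \<otimes> n)
    = (adj A n \<otimes> (a \<otimes> b) \<otimes> n) \<otimes> (adj A n \<otimes> n)"
proof -
  note [simp] = norm_carrier[OF n] a b
  have "(adj A n \<otimes> a \<otimes> n) \<otimes> (adj A n \<otimes> b \<otimes> n) = adj A n \<otimes> a \<otimes> ((n \<otimes> adj A n) \<otimes> b) \<otimes> n"
    by (simp add: m_assoc)
  also have "(n \<otimes> adj A n) \<otimes> b = b \<otimes> (n \<otimes> adj A n)"
    by (rule comm_B[OF norm_mult_adj[OF n] b])
  also have "adj A n \<otimes> a \<otimes> (b \<otimes> (n \<otimes> adj A n)) \<otimes> n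
      = (adj A n \<otimes> (a \<otimes> b) \<otimes> n) \<otimes> (adj A n \<otimes> n)"
    by (simp add: m_assoc)
  finally show ?thesis .
qed

lemma char_conj_mult:
  assumes n: "n \<in> N" and x: "x \<in> X" and a: "a \<in> B" and b: "b \<in> B"
  shows "x (adj A n \<otimes> a \<otimes> n) * x (adj A n \<otimes> b \<otimes> n)
    = x (adj A n \<otimes> (a \<otimes> b) \<otimes> n) * x (adj A n \<otimes> n)"
  using arg_cong[OF norm_conj_mult[OF n a b], of x] n a b
  by (simp add: char_mult[OF x] norm_right norm_adj_mult)

text \<open>By \<open>char_conj_mult\<close> with both arguments equal to \<open>b\<close>, the
  square of this value has x(n^* n) as a factor. It stands in for a Cauchy-Schwarz estimate with
  positive functionals.\<close>

lemma char_conj_eq_0: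
  assumes n: "n \<in> N" and x: "x \<in> X" and b: "b \<in> B" and "x (adj A n \<otimes> n) = 0"
  shows "x (adj A n \<otimes> b \<otimes> n) = 0"
  using char_conj_mult[OF n x b b] assms by simp

lemma wmap_char:
  assumes n: "n \<in> N" and x: "x \<in> X" and nz: "x (adj A n \<otimes> n) \<noteq> 0"
  shows "wmap n x \<in> X"
proof -
  note [simp] = norm_carrier[OF n] norm_right[OF n] char_add[OF x] char_smult[OF x] char_adj[OF x]
  have 1: "wmap n x \<one> = 1" using nz by (simp add: wmap_def)
  have 2: "wmap n x (a \<oplus> b) = wmap n x a + wmap n x b" if "a \<in> B" "b \<in> B" for a b
  proof -
    have "adj A n \<otimes> (a \<oplus> b) \<otimes> n = adj A n \<otimes> a \<otimes> n \<oplus> adj A n \<otimes> b \<otimes> n"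
      using that by (simp add: mult_add add_mult)
    then show ?thesis using that by (simp add: wmap_def add_divide_distrib)
  qed
  have 3: "wmap n x (z \<odot> b) = z * wmap n x b" if "b \<in> B" for z b
    using that by (simp add: wmap_def smult_mult mult_smult)
  have 4: "wmap n x (a \<otimes> b) = wmap n x a * wmap n x b" if "a \<in> B" "b \<in> B" for a b
    using that nz char_conj_mult[OF n x that] by (simp add: wmap_def field_simps)
  have 5: "wmap n x (adj A b) = cnj (wmap n x b)" if b: "b \<in> B" for b
  proof -
    have "adj A n \<otimes> adj A b \<otimes> n = adj A (adj A n \<otimes> b \<otimes> n)"
      using b by (simp add: adj_mult m_assoc)
    moreover have "cnj (x (adj A n \<otimes> n)) = x (adj A n \<otimes> n)"
      using char_adj[OF x norm_adj_mult[OF n]] by (simp add: adj_mult)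
    ultimately show ?thesis using b by (simp add: wmap_def)
  qed
  have 6: "wmap n x \<in> extensional B" by (simp add: wmap_def)
  have 7: "\<exists>b\<in>B. wmap n x b \<noteq> 0" using 1 by (intro bexI[of _ \<one>]) auto
  show ?thesis unfolding characters_def using 2 3 4 5 6 7 by blast
qed

lemma D_subset: "D n \<subseteq> X" by (auto simp: weyl_dom_def)

lemma D_D: "x \<in> D n \<Longrightarrow> x \<in> X \<and> x (adj A n \<otimes> n) > 0 \<and> x (adj A n \<otimes> n) \<noteq> 0"
  by (auto simp: weyl_dom_def)

lemma wmap_smult:
  assumes n: "n \<in> N" and x: "x \<in> X" and z: "cmod z = 1"
  shows "wmap (z \<odot> n) x = wmap n x" and "D (z \<odot> n) = D n"
proof -
  have zz: "cnj z * z = 1" using z by (metis complex_norm_square mult.commute of_real_1 one_power2)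
  have *: "adj A (z \<odot> n) \<otimes> b \<otimes> (z \<odot> n) = adj A n \<otimes> b \<otimes> n" if "b \<in> B" for b
    using that norm_carrier[OF n]
    by (simp add: adj_smult smult_mult mult_smult smult_smult smult_one zz mult.commute[of z])
  have **: "adj A (z \<odot> n) \<otimes> (z \<odot> n) = adj A n \<otimes> n"
    using norm_carrier[OF n]
    by (simp add: adj_smult smult_mult mult_smult smult_smult smult_one zz mult.commute[of z])
  show "wmap (z \<odot> n) x = wmap n x" "D (z \<odot> n) = D n"
    by (auto simp: wmap_def weyl_dom_def * ** cong: restrict_cong)
qed

lemma wmap_adj:
  assumes n: "n \<in> N" and x: "x \<in> D n"
  shows "wmap n x \<in> D (adj A n)" and "wmap (adj A n) (wmap n x) = x"
proof -
  note [simp] = norm_carrier[OF n] norm_right[OF n] norm_left[OF n] norm_mult_adj[OF n] norm_adj_mult[OF n]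
  have xX: "x \<in> X" and pos: "x (adj A n \<otimes> n) > 0" and nz: "x (adj A n \<otimes> n) \<noteq> 0"
    using D_D[OF x] by auto
  have eq: "adj A n \<otimes> (n \<otimes> b \<otimes> adj A n) \<otimes> n = (adj A n \<otimes> n) \<otimes> b \<otimes> (adj A n \<otimes> n)" if "b \<in> B" for b
    using that by (simp add: m_assoc)
  have eq1: "adj A n \<otimes> (n \<otimes> adj A n) \<otimes> n = (adj A n \<otimes> n) \<otimes> (adj A n \<otimes> n)"
    by (simp add: m_assoc)
  \<comment> \<open>Since conjugating n n^* by n gives the square of n^* n, the value of
    \<alpha>_n(x) at n n^* equals that of x at n^* n. Hence positivity is carried from the domain of
    \<open>n\<close> to that of its adjoint.\<close>
  have v: "wmap n x (n \<otimes> adj A n) = x (adj A n \<otimes> n)"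
    using nz by (simp add: wmap_def eq1 char_mult[OF xX])
  show "wmap n x \<in> D (adj A n)"
    using wmap_char[OF n xX nz] pos v by (simp add: weyl_dom_def)
  have "wmap (adj A n) (wmap n x) b = x b" if b: "b \<in> B" for b
    using b nz v by (simp add: wmap_def[of "adj A n"], simp add: wmap_def eq char_mult[OF xX])
  moreover have "wmap (adj A n) (wmap n x) \<in> extensional B" by (simp add: wmap_def)
  ultimately show "wmap (adj A n) (wmap n x) = x"
    using char_ext[OF xX] by (metis extensionalityI)
qed

lemma continuous_wmap:
  assumes n: "n \<in> N"
  shows "continuous_map (subtopology Sp (D n)) (subtopology Sp (D (adj A n))) (wmap n)"
proof -
  have "continuous_map (subtopology Sp (D n)) Sp (wmap n)"
  proof (rule continuous_map_into_spectrum)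
    fix b assume b: "b \<in> B"
    have 1: "continuous_map (subtopology Sp (D n)) euclidean (\<lambda>x. x (adj A n \<otimes> b \<otimes> n))"
      by (intro continuous_map_from_subtopology spectrum_eval norm_right n b)
    have 2: "continuous_map (subtopology Sp (D n)) (top_of_set (- {0})) (\<lambda>x. x (adj A n \<otimes> n))"
      using D_D continuous_map_from_subtopology[OF spectrum_eval[OF norm_adj_mult[OF n]]]
      by (auto simp: continuous_map_in_subtopology)
    have 3: "continuous_map (prod_topology euclidean (top_of_set (- {0}))) euclidean
        (\<lambda>p. fst p / snd p :: complex)"
    proof -
      have "continuous_on (UNIV \<times> - {0}) (\<lambda>p. fst p / snd p :: complex)"
        by (rule continuous_on_divide[OF continuous_on_fst[OF continuous_on_id] continuous_on_snd[OF continuous_on_id]]) auto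
      moreover have "prod_topology (euclidean :: complex topology) (top_of_set (- {0 :: complex})) = top_of_set (UNIV \<times> - {0})"
        using prod_topology_subtopology_eu[of "UNIV :: complex set" "- {0 :: complex}"] by simp
      ultimately show ?thesis by simp
    qed
    show "continuous_map (subtopology Sp (D n)) euclidean (\<lambda>x. wmap n x b)"
      using continuous_map_compose[OF continuous_map_pairedI[OF 1 2] 3] b
      by (simp add: wmap_def o_def)
  qed (use D_D wmap_char[OF n] in \<open>auto simp: topspace_spectrum\<close>)
  then show ?thesis
    using wmap_adj(1)[OF n] by (auto simp: continuous_map_in_subtopology topspace_spectrum)
qed

text \<open>Conjugating \<open>a\<close> by the common element n b = m b' relates the two conjugates
  up to the factors |x b|^2 and |x b'|^2; dividing by the instance a = 1 removes these. The
  multipliers need only be nonzero at \<open>x\<close>, because nonvanishing, unlike positivity,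
  persists on a neighbourhood.\<close>

lemma wmap_eq:
  assumes n: "n \<in> N" and m: "m \<in> N" and x: "x \<in> D n" "x \<in> D m"
    and b: "b \<in> B" "b' \<in> B" "x b \<noteq> 0" "x b' \<noteq> 0" and eq: "n \<otimes> b = m \<otimes> b'"
  shows "wmap n x = wmap m x"
proof -
  note [simp] = norm_carrier[OF n] norm_carrier[OF m] b(1,2)
    norm_right[OF n] norm_right[OF m] norm_adj_mult[OF n] norm_adj_mult[OF m]
  have xX: "x \<in> X" using D_D x by auto
  note [simp] = char_mult[OF xX] char_adj[OF xX]
  have *: "x (adj A n \<otimes> a \<otimes> n) * (x b * cnj (x b)) = x (adj A m \<otimes> a \<otimes> m) * (x b' * cnj (x b'))"
    if a: "a \<in> B" for a
  proof -
    have "adj A (n \<otimes> b) \<otimes> a \<otimes> (n \<otimes> b) = adj A (m \<otimes> b') \<otimes> a \<otimes> (m \<otimes> b')" by (simp add: eq)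
    then have "adj A b \<otimes> (adj A n \<otimes> a \<otimes> n) \<otimes> b = adj A b' \<otimes> (adj A m \<otimes> a \<otimes> m) \<otimes> b'"
      using a by (simp add: adj_mult m_assoc)
    from arg_cong[OF this, of x] show ?thesis using a by (simp add: mult_ac)
  qed
  have nz: "x (adj A n \<otimes> n) \<noteq> 0" "x (adj A m \<otimes> m) \<noteq> 0" using D_D x by auto
  have "x (adj A n \<otimes> a \<otimes> n) / x (adj A n \<otimes> n) = x (adj A m \<otimes> a \<otimes> m) / x (adj A m \<otimes> m)"
    if a: "a \<in> B" for a
  proof -
    have "x (adj A n \<otimes> a \<otimes> n) / x (adj A n \<otimes> n)
        = (x (adj A n \<otimes> a \<otimes> n) * (x b * cnj (x b))) / (x (adj A n \<otimes> n) * (x b * cnj (x b)))"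
      using b by simp
    also have "\<dots> = x (adj A m \<otimes> a \<otimes> m) / x (adj A m \<otimes> m)"
      using *[OF a] *[OF one_B] b by simp
    finally show ?thesis .
  qed
  then show ?thesis by (auto simp: wmap_def cong: restrict_cong)
qed

end

text \<open>
  Positivity of \<open>x (n\<^sup>* n)\<close> is automatic for C*-algebras; in this algebraic setting it is assumed.
\<close>

locale positive_star_pair = star_pair +
  assumes positive: "n \<in> normalizers A B \<Longrightarrow> x \<in> characters A B \<Longrightarrow>
    x (adj A n \<otimes> n) \<noteq> 0 \<Longrightarrow> x (adj A n \<otimes> n) > 0"
begin

lemma D_eq: "n \<in> N \<Longrightarrow> D n = {x \<in> X. x (adj A n \<otimes> n) \<noteq> 0}"
  using positive by (auto simp: weyl_dom_def)

lemma openin_D: "n \<in> N \<Longrightarrow> openin Sp (D n)"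
  by (simp add: D_eq openin_char_neq_0 norm_adj_mult)

text \<open>Evaluates the definite description. Existence: \<open>wmap\<close> for the adjoint is
  the inverse homeomorphism. Uniqueness: the equation fixes \<open>a x\<close> on \<open>B\<close>,
  and since \<open>a\<close> maps into the spectrum, \<open>a x\<close> is extensional and so fixed
  everywhere.\<close>

lemma weyl_map_eq:
  assumes n: "n \<in> N" shows "weyl_map A B n = restrict (wmap n) (D n)"
  unfolding weyl_map_def
proof (rule the_equality, intro conjI ballI)
  have "homeomorphic_maps (subtopology Sp (D n)) (subtopology Sp (D (adj A n))) (wmap n) (wmap (adj A n))"
    unfolding homeomorphic_maps_def
    using continuous_wmap[OF n] continuous_wmap[OF norm_adj[OF n]] wmap_adj[OF n]
      wmap_adj[OF norm_adj[OF n]] norm_carrier[OF n]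
    by (auto simp: topspace_spectrum)
  then have "homeomorphic_map (subtopology Sp (D n)) (subtopology Sp (D (adj A n))) (wmap n)"
    by (rule homeomorphic_maps_imp_map)
  then show "homeomorphic_map (subtopology Sp (D n)) (subtopology Sp (D (adj A n)))
      (restrict (wmap n) (D n))"
    by (rule homeomorphic_map_eq) (auto simp: topspace_spectrum)
  show "x (adj A n \<otimes> b \<otimes> n) = restrict (wmap n) (D n) x b * x (adj A n \<otimes> n)"
    if "b \<in> B" "x \<in> X" for b x
  proof (cases "x \<in> D n")
    case True
    then show ?thesis using D_D[OF True] that by (simp add: wmap_def)
  next
    case False
    then have "x (adj A n \<otimes> n) = 0" using that by (simp add: D_eq[OF n])
    then show ?thesis using char_conj_eq_0[OF n that(2,1)] by simp
  qed
next
  fix a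
  assume a: "a \<in> extensional (D n) \<and>
    homeomorphic_map (subtopology Sp (D n)) (subtopology Sp (D (adj A n))) a \<and>
    (\<forall>b\<in>B. \<forall>x\<in>X. x (adj A n \<otimes> b \<otimes> n) = a x b * x (adj A n \<otimes> n))"
  show "a = restrict (wmap n) (D n)"
  proof (rule extensionalityI[of _ "D n"])
    fix x assume x: "x \<in> D n"
    have "continuous_map (subtopology Sp (D n)) (subtopology Sp (D (adj A n))) a"
      using a by (blast intro: homeomorphic_imp_continuous_map)
    then have "a x \<in> topspace (subtopology Sp (D (adj A n)))"
      by (rule continuous_map_funspace[THEN PiE]) (use x D_D in \<open>auto simp: topspace_spectrum\<close>)
    then have "a x \<in> X" by (simp add: topspace_spectrum)
    moreover have "a x b = wmap n x b" if b: "b \<in> B" for b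
    proof -
      have "x (adj A n \<otimes> b \<otimes> n) = a x b * x (adj A n \<otimes> n)" using a b D_D[OF x] by blast
      then show ?thesis using D_D[OF x] b by (simp add: wmap_def)
    qed
    ultimately show "a x = restrict (wmap n) (D n) x"
      using x by (simp add: char_eqI[OF _ wmap_char[OF n]] D_D[OF x])
  qed (use a in auto)
qed auto

lemma weyl_map_apply: "n \<in> N \<Longrightarrow> x \<in> D n \<Longrightarrow> weyl_map A B n x = wmap n x"
  by (simp add: weyl_map_eq)

subsection \<open>The twist and its projection\<close>

text \<open>\<open>tw\<close> and \<open>loc\<close> are the twist and groupoid relations at a fixed
  base point, stripped of the redundant first entry of the triples.\<close>

definition tw :: "'a \<Rightarrow> 'a \<Rightarrow> ('a \<Rightarrow> complex) \<Rightarrow> bool" where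
  "tw n m x \<longleftrightarrow> (\<exists>b\<in>B. \<exists>b'\<in>B. x b > 0 \<and> x b' > 0 \<and> n \<otimes> b = m \<otimes> b')"

definition loc :: "'a \<Rightarrow> 'a \<Rightarrow> ('a \<Rightarrow> complex) \<Rightarrow> bool" where
  "loc n m x \<longleftrightarrow> (\<exists>U. openin Sp U \<and> x \<in> U \<and> U \<subseteq> D n \<inter> D m \<and> (\<forall>u\<in>U. wmap n u = wmap m u))"

abbreviation triple :: "'a \<Rightarrow> ('a \<Rightarrow> complex) \<Rightarrow> 'a weyl_triple" where
  "triple n x \<equiv> (weyl_map A B n x, n, x)"

abbreviation tcls :: "'a \<Rightarrow> ('a \<Rightarrow> complex) \<Rightarrow> 'a weyl_triple set" where
  "tcls n x \<equiv> weyl_twist_class A B (triple n x)"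

text \<open>The witnesses \<open>b\<close>, \<open>b'\<close> do not vanish at \<open>x\<close>,
  hence not on a neighbourhood, and there the same equation forces the two partial maps to agree.
  This is why the twist projects onto the groupoid.\<close>

lemma loc_of_tw:
  assumes n: "n \<in> N" and m: "m \<in> N" and x: "x \<in> D n" "x \<in> D m" and t: "tw n m x"
  shows "loc n m x"
proof -
  obtain b b' where b: "b \<in> B" "b' \<in> B" "x b > 0" "x b' > 0" "n \<otimes> b = m \<otimes> b'"
    using t by (auto simp: tw_def)
  define U where "U = D n \<inter> D m \<inter> {u \<in> X. u b \<noteq> 0} \<inter> {u \<in> X. u b' \<noteq> 0}"
  have "openin Sp U" unfolding U_def
    by (intro openin_Int openin_D openin_char_neq_0 n m b)
  moreover have "x \<in> U" using x b D_D[OF x(1)] by (auto simp: U_def)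
  moreover have "wmap n u = wmap m u" if "u \<in> U" for u
    by (rule wmap_eq[OF n m _ _ b(1,2) _ _ b(5)]) (use that in \<open>auto simp: U_def\<close>)
  ultimately show ?thesis unfolding loc_def by (auto simp: U_def intro!: exI[of _ U])
qed

lemma tw_refl: "n \<in> N \<Longrightarrow> x \<in> X \<Longrightarrow> tw n n x"
  unfolding tw_def by (intro bexI[of _ \<one>]) (auto simp: char_one less_complex_def)

lemma tw_sym: "tw n m x \<Longrightarrow> tw m n x"
  unfolding tw_def by metis

lemma tw_trans:
  assumes n: "n \<in> N" and m: "m \<in> N" and k: "k \<in> N" and x: "x \<in> X" and 1: "tw n m x" and 2: "tw m k x"
  shows "tw n k x"
proof -
  obtain b b' where b: "b \<in> B" "b' \<in> B" "x b > 0" "x b' > 0" "n \<otimes> b = m \<otimes> b'"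
    using 1 by (auto simp: tw_def)
  obtain d d' where d: "d \<in> B" "d' \<in> B" "x d > 0" "x d' > 0" "m \<otimes> d = k \<otimes> d'"
    using 2 by (auto simp: tw_def)
  note [simp] = b(1,2) d(1,2) norm_carrier[OF n] norm_carrier[OF m] norm_carrier[OF k]
  have "n \<otimes> (b \<otimes> d) = m \<otimes> (b' \<otimes> d)" using b(5) by (simp add: m_assoc[symmetric])
  also have "\<dots> = m \<otimes> d \<otimes> b'" by (simp add: comm_B m_assoc)
  also have "\<dots> = k \<otimes> (d' \<otimes> b')" by (simp add: d(5) m_assoc)
  finally have "n \<otimes> (b \<otimes> d) = k \<otimes> (d' \<otimes> b')" .
  moreover have "x (b \<otimes> d) > 0" "x (d' \<otimes> b') > 0"
    using b d by (auto simp: char_mult[OF x] less_complex_def)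
  ultimately show ?thesis unfolding tw_def by (meson b d mult_B)
qed

lemma triples_iff: "t \<in> weyl_triples A B \<longleftrightarrow> (\<exists>n\<in>N. \<exists>x\<in>D n. t = triple n x)"
  by (auto simp: weyl_triples_def)

lemma twist_rel_iff:
  "(s, t) \<in> weyl_twist_rel A B \<longleftrightarrow>
    (\<exists>n\<in>N. \<exists>m\<in>N. \<exists>x\<in>D n \<inter> D m. s = triple n x \<and> t = triple m x \<and> tw n m x)"
  by (auto simp: weyl_twist_rel_def weyl_triples_def tw_def; blast)

lemma groupoid_rel_iff:
  "(s, t) \<in> weyl_groupoid_rel A B \<longleftrightarrow>
    (\<exists>n\<in>N. \<exists>m\<in>N. \<exists>x\<in>D n \<inter> D m. s = triple n x \<and> t = triple m x \<and> loc n m x)"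
proof -
  have *: "(\<forall>u\<in>U. weyl_map A B n u = weyl_map A B m u) \<longleftrightarrow> (\<forall>u\<in>U. wmap n u = wmap m u)"
    if "U \<subseteq> D n \<inter> D m" "n \<in> N" "m \<in> N" for U n m
    using that weyl_map_apply by (metis IntD1 IntD2 subsetD)
  show ?thesis
    unfolding weyl_groupoid_rel_def weyl_triples_def loc_def
    using * by (auto; blast)
qed

lemma loc_sym: "loc n m x \<Longrightarrow> loc m n x"
  unfolding loc_def by (metis Int_commute)

lemma loc_trans:
  assumes "loc n m x" "loc m k x" shows "loc n k x"
proof -
  obtain U where U: "openin Sp U" "x \<in> U" "U \<subseteq> D n \<inter> D m" "\<forall>u\<in>U. wmap n u = wmap m u"
    using assms(1) unfolding loc_def by blast
  obtain V where V: "openin Sp V" "x \<in> V" "V \<subseteq> D m \<inter> D k" "\<forall>u\<in>V. wmap m u = wmap k u"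
    using assms(2) unfolding loc_def by blast
  show ?thesis unfolding loc_def using U V by (intro exI[of _ "U \<inter> V"]) auto
qed

lemma equiv_twist_rel: "equiv (weyl_triples A B) (weyl_twist_rel A B)"
proof (rule equivI)
  show "refl_on (weyl_triples A B) (weyl_twist_rel A B)"
  proof (rule refl_onI)
    fix t assume "t \<in> weyl_triples A B"
    then obtain n x where n: "n \<in> N" "x \<in> D n" "t = triple n x" unfolding triples_iff by blast
    have "tw n n x" using n tw_refl D_D by blast
    then show "(t, t) \<in> weyl_twist_rel A B" unfolding twist_rel_iff using n by blast
  qed
  show "sym (weyl_twist_rel A B)"
  proof (rule symI)
    fix s t assume "(s, t) \<in> weyl_twist_rel A B"
    then obtain n m x where "n \<in> N" "m \<in> N" "x \<in> D n \<inter> D m" "s = triple n x" "t = triple m x" "tw n m x"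
      unfolding twist_rel_iff by blast
    moreover from this have "tw m n x" by (simp add: tw_sym)
    ultimately show "(t, s) \<in> weyl_twist_rel A B" unfolding twist_rel_iff by blast
  qed
  show "trans (weyl_twist_rel A B)"
  proof (rule transI)
    fix s t r assume "(s, t) \<in> weyl_twist_rel A B" and "(t, r) \<in> weyl_twist_rel A B"
    then obtain n m x m' k x'
      where 1: "n \<in> N" "m \<in> N" "x \<in> D n \<inter> D m" "s = triple n x" "t = triple m x" "tw n m x"
        and 2: "m' \<in> N" "k \<in> N" "x' \<in> D m' \<inter> D k" "t = triple m' x'" "r = triple k x'" "tw m' k x'"
      unfolding twist_rel_iff by blast
    have eq: "m' = m" "x' = x" using 1 2 by auto
    have "tw n k x" by (rule tw_trans[of n m k]) (use 1 2 D_D eq in auto)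
    then show "(s, r) \<in> weyl_twist_rel A B"
      unfolding twist_rel_iff using 1 2 eq by blast
  qed
  show "weyl_twist_rel A B \<subseteq> weyl_triples A B \<times> weyl_triples A B"
    by (auto simp: weyl_twist_rel_def)
qed

lemma equiv_groupoid_rel: "equiv (weyl_triples A B) (weyl_groupoid_rel A B)"
proof (rule equivI)
  show "refl_on (weyl_triples A B) (weyl_groupoid_rel A B)"
  proof (rule refl_onI)
    fix t assume "t \<in> weyl_triples A B"
    then obtain n x where n: "n \<in> N" "x \<in> D n" "t = triple n x" unfolding triples_iff by blast
    have "loc n n x" using n loc_of_tw tw_refl D_D by blast
    then show "(t, t) \<in> weyl_groupoid_rel A B" unfolding groupoid_rel_iff using n by blast
  qed
  show "sym (weyl_groupoid_rel A B)"
  proof (rule symI)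
    fix s t assume "(s, t) \<in> weyl_groupoid_rel A B"
    then obtain n m x where "n \<in> N" "m \<in> N" "x \<in> D n \<inter> D m" "s = triple n x" "t = triple m x" "loc n m x"
      unfolding groupoid_rel_iff by blast
    moreover from this have "loc m n x" by (simp add: loc_sym)
    ultimately show "(t, s) \<in> weyl_groupoid_rel A B" unfolding groupoid_rel_iff by blast
  qed
  show "trans (weyl_groupoid_rel A B)"
  proof (rule transI)
    fix s t r assume "(s, t) \<in> weyl_groupoid_rel A B" and "(t, r) \<in> weyl_groupoid_rel A B"
    then obtain n m x m' k x'
      where 1: "n \<in> N" "m \<in> N" "x \<in> D n \<inter> D m" "s = triple n x" "t = triple m x" "loc n m x"
        and 2: "m' \<in> N" "k \<in> N" "x' \<in> D m' \<inter> D k" "t = triple m' x'" "r = triple k x'" "loc m' k x'"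
      unfolding groupoid_rel_iff by blast
    have eq: "m' = m" "x' = x" using 1 2 by auto
    have "loc n k x" by (rule loc_trans[of n m]) (use 1 2 eq in auto)
    then show "(s, r) \<in> weyl_groupoid_rel A B"
      unfolding groupoid_rel_iff using 1 2 eq by blast
  qed
  show "weyl_groupoid_rel A B \<subseteq> weyl_triples A B \<times> weyl_triples A B"
    by (auto simp: weyl_groupoid_rel_def)
qed

lemma tcls_eq_iff:
  assumes "n \<in> N" "m \<in> N" "x \<in> D n" "y \<in> D m"
  shows "tcls n x = tcls m y \<longleftrightarrow> x = y \<and> tw n m x"
proof -
  have "triple n x \<in> weyl_triples A B" "triple m y \<in> weyl_triples A B"
    using assms by (auto simp: triples_iff)
  then have "tcls n x = tcls m y \<longleftrightarrow> (triple n x, triple m y) \<in> weyl_twist_rel A B"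
    unfolding weyl_twist_class_def by (rule eq_equiv_class_iff[OF equiv_twist_rel])
  then show ?thesis using assms by (auto simp: twist_rel_iff)
qed

lemma twist_iff: "\<sigma> \<in> weyl_twist A B \<longleftrightarrow> (\<exists>n\<in>N. \<exists>x\<in>D n. \<sigma> = tcls n x)"
  unfolding weyl_twist_def quotient_def weyl_twist_class_def by (auto simp: triples_iff; blast)

lemma proj_tcls:
  assumes n: "n \<in> N" and x: "x \<in> D n"
  shows "weyl_twist_proj A B (tcls n x) = weyl_groupoid_class A B (triple n x)"
proof -
  have sub: "weyl_twist_rel A B \<subseteq> weyl_groupoid_rel A B"
    using loc_of_tw by (auto simp: twist_rel_iff groupoid_rel_iff)
  have refl: "(triple n x, triple n x) \<in> weyl_twist_rel A B"
    using n x tw_refl D_D by (auto simp: twist_rel_iff)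
  have tr: "trans (weyl_groupoid_rel A B)" using equiv_groupoid_rel by (simp add: equiv_def)
  show ?thesis
    unfolding weyl_twist_proj_def weyl_twist_class_def weyl_groupoid_class_def
    using sub refl transD[OF tr] by blast
qed

text \<open>Working form of the fibre over a support: the representative \<open>m\<close> only has
  to share the germ of \<open>n\<close>. That the class is nevertheless a phase multiple of that of
  \<open>n\<close> is a separate fact, supplied by \<open>chart_image\<close>.\<close>

lemma over_supp_iff:
  assumes n: "n \<in> N"
  shows "\<sigma> \<in> weyl_twist_over A B (weyl_supp A B n) \<longleftrightarrow>
    (\<exists>m\<in>N. \<exists>x\<in>D m \<inter> D n. \<sigma> = tcls m x \<and> loc m n x)" (is "?L \<longleftrightarrow> ?R")
proof
  have gc: "weyl_groupoid_class A B (triple m x) = weyl_groupoid_class A B (triple n y)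
      \<longleftrightarrow> x = y \<and> loc m n x" if "m \<in> N" "x \<in> D m" "y \<in> D n" for m x y
  proof -
    have "triple m x \<in> weyl_triples A B" "triple n y \<in> weyl_triples A B"
      using that n by (auto simp: triples_iff)
    then have "weyl_groupoid_class A B (triple m x) = weyl_groupoid_class A B (triple n y)
        \<longleftrightarrow> (triple m x, triple n y) \<in> weyl_groupoid_rel A B"
      unfolding weyl_groupoid_class_def by (rule eq_equiv_class_iff[OF equiv_groupoid_rel])
    then show ?thesis using that n by (auto simp: groupoid_rel_iff)
  qed
  {
    assume ?L
    then obtain m x y where *: "m \<in> N" "x \<in> D m" "\<sigma> = tcls m x" "y \<in> D n"
      "weyl_twist_proj A B \<sigma> = weyl_groupoid_class A B (triple n y)"
      unfolding weyl_twist_over_def weyl_supp_def by (auto simp: twist_iff)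
    then have "x = y \<and> loc m n x" using gc proj_tcls by metis
    then show ?R using * by blast
  }
  {
    assume ?R
    then obtain m x where *: "m \<in> N" "x \<in> D m" "x \<in> D n" "\<sigma> = tcls m x" "loc m n x" by blast
    then have "weyl_twist_proj A B \<sigma> = weyl_groupoid_class A B (triple n x)"
      using gc[of m x x] proj_tcls by simp
    then show ?L unfolding weyl_twist_over_def weyl_supp_def using * by (auto simp: twist_iff)
  }
qed

subsection \<open>Uniqueness of the twist topology\<close>

definition chart :: "'a \<Rightarrow> ('a \<Rightarrow> complex) \<times> complex \<Rightarrow> 'a weyl_triple set" where
  "chart n = (\<lambda>(x, z). weyl_twist_class A B (weyl_map A B n x, z \<odot> n, x))"

abbreviation chart_dom :: "'a \<Rightarrow> (('a \<Rightarrow> complex) \<times> complex) topology" where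
  "chart_dom n \<equiv> prod_topology (subtopology Sp (D n)) circle_top"

abbreviation over :: "'a \<Rightarrow> 'a weyl_triple set set" where
  "over n \<equiv> weyl_twist_over A B (weyl_supp A B n)"

definition is_twist_top :: "'a weyl_triple set topology \<Rightarrow> bool" where
  "is_twist_top T \<longleftrightarrow> topspace T = weyl_twist A B \<and>
    (\<forall>n\<in>N. openin T (over n) \<and> homeomorphic_map (chart_dom n) (subtopology T (over n)) (chart n))"

lemma topspace_chart_dom: "topspace (chart_dom n) = D n \<times> sphere 0 1"
  using D_subset by (auto simp: topspace_spectrum)

lemma chart_apply:
  assumes "n \<in> N" "x \<in> D n" "cmod z = 1"
  shows "chart n (x, z) = tcls (z \<odot> n) x"
  using assms wmap_smult[OF assms(1) _ assms(3), of x] D_D[OF assms(2)]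
  by (simp add: chart_def weyl_map_apply norm_smult)

text \<open>The right-hand side does not mention \<open>T\<close>, so at most one topology has the
  chart property. The sets \<open>over n\<close> are open and cover the twist, each class lying over
  the support of its own representative; a set is therefore open as soon as its chart preimages
  are.\<close>

lemma twist_top_openin_iff:
  assumes T: "is_twist_top T"
  shows "openin T U \<longleftrightarrow> U \<subseteq> weyl_twist A B \<and>
    (\<forall>n\<in>N. openin (chart_dom n) {p \<in> topspace (chart_dom n). chart n p \<in> U})"
proof
  have ts: "topspace T = weyl_twist A B" using T by (simp add: is_twist_top_def)
  have op: "openin T (over n)" and hm: "homeomorphic_map (chart_dom n) (subtopology T (over n)) (chart n)"
    if "n \<in> N" for n using T that by (auto simp: is_twist_top_def)
  {
    assume U: "openin T U"
    have "openin (chart_dom n) {p \<in> topspace (chart_dom n). chart n p \<in> U}" if "n \<in> N" for n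
    proof -
      have "continuous_map (chart_dom n) T (chart n)"
        using homeomorphic_imp_continuous_map[OF hm[OF that]] by (simp add: continuous_map_in_subtopology)
      then show ?thesis using U by (rule openin_continuous_map_preimage)
    qed
    then show "U \<subseteq> weyl_twist A B \<and>
      (\<forall>n\<in>N. openin (chart_dom n) {p \<in> topspace (chart_dom n). chart n p \<in> U})"
      using openin_subset[OF U] ts by blast
  }
  {
    assume U: "U \<subseteq> weyl_twist A B \<and>
      (\<forall>n\<in>N. openin (chart_dom n) {p \<in> topspace (chart_dom n). chart n p \<in> U})"
    have "openin T (U \<inter> over n)" if n: "n \<in> N" for n
    proof -
      have "openin (subtopology T (over n)) (chart n ` {p \<in> topspace (chart_dom n). chart n p \<in> U})"
        using homeomorphic_imp_open_map[OF hm[OF n]] U n by (auto simp: open_map_def)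
      moreover have "chart n ` {p \<in> topspace (chart_dom n). chart n p \<in> U} = U \<inter> over n"
      proof -
        have "topspace (subtopology T (over n)) = over n"
          by (simp only: topspace_subtopology Int_absorb1[OF openin_subset[OF op[OF n]]])
        then have "chart n ` topspace (chart_dom n) = over n"
          by (rule trans[OF homeomorphic_imp_surjective_map[OF hm[OF n]]])
        moreover have "f ` {p \<in> P. f p \<in> V} = V \<inter> f ` P" for f :: "('a \<Rightarrow> complex) \<times> complex \<Rightarrow> 'a weyl_triple set" and P V
          by auto
        ultimately show ?thesis by simp
      qed
      ultimately have "openin (subtopology T (over n)) (U \<inter> over n)" by simp
      then show ?thesis by (rule openin_trans_full[OF _ op[OF n]])
    qed
    moreover have "U = (\<Union>n\<in>N. U \<inter> over n)"
    proof -
      have "\<exists>n\<in>N. \<sigma> \<in> over n" if "\<sigma> \<in> U" for \<sigma>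
      proof -
        have "\<sigma> \<in> weyl_twist A B" using U that by (rule subsetD[OF conjunct1])
        then obtain n x where n: "n \<in> N" "x \<in> D n" and \<sigma>: "\<sigma> = tcls n x"
          unfolding twist_iff by (elim bexE)
        have "loc n n x" using n loc_of_tw tw_refl D_D by blast
        then have "\<sigma> \<in> over n" unfolding over_supp_iff[OF n(1)] using n \<sigma> by (intro bexI[of _ n] bexI[of _ x]) auto
        then show ?thesis using n(1) by (rule bexI)
      qed
      then have "U \<subseteq> (\<Union>n\<in>N. U \<inter> over n)" by (simp add: subset_iff)
      then show ?thesis by (simp add: set_eq_subset UN_subset_iff)
    qed
    moreover have "openin T (\<Union>n\<in>N. U \<inter> over n)"
      by (rule openin_Union) (use calculation(1) in auto)
    ultimately show "openin T U" by simp
  }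
qed

lemma twist_top_eq:
  assumes "is_twist_top T" shows "weyl_twist_top A B = T"
proof -
  have uniq: "T' = T" if "is_twist_top T'" for T'
    by (rule topology_eq[THEN iffD2]) (use twist_top_openin_iff that assms in blast)
  have "weyl_twist_top A B = (THE T. is_twist_top T)"
    unfolding weyl_twist_top_def is_twist_top_def chart_def by simp
  also have "\<dots> = T" by (rule the_equality[where P = is_twist_top, OF assms uniq])
  finally show ?thesis .
qed

end

section \<open>Twists generated by a family of unitary normalizers\<close>

lemma continuous_map_locallyI:
  assumes "\<And>p. p \<in> topspace P \<Longrightarrow> \<exists>W. openin P W \<and> p \<in> W \<and> continuous_map (subtopology P W) T f"
  shows "continuous_map P T f"
proof -
  obtain W where W: "\<And>p. p \<in> topspace P \<Longrightarrow> openin P (W p) \<and> p \<in> W p \<and> continuous_map (subtopology P (W p)) T f"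
    using assms by metis
  show ?thesis
    by (rule pasting_lemma[of "topspace P" P W T "\<lambda>_. f"]) (use W in auto)
qed

lemma open_map_locallyI:
  assumes "\<And>p. p \<in> topspace P \<Longrightarrow> \<exists>W. openin P W \<and> p \<in> W \<and> open_map (subtopology P W) T f"
  shows "open_map P T f"
  unfolding open_map_def
proof (intro allI impI)
  fix V assume V: "openin P V"
  show "openin T (f ` V)"
  proof (subst openin_subopen, intro ballI)
    fix y assume "y \<in> f ` V"
    then obtain p where p: "p \<in> V" "y = f p" by blast
    then have "p \<in> topspace P" using openin_subset[OF V] by blast
    then obtain W where W: "openin P W" "p \<in> W" "open_map (subtopology P W) T f"
      using assms by blast
    have "openin (subtopology P W) (V \<inter> W)" using V by (auto simp: openin_subtopology)
    then have "openin T (f ` (V \<inter> W))" using W(3) by (auto simp: open_map_def)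
    then show "\<exists>Z. openin T Z \<and> y \<in> Z \<and> Z \<subseteq> f ` V" using p W(2) by (intro exI[of _ "f ` (V \<inter> W)"]) auto
  qed
qed

text \<open>Moves a topology along \<open>f\<close> to a set that carries none yet. Pulling back
  along the inverse keeps the open sets explicit.\<close>

lemma homeomorphic_map_pullback_inv:
  assumes bij: "bij_betw f (topspace K) Y"
  defines "T \<equiv> pullback_topology Y (inv_into (topspace K) f) K"
  shows "topspace T = Y" and "homeomorphic_map K T f"
proof -
  let ?g = "inv_into (topspace K) f"
  have g: "?g y \<in> topspace K" "f (?g y) = y" if "y \<in> Y" for y
    using bij that by (auto simp: bij_betw_def inv_into_into f_inv_into_f)
  have gf: "?g (f p) = p" if "p \<in> topspace K" for p
    using bij that by (simp add: bij_betw_def)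
  have fY: "f p \<in> Y" if "p \<in> topspace K" for p using bij that by (auto simp: bij_betw_def)
  show ts: "topspace T = Y" unfolding T_def topspace_pullback_topology using g by auto
  have op: "openin T V \<longleftrightarrow> (\<exists>U. openin K U \<and> V = ?g -` U \<inter> Y)" for V
    by (simp add: T_def openin_pullback_topology)
  have "homeomorphic_maps K T f ?g"
    unfolding homeomorphic_maps_def
  proof (intro conjI ballI)
    show "continuous_map K T f"
    proof (rule continuous_map_openin_preimage_eq[THEN iffD2], intro conjI allI impI)
      show "f \<in> topspace K \<rightarrow> topspace T" using fY ts by auto
      fix V assume "openin T V"
      then obtain U where U: "openin K U" "V = ?g -` U \<inter> Y" using op by blast
      have "topspace K \<inter> f -` V = U" using openin_subset[OF U(1)] gf fY by (auto simp: U(2))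
      then show "openin K (topspace K \<inter> f -` V)" using U by simp
    qed
    show "continuous_map T K ?g"
    proof (rule continuous_map_openin_preimage_eq[THEN iffD2], intro conjI allI impI)
      show "?g \<in> topspace T \<rightarrow> topspace K" using g ts by auto
      fix U assume U: "openin K U"
      have "topspace T \<inter> ?g -` U = ?g -` U \<inter> Y" using ts by auto
      then show "openin T (topspace T \<inter> ?g -` U)" using op U by auto
    qed
  qed (use gf g ts in auto)
  then show "homeomorphic_map K T f" by (rule homeomorphic_maps_imp_map)
qed

lemma complex_of_real_pos_iff: "(0 :: complex) < of_real t \<longleftrightarrow> 0 < t"
  by (simp add: less_complex_def)

text \<open>A projective representation of \<open>G\<close> by unitary normalizers. Of the cocycle
  only unimodularity is recorded, because a phase changes neither the domain nor the partial
  homeomorphism of a normalizer.\<close>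

locale normalizer_family = star_pair A B + G: normal S G
  for A :: "('b, 'm) star_algebra_scheme" (structure) and B :: "'b set"
    and S :: "'g set" and G :: "('g, 'k) monoid_scheme" +
  fixes \<delta> :: "'g \<Rightarrow> 'b"
  assumes \<delta>_normalizer: "g \<in> carrier G \<Longrightarrow> \<delta> g \<in> normalizers A B"
    and \<delta>_unitary: "g \<in> carrier G \<Longrightarrow> adj A (\<delta> g) \<otimes> \<delta> g = \<one>"
    and \<delta>_unitary': "g \<in> carrier G \<Longrightarrow> \<delta> g \<otimes> adj A (\<delta> g) = \<one>"
    and \<delta>_mult: "g \<in> carrier G \<Longrightarrow> h \<in> carrier G \<Longrightarrow>
      \<exists>z. cmod z = 1 \<and> \<delta> g \<otimes> \<delta> h = z \<odot> \<delta> (g \<otimes>\<^bsub>G\<^esub> h)"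
    and \<delta>_B: "s \<in> S \<Longrightarrow> \<delta> s \<in> B"
begin

lemma \<delta>_carrier [simp]: "g \<in> carrier G \<Longrightarrow> \<delta> g \<in> carrier A"
  using \<delta>_normalizer norm_carrier by blast

end

text \<open>All that the topological part needs to know about arbitrary normalizers is condensed
  into \<open>dominated\<close>, which the conditional expectation delivers later. The multipliers
  are merely nonzero there; the phase correction is made in \<open>local_form\<close>.\<close>

locale weyl_family = normalizer_family A B S G \<delta>
  for A :: "('b, 'm) star_algebra_scheme" (structure) and B :: "'b set"
    and S :: "'g set" and G :: "('g, 'k) monoid_scheme" and \<delta> :: "'g \<Rightarrow> 'b" +
  assumes dominated: "n \<in> normalizers A B \<Longrightarrow> x \<in> characters A B \<Longrightarrow> x (adj A n \<otimes> n) \<noteq> 0 \<Longrightarrow>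
    \<exists>g\<in>carrier G. \<exists>b\<in>B. \<exists>b'\<in>B. x b \<noteq> 0 \<and> x b' \<noteq> 0 \<and> n \<otimes> b = \<delta> g \<otimes> b'"

text \<open>Comparing b^* n^* n b with b'^* b' gives x(n^* n) = |x b'|^2 / |x b|^2, so positivity
  follows from domination instead of spectral theory.\<close>

sublocale weyl_family \<subseteq> positive_star_pair A B
proof
  fix n x assume n: "n \<in> N" and x: "x \<in> X" and nz: "x (adj A n \<otimes> n) \<noteq> 0"
  obtain g b b' where g: "g \<in> carrier G" and b: "b \<in> B" "b' \<in> B" "x b \<noteq> 0" "x b' \<noteq> 0"
    and eq: "n \<otimes> b = \<delta> g \<otimes> b'" using dominated[OF n x nz] by blast
  note [simp] = b(1,2) norm_carrier[OF n] g norm_adj_mult[OF n]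
  have "adj A b \<otimes> (adj A n \<otimes> n) \<otimes> b = adj A (n \<otimes> b) \<otimes> (n \<otimes> b)"
    by (simp add: adj_mult m_assoc)
  also have "\<dots> = adj A b' \<otimes> (adj A (\<delta> g) \<otimes> \<delta> g) \<otimes> b'"
    unfolding eq by (simp add: adj_mult m_assoc)
  also have "\<dots> = adj A b' \<otimes> b'" by (simp add: \<delta>_unitary)
  finally have "x (adj A b \<otimes> (adj A n \<otimes> n) \<otimes> b) = x (adj A b' \<otimes> b')" by simp
  then have "x (adj A n \<otimes> n) * (x b * cnj (x b)) = x b' * cnj (x b')"
    by (simp add: char_mult[OF x] char_adj[OF x] mult_ac)
  then have "x (adj A n \<otimes> n) * of_real ((cmod (x b))\<^sup>2) = of_real ((cmod (x b'))\<^sup>2)"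
    unfolding complex_norm_square .
  then have "x (adj A n \<otimes> n) = of_real ((cmod (x b'))\<^sup>2 / (cmod (x b))\<^sup>2)"
    using b by (simp add: field_simps)
  moreover have "(cmod (x b'))\<^sup>2 / (cmod (x b))\<^sup>2 > 0" using b by simp
  ultimately show "x (adj A n \<otimes> n) > 0" by (simp only: complex_of_real_pos_iff)
qed

section \<open>The action of the quotient group and topological freeness\<close>

context weyl_family begin

lemma D_\<delta>: "g \<in> carrier G \<Longrightarrow> D (\<delta> g) = X"
  by (auto simp: weyl_dom_def \<delta>_unitary char_one less_complex_def)

lemma wmap_\<delta>_char: "g \<in> carrier G \<Longrightarrow> x \<in> X \<Longrightarrow> wmap (\<delta> g) x \<in> X"
  by (rule wmap_char) (auto simp: \<delta>_unitary char_one \<delta>_normalizer)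

lemma \<delta>_mult_wmap:
  assumes g: "g \<in> carrier G" and h: "h \<in> carrier G" and x: "x \<in> X"
  shows "wmap (\<delta> (g \<otimes>\<^bsub>G\<^esub> h)) x = wmap (\<delta> g) (wmap (\<delta> h) x)"
proof -
  obtain z where z: "cmod z = 1" and eq: "\<delta> g \<otimes> \<delta> h = z \<odot> \<delta> (g \<otimes>\<^bsub>G\<^esub> h)" using \<delta>_mult[OF g h] by blast
  note [simp] = g h \<delta>_unitary char_one[OF x]
  have "wmap (\<delta> (g \<otimes>\<^bsub>G\<^esub> h)) x = wmap (\<delta> g \<otimes> \<delta> h) x"
    unfolding eq by (rule wmap_smult(1)[symmetric, OF _ x z]) (simp add: \<delta>_normalizer)
  also have "\<dots> = wmap (\<delta> g) (wmap (\<delta> h) x)"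
  proof -
    have 1: "adj A (\<delta> g \<otimes> \<delta> h) \<otimes> b \<otimes> (\<delta> g \<otimes> \<delta> h) = adj A (\<delta> h) \<otimes> (adj A (\<delta> g) \<otimes> b \<otimes> \<delta> g) \<otimes> \<delta> h"
      if "b \<in> B" for b using that by (simp add: adj_mult m_assoc)
    have "adj A (\<delta> g \<otimes> \<delta> h) \<otimes> (\<delta> g \<otimes> \<delta> h) = adj A (\<delta> h) \<otimes> (adj A (\<delta> g) \<otimes> \<delta> g) \<otimes> \<delta> h"
      by (simp add: adj_mult m_assoc del: \<delta>_unitary)
    then have 2: "adj A (\<delta> g \<otimes> \<delta> h) \<otimes> (\<delta> g \<otimes> \<delta> h) = \<one>" by simp
    show ?thesis
      by (rule ext) (simp add: wmap_def restrict_def 1 2 norm_right[OF \<delta>_normalizer])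
  qed
  finally show ?thesis .
qed

text \<open>Under a character the conjugating factors \<open>\<delta> s\<close>, which lie in
  \<open>B\<close>, multiply to 1. Hence the action factors through the quotient by
  \<open>S\<close>.\<close>

lemma wmap_\<delta>_S:
  assumes s: "s \<in> S" and x: "x \<in> X" shows "wmap (\<delta> s) x = x"
proof (rule char_eqI[OF wmap_\<delta>_char x])
  have sG: "s \<in> carrier G" using s G.subset by blast
  show "s \<in> carrier G" "x \<in> X" by fact+
  fix b assume b: "b \<in> B"
  have "x (adj A (\<delta> s)) * x (\<delta> s) = 1"
    using arg_cong[OF \<delta>_unitary[OF sG], of x] \<delta>_B[OF s] x by (simp add: char_mult char_one)
  then show "wmap (\<delta> s) x b = x b"
    using \<delta>_B[OF s] b x by (simp add: wmap_def char_mult \<delta>_unitary[OF sG] char_one mult_ac)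
qed

definition coset_act :: "'g set \<Rightarrow> ('b \<Rightarrow> complex) \<Rightarrow> ('b \<Rightarrow> complex)" where
  "coset_act q = (THE a. \<forall>g\<in>q. a = weyl_map A B (\<delta> g))"

text \<open>Members of the coset have the form s g with \<open>s\<close> on the left, so \<alpha>_s
  is the outer map of the composition and drops out. The description over the coset is thus
  consistent.\<close>

lemma coset_act_eq:
  assumes g: "g \<in> carrier G" shows "coset_act (S #>\<^bsub>G\<^esub> g) = weyl_map A B (\<delta> g)"
proof -
  have *: "weyl_map A B (\<delta> h) = weyl_map A B (\<delta> g)" if h: "h \<in> S #>\<^bsub>G\<^esub> g" for h
  proof -
    obtain s where s: "s \<in> S" "h = s \<otimes>\<^bsub>G\<^esub> g" using h by (auto simp: r_coset_def)
    then have sG: "s \<in> carrier G" and hG: "h \<in> carrier G" using G.subset g by auto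
    have "wmap (\<delta> h) x = wmap (\<delta> g) x" if "x \<in> X" for x
      using that s sG g by (simp add: \<delta>_mult_wmap wmap_\<delta>_S wmap_\<delta>_char)
    then show ?thesis
      unfolding weyl_map_eq[OF \<delta>_normalizer[OF g]] weyl_map_eq[OF \<delta>_normalizer[OF hG]]
      by (auto simp: D_\<delta> g hG cong: restrict_cong)
  qed
  have "g \<in> S #>\<^bsub>G\<^esub> g" by (rule G.rcos_self[OF g G.subgroup_axioms])
  note g_mem = this
  show ?thesis unfolding coset_act_def
  proof (rule the_equality)
    show "\<forall>h\<in>S #>\<^bsub>G\<^esub> g. weyl_map A B (\<delta> g) = weyl_map A B (\<delta> h)"
      by (intro ballI *[symmetric])
    show "a = weyl_map A B (\<delta> g)" if "\<forall>h\<in>S #>\<^bsub>G\<^esub> g. a = weyl_map A B (\<delta> h)" for a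
      using that g_mem by (rule bspec)
  qed
qed

lemma coset_act_apply:
  "g \<in> carrier G \<Longrightarrow> x \<in> X \<Longrightarrow> coset_act (S #>\<^bsub>G\<^esub> g) x = wmap (\<delta> g) x"
  by (simp add: coset_act_eq weyl_map_apply \<delta>_normalizer D_\<delta>)

text \<open>With k = h^{-1} g outside \<open>S\<close>, freeness for the one-element set consisting
  of the coset of \<open>k\<close> makes the points moved by \<open>k\<close> dense, so one lies in
  \<open>U\<close>. But where \<alpha>_g and \<alpha>_h agree, \<alpha>_k is the identity.\<close>

lemma coset_eq_of_wmap_eq:
  assumes free: "topologically_free (G Mod S) Sp coset_act"
    and g: "g \<in> carrier G" and h: "h \<in> carrier G"
    and U: "openin Sp U" "U \<noteq> {}" and eq: "\<And>u. u \<in> U \<Longrightarrow> wmap (\<delta> g) u = wmap (\<delta> h) u"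
  shows "S #>\<^bsub>G\<^esub> g = S #>\<^bsub>G\<^esub> h"
proof (rule ccontr)
  assume ne: "S #>\<^bsub>G\<^esub> g \<noteq> S #>\<^bsub>G\<^esub> h"
  define k where "k = inv\<^bsub>G\<^esub> h \<otimes>\<^bsub>G\<^esub> g"
  have k: "k \<in> carrier G" and hk: "g = h \<otimes>\<^bsub>G\<^esub> k"
    using g h by (auto simp: k_def G.inv_solve_left[symmetric] G.m_assoc[symmetric])
  have "S #>\<^bsub>G\<^esub> k \<noteq> S"
  proof
    assume "S #>\<^bsub>G\<^esub> k = S"
    then have "k \<in> S" using G.rcos_self[OF k G.subgroup_axioms] by simp
    then have "g \<in> h <#\<^bsub>G\<^esub> S" using hk by (auto simp: l_coset_def)
    then have "g \<in> S #>\<^bsub>G\<^esub> h" using G.coset_eq h by blast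
    then show False using ne G.repr_independence[OF _ h G.subgroup_axioms] by blast
  qed
  then have "finite {S #>\<^bsub>G\<^esub> k} \<and> {S #>\<^bsub>G\<^esub> k} \<subseteq> carrier (G Mod S) - {\<one>\<^bsub>G Mod S\<^esub>}"
    using k by (auto simp: FactGroup_def RCOSETS_def)
  then have "Sp closure_of {x \<in> topspace Sp. \<forall>q\<in>{S #>\<^bsub>G\<^esub> k}. coset_act q x \<noteq> x} = topspace Sp"
    using free unfolding topologically_free_def by blast
  moreover obtain u where "u \<in> U" using U by blast
  ultimately obtain v where v: "v \<in> U" "v \<in> X" "coset_act (S #>\<^bsub>G\<^esub> k) v \<noteq> v"
    using U(1) openin_subset[OF U(1)] by (auto simp: topspace_spectrum set_eq_iff in_closure_of) blast
  have "wmap (\<delta> k) v = wmap (\<delta> (inv\<^bsub>G\<^esub> h)) (wmap (\<delta> g) v)"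
    unfolding k_def using g h v by (simp add: \<delta>_mult_wmap)
  also have "\<dots> = wmap (\<delta> (inv\<^bsub>G\<^esub> h \<otimes>\<^bsub>G\<^esub> h)) v"
    using g h v by (subst \<delta>_mult_wmap) (auto simp: eq)
  also have "\<dots> = v" using h v wmap_\<delta>_S[OF subgroup.one_closed[OF G.subgroup_axioms]] by (simp add: G.l_inv)
  finally show False using v k by (simp add: coset_act_apply)
qed

end

section \<open>The parametrization of the twist by cosets, characters and phases\<close>

locale weyl_section = weyl_family A B S G \<delta>
  for A :: "('b, 'm) star_algebra_scheme" (structure) and B :: "'b set"
    and S :: "'g set" and G :: "('g, 'k) monoid_scheme" and \<delta> :: "'g \<Rightarrow> 'b" +
  fixes r :: "'g set \<Rightarrow> 'g"
  assumes repr: "q \<in> carrier (G Mod S) \<Longrightarrow> r q \<in> q"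
    and free: "topologically_free (G Mod S) Sp coset_act"
begin

abbreviation "Q \<equiv> carrier (G Mod S)"
abbreviation "K \<equiv> prod_topology (transformation_groupoid_top (G Mod S) Sp) circle_top"

definition \<psi> :: "('g set \<times> ('b \<Rightarrow> complex)) \<times> complex \<Rightarrow> 'b weyl_triple set" where
  "\<psi> = (\<lambda>((q, x), z). weyl_twist_class A B (coset_act q x, z \<odot> \<delta> (r q), x))"

lemma topspace_groupoid [simp]: "topspace (transformation_groupoid_top (G Mod S) Sp) = Q \<times> X"
  by (simp add: transformation_groupoid_top_def topspace_spectrum)

lemma topspace_K: "topspace K = (Q \<times> X) \<times> sphere 0 1"
  by simp

lemma coset_repr:
  assumes q: "q \<in> Q" shows "r q \<in> carrier G" and "S #>\<^bsub>G\<^esub> r q = q"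
proof -
  obtain g where g: "g \<in> carrier G" "q = S #>\<^bsub>G\<^esub> g" using q by (auto simp: FactGroup_def RCOSETS_def)
  have "r q \<in> S #>\<^bsub>G\<^esub> g" using repr[OF q] g by simp
  then show "r q \<in> carrier G" "S #>\<^bsub>G\<^esub> r q = q"
    using g G.r_coset_subset_G[OF G.subset] G.repr_independence[OF _ _ G.subgroup_axioms] by blast+
qed

lemma coset_in_Q: "g \<in> carrier G \<Longrightarrow> S #>\<^bsub>G\<^esub> g \<in> Q"
  by (auto simp: FactGroup_def RCOSETS_def)

lemma \<psi>_apply:
  assumes "q \<in> Q" "x \<in> X" "cmod z = 1"
  shows "\<psi> ((q, x), z) = tcls (z \<odot> \<delta> (r q)) x"
proof -
  note rq = coset_repr[OF assms(1)]
  have "coset_act q x = weyl_map A B (z \<odot> \<delta> (r q)) x"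
    using coset_act_apply[OF rq(1) assms(2)] rq assms wmap_smult[OF \<delta>_normalizer[OF rq(1)] assms(2,3)]
    by (simp add: weyl_map_apply norm_smult \<delta>_normalizer D_\<delta>)
  then show ?thesis by (simp add: \<psi>_def)
qed

text \<open>Here the twist relation's demand for positive multipliers is essential: z (x b) = w (x
  b') with both values positive leaves no room for a phase.\<close>

lemma tw_smult_eq:
  assumes n: "n \<in> N" and x: "x \<in> D n" and "cmod z = 1" "cmod w = 1"
    and b: "b \<in> B" "b' \<in> B" "x b > 0" "x b' > 0" and eq: "(z \<odot> n) \<otimes> b = (w \<odot> n) \<otimes> b'"
  shows "z = w"
proof -
  note [simp] = norm_carrier[OF n] b(1,2) norm_adj_mult[OF n]
  have xX: "x \<in> X" and nz: "x (adj A n \<otimes> n) \<noteq> 0" using D_D[OF x] by auto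
  have "z \<odot> ((adj A n \<otimes> n) \<otimes> b) = adj A n \<otimes> ((z \<odot> n) \<otimes> b)"
    by (simp add: smult_mult mult_smult m_assoc)
  also have "\<dots> = w \<odot> ((adj A n \<otimes> n) \<otimes> b')"
    unfolding eq by (simp add: smult_mult mult_smult m_assoc)
  finally have "x (z \<odot> ((adj A n \<otimes> n) \<otimes> b)) = x (w \<odot> ((adj A n \<otimes> n) \<otimes> b'))" by simp
  then have *: "z * x b = w * x b'" using nz by (simp add: char_smult[OF xX] char_mult[OF xX])
  have r: "x b = of_real (cmod (x b))" "x b' = of_real (cmod (x b'))"
    using b by (auto simp: less_complex_def complex_eq_iff cmod_eq_Re)
  have "cmod (x b) = cmod (x b')" using arg_cong[OF *, of cmod] assms by (simp add: norm_mult)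
  then show "z = w" using * r b by (metis mult_right_cancel order_less_irrefl)
qed

text \<open>The base point is part of the class, the coset is recovered from the germ by topological
  freeness, and the phase from \<open>tw_smult_eq\<close>.\<close>

lemma inj_\<psi>: "inj_on \<psi> (topspace K)"
proof (rule inj_onI)
  fix a a' assume a: "a \<in> topspace K" "a' \<in> topspace K" "\<psi> a = \<psi> a'"
  obtain q x z q' x' w where eq: "a = ((q, x), z)" "a' = ((q', x'), w)" by (metis surj_pair)
  have q: "q \<in> Q" "q' \<in> Q" and x: "x \<in> X" "x' \<in> X" and z: "cmod z = 1" "cmod w = 1"
    using a eq by (auto simp: topspace_K)
  note rq = coset_repr[OF q(1)] coset_repr[OF q(2)]
  have nN: "z \<odot> \<delta> (r q) \<in> N" "w \<odot> \<delta> (r q') \<in> N"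
    using rq by (auto intro!: norm_smult \<delta>_normalizer)
  have dom: "D (z \<odot> \<delta> (r q)) = X" "D (w \<odot> \<delta> (r q')) = X"
    using wmap_smult(2)[OF \<delta>_normalizer x(1)] rq z by (simp_all add: D_\<delta>)
  have "tcls (z \<odot> \<delta> (r q)) x = tcls (w \<odot> \<delta> (r q')) x'"
    using a(3) eq q x z by (simp add: \<psi>_apply)
  then have xx: "x = x'" and t: "tw (z \<odot> \<delta> (r q)) (w \<odot> \<delta> (r q')) x"
    using tcls_eq_iff[OF nN] dom x by auto
  have "loc (z \<odot> \<delta> (r q)) (w \<odot> \<delta> (r q')) x"
    by (rule loc_of_tw[OF nN _ _ t]) (use dom x in auto)
  then obtain U where U: "openin Sp U" "x \<in> U" "U \<subseteq> X"
    "\<forall>u\<in>U. wmap (z \<odot> \<delta> (r q)) u = wmap (w \<odot> \<delta> (r q')) u" by (auto simp: loc_def dom)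
  have "wmap (\<delta> (r q)) u = wmap (\<delta> (r q')) u" if u: "u \<in> U" for u
  proof -
    have uX: "u \<in> X" using u U by blast
    show ?thesis
      using bspec[OF U(4) u] wmap_smult(1)[OF \<delta>_normalizer uX] rq z by simp
  qed
  then have qq: "q = q'"
    using coset_eq_of_wmap_eq[OF free rq(1,3) U(1)] U(2) rq by blast
  have "z = w"
    using t tw_smult_eq[OF \<delta>_normalizer[OF rq(1)] _ z] x rq(1) unfolding tw_def qq[symmetric]
    by (auto simp: D_\<delta>)
  then show "a = a'" using eq xx qq by simp
qed

lemma cmod_sgn_eq: "z \<noteq> 0 \<Longrightarrow> cmod (sgn z) = 1"
  by (simp add: norm_sgn)

lemma cmod_1_cnj: "cmod z = 1 \<Longrightarrow> cnj z * z = 1"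
  by (metis complex_norm_square mult.commute of_real_1 one_power2)

text \<open>Bridge between arbitrary normalizers and the parametrization: on \<open>U\<close> the
  coset stays constant, and the only datum of \<open>n\<close> that varies is the phase
  \<open>sgn (u d)\<close>. Since \<open>d\<close> does not vanish on \<open>U\<close>, this phase
  is continuous there.\<close>

lemma local_form:
  assumes n: "n \<in> N" and x: "x \<in> D n"
  obtains q d U where "q \<in> Q" "d \<in> B" "openin Sp U" "x \<in> U" "U \<subseteq> D n" "\<And>u. u \<in> U \<Longrightarrow> u d \<noteq> 0"
    "\<And>u z. u \<in> U \<Longrightarrow> cmod z = 1 \<Longrightarrow> tcls (z \<odot> n) u = \<psi> ((q, u), z * sgn (u d))"
proof -
  have xX: "x \<in> X" and nz: "x (adj A n \<otimes> n) \<noteq> 0" using D_D[OF x] by auto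
  obtain g b b0 where g: "g \<in> carrier G" and b: "b \<in> B" "x b \<noteq> 0" and b0: "b0 \<in> B" "x b0 \<noteq> 0"
    and eq0: "n \<otimes> b = \<delta> g \<otimes> b0" using dominated[OF n xX nz] by blast
  define q where "q = S #>\<^bsub>G\<^esub> g"
  have q: "q \<in> Q" using g by (simp add: q_def coset_in_Q)
  note rq = coset_repr[OF q]
  have "g \<in> S #>\<^bsub>G\<^esub> r q" using rq(2) G.rcos_self[OF g G.subgroup_axioms] by (simp add: q_def)
  then have "g \<in> r q <#\<^bsub>G\<^esub> S" using G.coset_eq rq(1) by blast
  then obtain s where s: "s \<in> S" "g = r q \<otimes>\<^bsub>G\<^esub> s" by (auto simp: l_coset_def)
  have sG: "s \<in> carrier G" using s G.subset by blast
  obtain z0 where z0: "cmod z0 = 1" "\<delta> (r q) \<otimes> \<delta> s = z0 \<odot> \<delta> g"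
    using \<delta>_mult[OF rq(1) sG] s by auto
  note [simp] = norm_carrier[OF n] g rq(1) sG b(1) b0(1) \<delta>_B[OF s(1)]
  have dg: "\<delta> g = cnj z0 \<odot> (\<delta> (r q) \<otimes> \<delta> s)"
    unfolding z0(2) using z0(1) by (simp add: smult_smult smult_one cmod_1_cnj)
  \<comment> \<open>The \<open>g\<close> from domination need not be the chosen representative. It
    equals \<open>r q\<close> times some \<open>s\<close> in \<open>S\<close>, and \<open>b'\<close>
    absorbs \<open>\<delta> s\<close> together with the cocycle phase.\<close>
  define b' where "b' = cnj z0 \<odot> (\<delta> s \<otimes> b0)"
  have b': "b' \<in> B" by (simp add: b'_def)
  have "n \<otimes> b = \<delta> (r q) \<otimes> b'"
    unfolding eq0 dg b'_def by (simp add: smult_mult mult_smult m_assoc)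
  note eq = this
  have "x (adj A (\<delta> s)) * x (\<delta> s) = 1"
    using arg_cong[OF \<delta>_unitary[OF sG], of x] by (simp add: char_mult[OF xX] char_one[OF xX])
  then have "x (\<delta> s) \<noteq> 0" by auto
  then have xb': "x b' \<noteq> 0" using z0 b0 by (auto simp: b'_def char_smult[OF xX] char_mult[OF xX])
  \<comment> \<open>Multiplying n b = \<delta> b' by the adjoint of \<open>b\<close> makes the
    multiplier of \<open>n\<close> take the positive value |u b|^2. The phase of the other
    multiplier \<open>d\<close> is then transferred to the scalar in front of \<delta>, leaving the
    positive value |u d|.\<close>
  define d where "d = b' \<otimes> adj A b"
  have d: "d \<in> B" using b' by (simp add: d_def)
  define U where "U = D n \<inter> {u \<in> X. u b \<noteq> 0} \<inter> {u \<in> X. u b' \<noteq> 0}"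
  have Uop: "openin Sp U" unfolding U_def
    by (intro openin_Int openin_D[OF n] openin_char_neq_0 b b')
  have ud: "u d \<noteq> 0" if "u \<in> U" for u
    using that b' by (auto simp: U_def d_def char_mult char_adj)
  have "tcls (z \<odot> n) u = \<psi> ((q, u), z * sgn (u d))" if u: "u \<in> U" and z: "cmod z = 1" for u z
  proof -
    have uX: "u \<in> X" and uD: "u \<in> D n" and ub: "u b \<noteq> 0" using u by (auto simp: U_def)
    define w where "w = sgn (u d)"
    have w: "cmod w = 1" using ud[OF u] by (simp add: w_def cmod_sgn_eq)
    have zw: "cmod (z * w) = 1" using z w by (simp add: norm_mult)
    have ww: "w * cnj w = 1" using cmod_1_cnj[OF w] by (simp add: mult.commute)
    have e: "(z \<odot> n) \<otimes> (b \<otimes> adj A b) = ((z * w) \<odot> \<delta> (r q)) \<otimes> (cnj w \<odot> d)"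
    proof -
      have "(z \<odot> n) \<otimes> (b \<otimes> adj A b) = z \<odot> ((n \<otimes> b) \<otimes> adj A b)"
        by (simp add: smult_mult m_assoc)
      also have "\<dots> = z \<odot> (\<delta> (r q) \<otimes> d)" using b' unfolding eq d_def by (simp add: m_assoc)
      also have "\<dots> = (z * (w * cnj w)) \<odot> (\<delta> (r q) \<otimes> d)" by (simp add: ww)
      also have "\<dots> = ((z * w) \<odot> \<delta> (r q)) \<otimes> (cnj w \<odot> d)"
        using d by (simp add: smult_mult mult_smult smult_smult mult_ac)
      finally show ?thesis .
    qed
    have 1: "u (b \<otimes> adj A b) > 0"
      using ub uX by (simp add: char_mult char_adj complex_of_real_pos_iff flip: complex_norm_square del: of_real_power)
    have "cnj w * u d = of_real (cmod (u d))"
    proof -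
      have "u d = w * of_real (cmod (u d))" using ud[OF u] by (simp add: w_def sgn_eq)
      then have "cnj w * u d = (w * cnj w) * of_real (cmod (u d))" by (metis mult.assoc mult.commute)
      then show ?thesis by (simp add: ww)
    qed
    then have 2: "u (cnj w \<odot> d) > 0"
      using ud[OF u] d uX by (simp add: char_smult less_complex_def)
    have "tw (z \<odot> n) ((z * w) \<odot> \<delta> (r q)) u"
      unfolding tw_def using e 1 2 d by (meson b(1) adj_B mult_B smult_B)
    then have "tcls (z \<odot> n) u = tcls ((z * w) \<odot> \<delta> (r q)) u"
      using tcls_eq_iff[OF norm_smult[OF n] norm_smult[OF \<delta>_normalizer[OF rq(1)]]] uX uD
        wmap_smult(2)[OF n uX z] wmap_smult(2)[OF \<delta>_normalizer[OF rq(1)] uX zw]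
      by (simp add: D_\<delta>)
    then show ?thesis by (simp add: \<psi>_apply[OF q uX zw] flip: w_def)
  qed
  moreover have "x \<in> U" using x xX b xb' by (simp add: U_def)
  moreover have "U \<subseteq> D n" by (auto simp: U_def)
  ultimately show ?thesis using that q d Uop ud by blast
qed

lemma bij_\<psi>: "bij_betw \<psi> (topspace K) (weyl_twist A B)"
  unfolding bij_betw_def
proof (intro conjI inj_\<psi> subset_antisym subsetI)
  fix \<sigma> assume "\<sigma> \<in> \<psi> ` topspace K"
  then obtain q x z where q: "q \<in> Q" "x \<in> X" "cmod z = 1" "\<sigma> = \<psi> ((q, x), z)"
    by (auto simp: topspace_K)
  have "\<delta> (r q) \<in> N" using q by (simp add: coset_repr \<delta>_normalizer)
  then show "\<sigma> \<in> weyl_twist A B"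
    unfolding q(4) \<psi>_apply[OF q(1-3)] twist_iff
    using wmap_smult(2)[of "\<delta> (r q)" x z] q coset_repr(1)[OF q(1)]
    by (intro bexI[of _ "z \<odot> \<delta> (r q)"] bexI[of _ x]) (auto simp: norm_smult D_\<delta>)
next
  fix \<sigma> assume "\<sigma> \<in> weyl_twist A B"
  then obtain n x where n: "n \<in> N" "x \<in> D n" and \<sigma>: "\<sigma> = tcls n x" unfolding twist_iff by (elim bexE)
  obtain q d U where q: "q \<in> Q" "x \<in> U" "\<And>u. u \<in> U \<Longrightarrow> u d \<noteq> 0"
    and "\<And>u z. u \<in> U \<Longrightarrow> cmod z = 1 \<Longrightarrow> tcls (z \<odot> n) u = \<psi> ((q, u), z * sgn (u d))"
    using local_form[OF n] by metis
  from this(4)[of x 1] have "\<sigma> = \<psi> ((q, x), sgn (x d))"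
    using q n by (simp add: \<sigma> smult_one norm_carrier)
  then show "\<sigma> \<in> \<psi> ` topspace K"
    using q D_D[OF n(2)] by (auto simp: topspace_K cmod_sgn_eq)
qed

text \<open>The inclusion from right to left uses topological freeness: a class over the support of
  \<open>n\<close> has a representative \<open>m\<close> with the same germ, both are locally given
  by some \<delta>, and equal germs force equal cosets. So the two classes at \<open>x\<close>
  differ by a phase.\<close>

lemma chart_image:
  assumes n: "n \<in> N" shows "chart n ` topspace (chart_dom n) = over n"
proof (intro subset_antisym subsetI)
  fix \<sigma> assume "\<sigma> \<in> chart n ` topspace (chart_dom n)"
  then obtain x z where x: "x \<in> D n" "cmod z = 1" "\<sigma> = chart n (x, z)"
    unfolding topspace_chart_dom by auto
  have xX: "x \<in> X" using D_D[OF x(1)] by blast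
  have d: "D (z \<odot> n) = D n" using wmap_smult(2)[OF n xX x(2)] .
  have "loc (z \<odot> n) n x"
    unfolding loc_def d using x openin_D[OF n] wmap_smult(1)[OF n _ x(2)] D_D by (intro exI[of _ "D n"]) auto
  then show "\<sigma> \<in> over n"
    unfolding over_supp_iff[OF n] using x d chart_apply[OF n x(1,2)]
    by (intro bexI[of _ "z \<odot> n"] bexI[of _ x]) (auto simp: norm_smult n)
next
  fix \<sigma> assume "\<sigma> \<in> over n"
  then obtain m x where m: "m \<in> N" "x \<in> D m" "x \<in> D n" and \<sigma>: "\<sigma> = tcls m x" and l: "loc m n x"
    unfolding over_supp_iff[OF n] by blast
  have xX: "x \<in> X" using D_D[OF m(2)] by blast
  have *: "\<exists>q\<in>Q. \<exists>w. cmod w = 1 \<and> loc k (\<delta> (r q)) x \<and>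
      (\<forall>z. cmod z = 1 \<longrightarrow> tcls (z \<odot> k) x = \<psi> ((q, x), z * w))" if k: "k \<in> N" "x \<in> D k" for k
  proof -
    obtain q d U where q: "q \<in> Q" "x \<in> U" "\<And>u. u \<in> U \<Longrightarrow> u d \<noteq> 0"
      and f: "\<And>u z. u \<in> U \<Longrightarrow> cmod z = 1 \<Longrightarrow> tcls (z \<odot> k) u = \<psi> ((q, u), z * sgn (u d))"
      using local_form[OF k] by metis
    define w where "w = sgn (x d)"
    have w: "cmod w = 1" using q by (simp add: w_def cmod_sgn_eq)
    have dN: "\<delta> (r q) \<in> N" using q by (simp add: coset_repr \<delta>_normalizer)
    have dD: "D (w \<odot> \<delta> (r q)) = X" "D (\<delta> (r q)) = X"
      using wmap_smult(2)[OF dN xX w] q by (auto simp: coset_repr D_\<delta>)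
    have "tcls k x = tcls (w \<odot> \<delta> (r q)) x"
      using f[OF q(2), of 1] k \<psi>_apply[OF q(1) xX w] by (simp add: smult_one norm_carrier w_def)
    then have "tw k (w \<odot> \<delta> (r q)) x"
      using tcls_eq_iff[OF k(1) norm_smult[OF dN]] k dD xX by simp
    then have "loc k (w \<odot> \<delta> (r q)) x"
      using loc_of_tw k norm_smult[OF dN] dD xX by simp
    moreover have "loc (w \<odot> \<delta> (r q)) (\<delta> (r q)) x"
      unfolding loc_def dD using xX wmap_smult(1)[OF dN _ w] openin_topspace[of Sp]
      by (intro exI[of _ X]) (auto simp: topspace_spectrum)
    ultimately have "loc k (\<delta> (r q)) x" by (rule loc_trans)
    then show ?thesis using q(1) w f[OF q(2)] by (auto simp: w_def)
  qed
  obtain q w where q: "q \<in> Q" "cmod w = 1" "loc m (\<delta> (r q)) x"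
    "\<And>z. cmod z = 1 \<Longrightarrow> tcls (z \<odot> m) x = \<psi> ((q, x), z * w)" using *[OF m(1,2)] by blast
  obtain p v where p: "p \<in> Q" "cmod v = 1" "loc n (\<delta> (r p)) x"
    "\<And>z. cmod z = 1 \<Longrightarrow> tcls (z \<odot> n) x = \<psi> ((p, x), z * v)" using *[OF n m(3)] by blast
  have "loc (\<delta> (r q)) (\<delta> (r p)) x" using l p(3) q(3) loc_trans loc_sym by blast
  then obtain U where U: "openin Sp U" "x \<in> U" "\<forall>u\<in>U. wmap (\<delta> (r q)) u = wmap (\<delta> (r p)) u"
    unfolding loc_def by blast
  have "q = p"
    using coset_eq_of_wmap_eq[OF free coset_repr(1)[OF q(1)] coset_repr(1)[OF p(1)] U(1)] U(2,3)
      coset_repr(2)[OF q(1)] coset_repr(2)[OF p(1)] by blast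
  have 1: "\<sigma> = \<psi> ((q, x), w)" using q(4)[of 1] m by (simp add: \<sigma> smult_one norm_carrier)
  \<comment> \<open>\<open>w\<close> and \<open>v\<close> are the phases of \<open>m\<close> and
    \<open>n\<close> relative to the common \<delta>, so w \<open>cnj\<close> v is the scalar by
    which \<open>n\<close> must be multiplied to reach the class of \<open>m\<close>.\<close>
  have c: "cmod (w * cnj v) = 1" using q p by (simp add: norm_mult)
  have "chart n (x, w * cnj v) = \<psi> ((p, x), w * cnj v * v)"
    using chart_apply[OF n m(3) c] p(4)[OF c] by simp
  then have "chart n (x, w * cnj v) = \<sigma>" using 1 \<open>q = p\<close> cmod_1_cnj[OF p(2)] by (simp add: mult.assoc)
  then show "\<sigma> \<in> chart n ` topspace (chart_dom n)"
    unfolding topspace_chart_dom using m(3) c by (intro image_eqI[of _ _ "(x, w * cnj v)"]) auto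
qed

lemma inj_chart:
  assumes n: "n \<in> N" shows "inj_on (chart n) (topspace (chart_dom n))"
proof (rule inj_onI)
  fix a a' assume a: "a \<in> topspace (chart_dom n)" "a' \<in> topspace (chart_dom n)" "chart n a = chart n a'"
  obtain x z x' w where eq: "a = (x, z)" "a' = (x', w)" by (metis surj_pair)
  have x: "x \<in> D n" "x' \<in> D n" and z: "cmod z = 1" "cmod w = 1"
    using a eq unfolding topspace_chart_dom by auto
  have xX: "x \<in> X" using D_D[OF x(1)] by blast
  have "tcls (z \<odot> n) x = tcls (w \<odot> n) x'"
    using a(3) eq x z n by (simp add: chart_apply)
  then have "x = x'" and t: "tw (z \<odot> n) (w \<odot> n) x"
    using tcls_eq_iff[OF norm_smult[OF n] norm_smult[OF n]] wmap_smult(2)[OF n xX] z x by auto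
  moreover have "z = w" using t tw_smult_eq[OF n x(1) z] unfolding tw_def by blast
  ultimately show "a = a'" using eq by simp
qed

text \<open>In the coordinates given by \<open>\<psi>\<close>, a chart is locally multiplication of the circle variable by
  a continuous phase.\<close>

lemma phase_homeomorphism:
  assumes q: "q \<in> Q" and d: "d \<in> B" and U: "openin Sp U" and ud: "\<And>u. u \<in> U \<Longrightarrow> u d \<noteq> 0"
  defines "\<kappa> \<equiv> \<lambda>(u, z). ((q, u), z * sgn (u d))"
  shows "continuous_map (prod_topology (subtopology Sp U) circle_top) K \<kappa>"
    and "open_map (prod_topology (subtopology Sp U) circle_top) K \<kappa>"
proof -
  have UX: "U \<subseteq> X" using openin_subset[OF U] by (simp add: topspace_spectrum)
  have sg: "continuous_map (subtopology Sp U) circle_top (\<lambda>u. sgn (u d))"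
  proof -
    have 1: "continuous_map (subtopology Sp U) (top_of_set (- {0})) (\<lambda>u. u d)"
      using continuous_map_from_subtopology[OF spectrum_eval[OF d]] ud
      by (auto simp: continuous_map_in_subtopology)
    have 2: "continuous_map (top_of_set (- {0})) circle_top (sgn :: complex \<Rightarrow> complex)"
      unfolding continuous_map_in_subtopology
      by (auto simp: norm_sgn intro!: continuous_intros)
    show ?thesis using continuous_map_compose[OF 1 2] by (simp add: o_def)
  qed
  have mult: "continuous_map Z circle_top (\<lambda>p. f p * g p)"
    if "continuous_map Z circle_top f" "continuous_map Z circle_top g" for f g :: "'z \<Rightarrow> complex" and Z
  proof -
    have 1: "continuous_map Z (top_of_set (sphere 0 1 \<times> sphere 0 1)) (\<lambda>p. (f p, g p))"
      using continuous_map_pairedI[OF that] by simp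
    have 2: "continuous_map (top_of_set (sphere 0 1 \<times> sphere 0 1)) circle_top (\<lambda>p. fst p * snd p :: complex)"
      unfolding continuous_map_in_subtopology
      by (auto simp: norm_mult intro!: continuous_intros)
    show ?thesis using continuous_map_compose[OF 1 2] by (simp add: o_def)
  qed
  have cnj: "continuous_map Z circle_top (\<lambda>p. cnj (f p))" if "continuous_map Z circle_top f"
    for f :: "'z \<Rightarrow> complex" and Z
  proof -
    have 2: "continuous_map circle_top circle_top cnj"
      unfolding continuous_map_in_subtopology by (auto intro!: continuous_intros)
    show ?thesis using continuous_map_compose[OF that 2] by (simp add: o_def)
  qed
  let ?P = "prod_topology (subtopology Sp U) circle_top"
  have fstP: "continuous_map ?P (subtopology Sp U) fst" and sndP: "continuous_map ?P circle_top snd"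
    by (rule continuous_map_fst continuous_map_snd)+
  have "continuous_map ?P K (\<lambda>p. ((q, fst p), snd p * sgn (fst p d)))"
    unfolding transformation_groupoid_top_def
  proof (intro continuous_map_pairedI mult sndP)
    show "continuous_map ?P (discrete_topology Q) (\<lambda>p. q)" using q by simp
    show "continuous_map ?P Sp fst" using fstP by (simp add: continuous_map_in_subtopology)
    show "continuous_map ?P circle_top (\<lambda>p. sgn (fst p d))"
      using continuous_map_compose[OF fstP sg] by (simp add: o_def)
  qed
  then show "continuous_map ?P K \<kappa>" by (simp add: \<kappa>_def case_prod_unfold)
  \<comment> \<open>\<open>W\<close> is open because the quotient group is discrete. It is the range
    of \<open>\<kappa>\<close>, and \<open>\<kappa>'\<close> undoes \<open>\<kappa>\<close> by the
    conjugate phase, so images of open sets under \<open>\<kappa>\<close> are preimages under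
    \<open>\<kappa>'\<close>.\<close>
  define W where "W = ({q} \<times> U) \<times> sphere (0 :: complex) 1"
  have W: "openin K W"
    unfolding W_def transformation_groupoid_top_def openin_prod_Times_iff
    using q U by auto
  define \<kappa>' where "\<kappa>' = (\<lambda>p :: ('g set \<times> ('b \<Rightarrow> complex)) \<times> complex. (snd (fst p), snd p * cnj (sgn (snd (fst p) d))))"
  have WK: "subtopology K W = prod_topology (prod_topology (subtopology (discrete_topology Q) {q}) (subtopology Sp U)) circle_top"
    unfolding W_def transformation_groupoid_top_def subtopology_Times
    by (simp add: subtopology_subtopology)
  have "continuous_map (subtopology K W) ?P \<kappa>'"
    unfolding \<kappa>'_def
  proof (intro continuous_map_pairedI mult cnj)
    show 1: "continuous_map (subtopology K W) (subtopology Sp U) (\<lambda>p. snd (fst p))"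
      unfolding WK
      using continuous_map_compose[OF continuous_map_fst continuous_map_snd] by (simp add: o_def)
    show "continuous_map (subtopology K W) circle_top snd"
      unfolding WK by (rule continuous_map_snd)
    show "continuous_map (subtopology K W) circle_top (\<lambda>p. sgn (snd (fst p) d))"
      using continuous_map_compose[OF 1 sg] by (simp add: o_def)
  qed
  note \<kappa>'_cont = this
  show "open_map ?P K \<kappa>"
    unfolding open_map_def
  proof (intro allI impI)
    fix V assume V: "openin ?P V"
    have VS: "V \<subseteq> U \<times> sphere 0 1" using openin_subset[OF V] by auto
    have tW: "topspace (subtopology K W) = W" using openin_subset[OF W] by (simp add: Int_absorb1)
    have s1: "sgn (u d) * cnj (sgn (u d)) = 1" if "u \<in> U" for u
      using cmod_1_cnj[OF cmod_sgn_eq[OF ud[OF that]]] by (simp add: mult.commute)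
    have "\<kappa> ` V = {p \<in> W. \<kappa>' p \<in> V}"
    proof (intro subset_antisym subsetI)
      fix p assume "p \<in> \<kappa> ` V"
      then obtain u z where uz: "(u, z) \<in> V" "p = ((q, u), z * sgn (u d))" by (auto simp: \<kappa>_def)
      then have u: "u \<in> U" "cmod z = 1" using VS by auto
      have "\<kappa>' p = (u, z * (sgn (u d) * cnj (sgn (u d))))" by (simp add: \<kappa>'_def uz mult.assoc)
      then have "\<kappa>' p = (u, z)" using s1[OF u(1)] by simp
      then show "p \<in> {p \<in> W. \<kappa>' p \<in> V}"
        using uz u ud[OF u(1)] by (simp add: W_def norm_mult cmod_sgn_eq)
    next
      fix p assume p: "p \<in> {p \<in> W. \<kappa>' p \<in> V}"
      then obtain u w where uw: "p = ((q, u), w)" "u \<in> U" by (auto simp: W_def)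
      have "(u, w * cnj (sgn (u d))) \<in> V" using p by (simp add: uw \<kappa>'_def)
      moreover have "\<kappa> (u, w * cnj (sgn (u d))) = p"
        using s1[OF uw(2)] by (simp add: \<kappa>_def uw mult.assoc mult.commute[of "cnj _"])
      ultimately show "p \<in> \<kappa> ` V" by (metis image_eqI)
    qed
    moreover have "openin (subtopology K W) {p \<in> W. \<kappa>' p \<in> V}"
      using openin_continuous_map_preimage[OF \<kappa>'_cont V] unfolding tW .
    ultimately show "openin K (\<kappa> ` V)" using W by (metis openin_trans_full)
  qed
qed

text \<open>Injectivity and range of the charts are global facts and already available; what remains
  is continuity and openness, which may be tested on the neighbourhoods of
  \<open>local_form\<close>, where a chart is \<open>\<psi>\<close> after a phase
  multiplication.\<close>

theorem homeomorphic_map_twist: "homeomorphic_map K (weyl_twist_top A B) \<psi>"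
proof -
  define T where "T = pullback_topology (weyl_twist A B) (inv_into (topspace K) \<psi>) K"
  have tsT: "topspace T = weyl_twist A B" and hom: "homeomorphic_map K T \<psi>"
    unfolding T_def by (rule homeomorphic_map_pullback_inv[OF bij_\<psi>])+
  have chart: "continuous_map (chart_dom n) T (chart n) \<and> open_map (chart_dom n) T (chart n)"
    if n: "n \<in> N" for n
  proof -
    have *: "\<exists>W. openin (chart_dom n) W \<and> p \<in> W \<and>
        continuous_map (subtopology (chart_dom n) W) T (chart n) \<and>
        open_map (subtopology (chart_dom n) W) T (chart n)" if "p \<in> topspace (chart_dom n)" for p
    proof -
      obtain x z where p: "p = (x, z)" "x \<in> D n" "cmod z = 1"
        using \<open>p \<in> topspace (chart_dom n)\<close> unfolding topspace_chart_dom by auto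
      obtain q d U where q: "q \<in> Q" "d \<in> B" "openin Sp U" "x \<in> U" "U \<subseteq> D n" "\<And>u. u \<in> U \<Longrightarrow> u d \<noteq> 0"
        and f: "\<And>u z. u \<in> U \<Longrightarrow> cmod z = 1 \<Longrightarrow> tcls (z \<odot> n) u = \<psi> ((q, u), z * sgn (u d))"
        using local_form[OF n p(2)] by metis
      define \<kappa> where "\<kappa> = (\<lambda>(u :: 'b \<Rightarrow> complex, z). ((q, u), z * sgn (u d)))"
      let ?P = "prod_topology (subtopology Sp U) circle_top"
      have ph: "continuous_map ?P K \<kappa>" "open_map ?P K \<kappa>"
        unfolding \<kappa>_def by (rule phase_homeomorphism; use q in blast)+
      have tP: "topspace ?P = U \<times> sphere 0 1" using openin_subset[OF q(3)] by auto
      have sub: "subtopology (chart_dom n) (U \<times> sphere 0 1) = ?P"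
        using q(5) by (simp add: subtopology_Times subtopology_subtopology Int_absorb1)
      have eq: "chart n p = (\<psi> \<circ> \<kappa>) p" if "p \<in> topspace ?P" for p
        using that q(5) f n unfolding tP by (auto simp: chart_apply \<kappa>_def)
      have c: "continuous_map ?P T (chart n)"
        by (rule continuous_map_eq[OF continuous_map_compose[OF ph(1) homeomorphic_imp_continuous_map[OF hom]]])
          (simp add: eq)
      have "open_map ?P T (\<psi> \<circ> \<kappa>)"
        by (rule open_map_compose[OF ph(2) homeomorphic_imp_open_map[OF hom]])
      then have o: "open_map ?P T (chart n)"
        by (rule open_map_eq) (simp add: eq)
      have "openin (chart_dom n) (U \<times> sphere 0 1)"
        unfolding openin_prod_Times_iff using q(3,5) by (auto simp: openin_subtopology intro!: exI[of _ U])
      then show ?thesis using c o sub p q(4) by (intro exI[of _ "U \<times> sphere 0 1"]) auto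
    qed
    show ?thesis
      using * by (intro conjI continuous_map_locallyI open_map_locallyI) blast+
  qed
  have "is_twist_top T"
    unfolding is_twist_top_def
  proof (intro conjI ballI tsT)
    fix n assume n: "n \<in> N"
    note cn = chart[OF n]
    show op: "openin T (over n)"
      using cn openin_topspace[of "chart_dom n"] unfolding chart_image[OF n, symmetric] open_map_def by blast
    have ts: "topspace (subtopology T (over n)) = over n"
      by (simp only: topspace_subtopology Int_absorb1[OF openin_subset[OF op]])
    show "homeomorphic_map (chart_dom n) (subtopology T (over n)) (chart n)"
    proof (rule bijective_open_imp_homeomorphic_map)
      show "continuous_map (chart_dom n) (subtopology T (over n)) (chart n)"
        unfolding continuous_map_in_subtopology using cn chart_image[OF n] by blast
      show "open_map (chart_dom n) (subtopology T (over n)) (chart n)"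
        unfolding open_map_def
      proof (intro allI impI)
        fix V assume V: "openin (chart_dom n) V"
        then have "openin T (chart n ` V)" using cn by (simp add: open_map_def)
        moreover have "chart n ` V \<subseteq> over n"
          using image_mono[OF openin_subset[OF V], of "chart n"] unfolding chart_image[OF n] .
        ultimately show "openin (subtopology T (over n)) (chart n ` V)"
          by (rule subset_openin_subtopology)
      qed
      show "chart n ` topspace (chart_dom n) = topspace (subtopology T (over n))"
        unfolding ts by (rule chart_image[OF n])
    qed (rule inj_chart[OF n])
  qed
  then have "weyl_twist_top A B = T" by (rule twist_top_eq)
  then show ?thesis using hom by simp
qed

end

subsection \<open>Conditional expectations\<close>

text \<open>\<open>E_char\<close> contains the approximation argument, in contrapositive use the
  existence of a nonvanishing coefficient at a point. \<open>E_detect\<close> recognizes elements of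
  \<open>B\<close> by their coefficients off \<open>S\<close>, and \<open>off_diagonal\<close> says
  that \<open>\<delta> k\<close> moves no nonzero element of \<open>B\<close> into
  \<open>B\<close>.\<close>

locale weyl_expectation = normalizer_family A B S G \<delta>
  for A :: "('b, 'm) star_algebra_scheme" (structure) and B :: "'b set"
    and S :: "'g set" and G :: "('g, 'k) monoid_scheme" and \<delta> :: "'g \<Rightarrow> 'b" +
  fixes E :: "'b \<Rightarrow> 'b"
  assumes E_mem: "a \<in> carrier A \<Longrightarrow> E a \<in> B"
    and E_id: "b \<in> B \<Longrightarrow> E b = b"
    and E_left: "a \<in> carrier A \<Longrightarrow> b \<in> B \<Longrightarrow> E (b \<otimes> a) = b \<otimes> E a"
    and E_right: "a \<in> carrier A \<Longrightarrow> b \<in> B \<Longrightarrow> E (a \<otimes> b) = E a \<otimes> b"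
    and E_detect: "a \<in> carrier A \<Longrightarrow> (\<And>k. k \<in> carrier G - S \<Longrightarrow> E (adj A (\<delta> k) \<otimes> a) = \<zero>) \<Longrightarrow> a \<in> B"
    and E_char: "a \<in> carrier A \<Longrightarrow> x \<in> characters A B \<Longrightarrow>
      (\<And>g. g \<in> carrier G \<Longrightarrow> x (E (adj A (\<delta> g) \<otimes> a)) = 0) \<Longrightarrow> x (E (adj A a \<otimes> a)) = 0"
    and max_abelian: "a \<in> carrier A \<Longrightarrow> (\<And>b. b \<in> B \<Longrightarrow> b \<otimes> a = a \<otimes> b) \<Longrightarrow> a \<in> B"
    and off_diagonal: "k \<in> carrier G - S \<Longrightarrow> b \<in> B \<Longrightarrow> \<delta> k \<otimes> b \<in> B \<Longrightarrow> b = \<zero>"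
    and smult_zero: "z \<odot> \<zero> = \<zero>"
begin

text \<open>Because n n^* commutes with \<open>b\<close>, n (n^* b n) = b n (n^* n). Applying the
  adjoint of \<open>\<delta> h\<close> and inserting \<open>\<delta> h\<close> with its adjoint next
  to \<open>b\<close> splits off the translate of \<open>b\<close>; bimodularity of \<open>E\<close>
  does the rest.\<close>

lemma fourier_coefficient_intertwines:
  assumes n: "n \<in> N" and h: "h \<in> carrier G" and b: "b \<in> B"
  shows "E (adj A (\<delta> h) \<otimes> n) \<otimes> (adj A n \<otimes> b \<otimes> n)
    = (adj A (\<delta> h) \<otimes> b \<otimes> \<delta> h) \<otimes> (E (adj A (\<delta> h) \<otimes> n) \<otimes> (adj A n \<otimes> n))"
proof -
  note [simp] = norm_carrier[OF n] h b norm_right[OF n] norm_adj_mult[OF n]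
    norm_right[OF \<delta>_normalizer[OF h]]
  have "n \<otimes> (adj A n \<otimes> b \<otimes> n) = ((n \<otimes> adj A n) \<otimes> b) \<otimes> n" by (simp add: m_assoc)
  also have "\<dots> = (b \<otimes> (n \<otimes> adj A n)) \<otimes> n" by (simp only: comm_B[OF norm_mult_adj[OF n] b])
  also have "\<dots> = \<delta> h \<otimes> adj A (\<delta> h) \<otimes> b \<otimes> (\<delta> h \<otimes> adj A (\<delta> h)) \<otimes> n \<otimes> (adj A n \<otimes> n)"
    unfolding \<delta>_unitary'[OF h] by (simp add: m_assoc)
  finally have eq: "n \<otimes> (adj A n \<otimes> b \<otimes> n) = \<dots>" .
  have "E (adj A (\<delta> h) \<otimes> n) \<otimes> (adj A n \<otimes> b \<otimes> n) = E (adj A (\<delta> h) \<otimes> n \<otimes> (adj A n \<otimes> b \<otimes> n))"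
    by (rule E_right[symmetric]) simp_all
  also have "adj A (\<delta> h) \<otimes> n \<otimes> (adj A n \<otimes> b \<otimes> n)
      = (adj A (\<delta> h) \<otimes> \<delta> h) \<otimes> ((adj A (\<delta> h) \<otimes> b \<otimes> \<delta> h) \<otimes> ((adj A (\<delta> h) \<otimes> n) \<otimes> (adj A n \<otimes> n)))"
    using arg_cong[OF eq, of "\<lambda>a. adj A (\<delta> h) \<otimes> a"] by (simp add: m_assoc)
  also have "\<dots> = (adj A (\<delta> h) \<otimes> b \<otimes> \<delta> h) \<otimes> ((adj A (\<delta> h) \<otimes> n) \<otimes> (adj A n \<otimes> n))"
    unfolding \<delta>_unitary[OF h] by simp
  also have "E \<dots> = (adj A (\<delta> h) \<otimes> b \<otimes> \<delta> h) \<otimes> (E (adj A (\<delta> h) \<otimes> n) \<otimes> (adj A n \<otimes> n))"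
    by (simp add: E_left E_right)
  finally show ?thesis .
qed

text \<open>
  By the previous lemma the product intertwines two different translates of \<open>B\<close>, so it vanishes
  because \<open>B\<close> is maximal abelian.
\<close>

lemma fourier_coefficients_orthogonal:
  assumes n: "n \<in> N" and g: "g \<in> carrier G" and k: "k \<in> carrier G - S"
    and h: "h = g \<otimes>\<^bsub>G\<^esub> k"
  shows "E (adj A (\<delta> h) \<otimes> n) \<otimes> E (adj A (\<delta> g) \<otimes> n) \<otimes> (adj A n \<otimes> n) = \<zero>"
proof -
  have kG: "k \<in> carrier G" and hG: "h \<in> carrier G" using k g h by auto
  define p where "p = adj A n \<otimes> n"
  define v where "v = E (adj A (\<delta> h) \<otimes> n)"
  define w where "w = E (adj A (\<delta> g) \<otimes> n)"
  define u where "u = v \<otimes> w \<otimes> p"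
  note [simp] = norm_carrier[OF n] g hG kG
  have [simp]: "p \<in> B" "v \<in> B" "w \<in> B" by (auto simp: p_def v_def w_def norm_adj_mult[OF n] E_mem)
  then have [simp]: "u \<in> B" by (simp add: u_def)
  have inter: "(adj A (\<delta> h) \<otimes> b \<otimes> \<delta> h) \<otimes> u = (adj A (\<delta> g) \<otimes> b \<otimes> \<delta> g) \<otimes> u" if b: "b \<in> B" for b
  proof -
    define bh where "bh = adj A (\<delta> h) \<otimes> b \<otimes> \<delta> h"
    define bg where "bg = adj A (\<delta> g) \<otimes> b \<otimes> \<delta> g"
    define bn where "bn = adj A n \<otimes> b \<otimes> n"
    have [simp]: "bh \<in> B" "bg \<in> B" "bn \<in> B"
      using b by (auto simp: bh_def bg_def bn_def norm_right n \<delta>_normalizer)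
    have 1: "v \<otimes> bn = bh \<otimes> (v \<otimes> p)" and 2: "w \<otimes> bn = bg \<otimes> (w \<otimes> p)"
      unfolding v_def w_def bn_def bh_def bg_def p_def
      by (rule fourier_coefficient_intertwines[OF n _ b]; simp)+
    \<comment> \<open>The product v \<open>bn\<close> w is evaluated in two ways, by letting
      \<open>bn\<close> pass \<open>v\<close> or pass \<open>w\<close>.\<close>
    have "bh \<otimes> u = (bh \<otimes> (v \<otimes> p)) \<otimes> w"
      by (simp add: u_def m_assoc comm_B[of p w])
    also have "\<dots> = v \<otimes> (w \<otimes> bn)"
      by (simp add: 1[symmetric] m_assoc comm_B[of bn w])
    also have "\<dots> = (v \<otimes> bg) \<otimes> (w \<otimes> p)" by (simp add: 2 m_assoc)
    also have "\<dots> = bg \<otimes> u" by (simp add: comm_B[of v bg] u_def m_assoc)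
    finally show ?thesis by (simp add: bh_def bg_def)
  qed
  have "adj A (\<delta> g) \<otimes> \<delta> h \<otimes> u \<in> B"
  proof (rule max_abelian)
    fix b0 assume b0: "b0 \<in> B"
    \<comment> \<open>Chosen so that its translate by \<open>g\<close> is \<open>b0\<close>. By
      \<open>inter\<close>, its translate by \<open>h\<close> then also acts on \<open>u\<close> as
      \<open>b0\<close>, which yields commutation with every \<open>b0\<close>.\<close>
    define b where "b = \<delta> g \<otimes> b0 \<otimes> adj A (\<delta> g)"
    have b: "b \<in> B" using b0 by (simp add: b_def norm_left \<delta>_normalizer)
    have gb: "adj A (\<delta> g) \<otimes> b \<otimes> \<delta> g = b0"
    proof -
      have "adj A (\<delta> g) \<otimes> b \<otimes> \<delta> g = (adj A (\<delta> g) \<otimes> \<delta> g) \<otimes> b0 \<otimes> (adj A (\<delta> g) \<otimes> \<delta> g)"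
        using b0 by (simp add: b_def m_assoc)
      then show ?thesis using b0 by (simp add: \<delta>_unitary)
    qed
    have "b0 \<otimes> (adj A (\<delta> g) \<otimes> \<delta> h \<otimes> u) = adj A (\<delta> g) \<otimes> b \<otimes> (\<delta> g \<otimes> adj A (\<delta> g)) \<otimes> \<delta> h \<otimes> u"
      using b0 b by (simp add: gb[symmetric] m_assoc)
    also have "\<dots> = adj A (\<delta> g) \<otimes> (\<delta> h \<otimes> adj A (\<delta> h)) \<otimes> b \<otimes> \<delta> h \<otimes> u"
      unfolding \<delta>_unitary'[OF g] \<delta>_unitary'[OF hG] using b by simp
    also have "\<dots> = adj A (\<delta> g) \<otimes> \<delta> h \<otimes> ((adj A (\<delta> h) \<otimes> b \<otimes> \<delta> h) \<otimes> u)"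
      using b by (simp add: m_assoc)
    also have "\<dots> = adj A (\<delta> g) \<otimes> \<delta> h \<otimes> (u \<otimes> b0)"
      unfolding inter[OF b] gb using b0 by (simp add: comm_B)
    also have "\<dots> = (adj A (\<delta> g) \<otimes> \<delta> h \<otimes> u) \<otimes> b0" using b0 by (simp add: m_assoc)
    finally show "b0 \<otimes> (adj A (\<delta> g) \<otimes> \<delta> h \<otimes> u) = (adj A (\<delta> g) \<otimes> \<delta> h \<otimes> u) \<otimes> b0" .
  qed simp
  moreover obtain z where z: "\<delta> g \<otimes> \<delta> k = z \<odot> \<delta> h" using \<delta>_mult[OF g kG] h by blast
  \<comment> \<open>Up to a phase \<open>\<delta> k\<close> is the quotient of
    \<open>\<delta> h\<close> by \<open>\<delta> g\<close>, so \<delta>_k u lies in \<open>B\<close>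
    although \<open>k\<close> is outside \<open>S\<close>; this is the situation of
    \<open>off_diagonal\<close>.\<close>
  have "\<delta> k \<otimes> u = z \<odot> (adj A (\<delta> g) \<otimes> \<delta> h \<otimes> u)"
  proof -
    have "\<delta> k \<otimes> u = (adj A (\<delta> g) \<otimes> \<delta> g) \<otimes> \<delta> k \<otimes> u" by (simp add: \<delta>_unitary)
    also have "\<dots> = adj A (\<delta> g) \<otimes> (\<delta> g \<otimes> \<delta> k) \<otimes> u" by (simp add: m_assoc)
    also have "\<dots> = z \<odot> (adj A (\<delta> g) \<otimes> \<delta> h \<otimes> u)" by (simp add: z smult_mult mult_smult)
    finally show ?thesis .
  qed
  ultimately have "\<delta> k \<otimes> u \<in> B" by (simp only: smult_B)
  then have "u = \<zero>" by (rule off_diagonal[OF k \<open>u \<in> B\<close>])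
  then show ?thesis by (simp add: u_def v_def w_def p_def)
qed

end

text \<open>The translated and cut-down normalizer \<open>a\<close> is shown to lie in
  \<open>B\<close>; being equal to its own expectation, it can then be computed in terms of
  \<open>w\<close>, and the equation for \<open>n\<close> results.\<close>

sublocale weyl_expectation \<subseteq> weyl_family A B S G \<delta>
proof
  fix n x assume n: "n \<in> N" and x: "x \<in> X" and nz: "x (adj A n \<otimes> n) \<noteq> 0"
  note [simp] = norm_carrier[OF n]
  define p where "p = adj A n \<otimes> n"
  have [simp]: "p \<in> B" by (simp add: p_def norm_adj_mult[OF n])
  have "x (E p) \<noteq> 0" using nz by (simp add: p_def[symmetric] E_id)
  then obtain g where g: "g \<in> carrier G" "x (E (adj A (\<delta> g) \<otimes> n)) \<noteq> 0"
    using E_char[OF norm_carrier[OF n] x] p_def by blast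
  define w where "w = E (adj A (\<delta> g) \<otimes> n)"
  have [simp]: "w \<in> B" "g \<in> carrier G" using g by (auto simp: w_def E_mem)
  \<comment> \<open>The factor w p is there for the orthogonality relation: the coefficient of
    \<open>a\<close> at \<open>k\<close> outside \<open>S\<close> is a phase times the product of
    the coefficients of \<open>n\<close> at g k and at g with p, which vanishes.\<close>
  define a where "a = adj A (\<delta> g) \<otimes> n \<otimes> (w \<otimes> p)"
  have [simp]: "a \<in> carrier A" by (simp add: a_def)
  have "a \<in> B"
  proof (rule E_detect)
    fix k assume k: "k \<in> carrier G - S"
    define h where "h = g \<otimes>\<^bsub>G\<^esub> k"
    have [simp]: "k \<in> carrier G" "h \<in> carrier G" using k by (auto simp: h_def)
    obtain z where "\<delta> g \<otimes> \<delta> k = z \<odot> \<delta> h" using \<delta>_mult[of g k] by (auto simp: h_def)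
    then have "adj A (\<delta> g \<otimes> \<delta> k) = adj A (z \<odot> \<delta> h)" by simp
    then have zz: "adj A (\<delta> k) \<otimes> adj A (\<delta> g) = cnj z \<odot> adj A (\<delta> h)"
      by (simp add: adj_mult adj_smult)
    have "adj A (\<delta> k) \<otimes> a = (adj A (\<delta> k) \<otimes> adj A (\<delta> g)) \<otimes> n \<otimes> (w \<otimes> p)"
      by (simp add: a_def m_assoc)
    also have "\<dots> = (adj A (\<delta> h) \<otimes> n) \<otimes> (cnj z \<odot> (w \<otimes> p))"
      by (simp add: zz smult_mult mult_smult)
    finally have "E (adj A (\<delta> k) \<otimes> a) = E (adj A (\<delta> h) \<otimes> n) \<otimes> (cnj z \<odot> (w \<otimes> p))"
      by (simp add: E_right)
    also have "\<dots> = cnj z \<odot> (E (adj A (\<delta> h) \<otimes> n) \<otimes> w \<otimes> p)"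
      by (simp add: mult_smult m_assoc E_mem)
    also have "\<dots> = \<zero>"
      unfolding w_def p_def fourier_coefficients_orthogonal[OF n g(1) k h_def] by (rule smult_zero)
    finally show "E (adj A (\<delta> k) \<otimes> a) = \<zero>" .
  qed simp
  then have "a = E a" by (simp add: E_id)
  also have "\<dots> = E (adj A (\<delta> g) \<otimes> n) \<otimes> (w \<otimes> p)"
    unfolding a_def by (rule E_right) simp_all
  also have "\<dots> = w \<otimes> (w \<otimes> p)" by (simp add: w_def)
  finally have a: "a = w \<otimes> (w \<otimes> p)" .
  have "n \<otimes> (w \<otimes> p) = (\<delta> g \<otimes> adj A (\<delta> g)) \<otimes> (n \<otimes> (w \<otimes> p))" by (simp add: \<delta>_unitary')
  also have "\<dots> = \<delta> g \<otimes> a" by (simp add: a_def m_assoc)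
  finally have "n \<otimes> (w \<otimes> p) = \<delta> g \<otimes> (w \<otimes> (w \<otimes> p))" by (simp add: a)
  moreover have "x (w \<otimes> p) \<noteq> 0" "x (w \<otimes> (w \<otimes> p)) \<noteq> 0"
    using nz g(2) by (auto simp: char_mult[OF x] w_def[symmetric] p_def[symmetric])
  ultimately show "\<exists>g\<in>carrier G. \<exists>b\<in>B. \<exists>b'\<in>B. x b \<noteq> 0 \<and> x b' \<noteq> 0 \<and> n \<otimes> b = \<delta> g \<otimes> b'"
    by (intro bexI[of _ g] bexI[of _ "w \<otimes> p"] bexI[of _ "w \<otimes> (w \<otimes> p)"] conjI) simp_all
qed

section \<open>Twisted group algebras\<close>

lemma op_bound_diff_trans:
  assumes "T \<in> bounded_operators I" "U \<in> bounded_operators I" "V \<in> bounded_operators I"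
    and 1: "op_bound I (op_diff I T U) a" and 2: "op_bound I (op_diff I U V) b"
  shows "op_bound I (op_diff I T V) (a + b)"
  unfolding op_bound_def
proof
  fix f assume f: "f \<in> ell2 I"
  note b = bounded_operators_ell2[OF assms(1) f] bounded_operators_ell2[OF assms(2) f]
    bounded_operators_ell2[OF assms(3) f]
  have "op_diff I T V f = (\<lambda>k. op_diff I T U f k + op_diff I U V f k)"
    using f by (simp add: op_diff_def)
  then have "ell2_norm I (op_diff I T V f)
      \<le> ell2_norm I (op_diff I T U f) + ell2_norm I (op_diff I U V f)"
    using ell2_norm_triangle[of "op_diff I T U f" I "op_diff I U V f"] f b
    by (simp add: op_diff_def ell2_diff)
  then show "ell2_norm I (op_diff I T V f) \<le> (a + b) * ell2_norm I f"
    using op_boundD[OF 1 f] op_boundD[OF 2 f] by (simp add: distrib_right)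
qed

lemma op_bound_diff_sym:
  assumes "T \<in> bounded_operators I" "U \<in> bounded_operators I" and "op_bound I (op_diff I T U) a"
  shows "op_bound I (op_diff I U T) a"
  unfolding op_bound_def
proof
  fix f assume f: "f \<in> ell2 I"
  note b = bounded_operators_ell2[OF assms(1) f] bounded_operators_ell2[OF assms(2) f]
  have "op_diff I U T f = (\<lambda>k. (-1) * (T f k - U f k))" using f by (simp add: op_diff_def)
  then have "ell2_norm I (op_diff I U T f) = ell2_norm I (op_diff I T U f)"
    using ell2_norm_scale[OF ell2_diff[OF b], of "-1"] f by (simp add: op_diff_def)
  then show "ell2_norm I (op_diff I U T f) \<le> a * ell2_norm I f" using op_boundD[OF assms(3) f] by simp
qed

lemma op_eq_if_bounds:
  assumes T: "T \<in> bounded_operators I" and U: "U \<in> bounded_operators I"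
    and bd: "\<And>\<epsilon>. \<epsilon> > 0 \<Longrightarrow> op_bound I (op_diff I T U) (C * \<epsilon>)"
  shows "T = U"
proof (rule bounded_operators_eqI[OF T U])
  fix f assume f: "f \<in> ell2 I"
  note b = bounded_operators_ell2[OF T f] bounded_operators_ell2[OF U f]
  have *: "ell2_norm I (\<lambda>k. T f k - U f k) \<le> C * \<epsilon> * ell2_norm I f" if "\<epsilon> > 0" for \<epsilon>
    using op_boundD[OF bd[OF that] f] f by (simp add: op_diff_def)
  have lim: "((\<lambda>\<epsilon>. C * \<epsilon> * ell2_norm I f) \<longlongrightarrow> C * 0 * ell2_norm I f) (at_right 0)"
    by (intro tendsto_intros)
  have "ell2_norm I (\<lambda>k. T f k - U f k) \<le> C * 0 * ell2_norm I f"
    by (rule tendsto_lowerbound[OF lim])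
      (use * in \<open>auto intro: eventually_at_rightI[of 0 1]\<close>)
  then have "(\<lambda>k. T f k - U f k) = (\<lambda>_. 0)" using ell2_norm_eq_0[OF ell2_diff[OF b]] by simp
  then show "T f = U f" by (auto simp: fun_eq_iff)
qed

lemma op_adjoint_diff:
  assumes "T \<in> bounded_operators I" "U \<in> bounded_operators I"
  shows "op_adjoint I (op_diff I T U) = op_diff I (op_adjoint I T) (op_adjoint I U)"
  using assms by (simp add: op_diff_conv op_adjoint_add op_adjoint_scale bounded_operators_op_scale)

locale twisted_group = group G for G :: "('g, 'm) monoid_scheme" (structure) +
  fixes c :: "'g \<Rightarrow> 'g \<Rightarrow> complex"
  assumes cocycle: "two_cocycle G c"
begin

abbreviation "H \<equiv> ell2 (carrier G)"
abbreviation "nrm \<equiv> ell2_norm (carrier G)"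
abbreviation "Bd \<equiv> bounded_operators (carrier G)"
abbreviation "bound \<equiv> op_bound (carrier G)"
abbreviation cmp (infixl "\<star>" 70) where "T \<star> U \<equiv> compose H T U"
abbreviation "oadd \<equiv> op_add (carrier G)"
abbreviation "odiff \<equiv> op_diff (carrier G)"
abbreviation "oscale \<equiv> op_scale (carrier G)"
abbreviation "zop \<equiv> (\<lambda>f\<in>H. (\<lambda>_. 0) :: 'g vec)"
abbreviation "dl \<equiv> delta G c"
abbreviation "cl \<equiv> delta_closure G c"

lemma c_norm: "g \<in> carrier G \<Longrightarrow> h \<in> carrier G \<Longrightarrow> cmod (c g h) = 1"
  and c_one: "g \<in> carrier G \<Longrightarrow> c g \<one> = 1" "g \<in> carrier G \<Longrightarrow> c \<one> g = 1"
  and c_cocycle: "g \<in> carrier G \<Longrightarrow> h \<in> carrier G \<Longrightarrow> k \<in> carrier G \<Longrightarrow>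
    c g (h \<otimes> k) * c h k = c (g \<otimes> h) k * c g h"
  using cocycle by (auto simp: two_cocycle_def)

lemma c_nonzero: "g \<in> carrier G \<Longrightarrow> h \<in> carrier G \<Longrightarrow> c g h \<noteq> 0"
  using c_norm by fastforce

lemma c_cnj: "g \<in> carrier G \<Longrightarrow> h \<in> carrier G \<Longrightarrow> cnj (c g h) * c g h = 1"
  by (metis c_norm complex_norm_square mult.commute of_real_1 one_power2)

lemma c_inv: assumes g: "g \<in> carrier G" shows "c g (inv g) = c (inv g) g"
  using c_cocycle[OF g inv_closed[OF g] g] g by (simp add: c_one)

lemma inv_mult_cancel: "g \<in> carrier G \<Longrightarrow> h \<in> carrier G \<Longrightarrow> inv g \<otimes> (g \<otimes> h) = h"
  by (simp add: m_assoc[symmetric])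

lemma mult_inv_cancel: "g \<in> carrier G \<Longrightarrow> h \<in> carrier G \<Longrightarrow> g \<otimes> (inv g \<otimes> h) = h"
  by (simp add: m_assoc[symmetric])

lemma compose_assoc_op:
  assumes "T \<in> Bd" "U \<in> Bd" "V \<in> Bd" shows "T \<star> U \<star> V = T \<star> (U \<star> V)"
  by (rule bounded_operators_eqI[of _ "carrier G"])
    (simp_all add: bounded_operators_compose assms,
      simp add: compose_def bounded_operators_ell2 assms)

subsection \<open>The operators \<open>\<delta>\<close>\<close>

lemma delta_apply:
  "f \<in> H \<Longrightarrow> dl g f k = (if k \<in> carrier G then c g (inv g \<otimes> k) * f (inv g \<otimes> k) else 0)"
  by (simp add: delta_def)

lemma delta_apply_mult:
  "f \<in> H \<Longrightarrow> g \<in> carrier G \<Longrightarrow> j \<in> carrier G \<Longrightarrow> dl g f (g \<otimes> j) = c g j * f j"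
  by (simp add: delta_apply inv_mult_cancel)

lemma
  assumes g: "g \<in> carrier G"
  shows delta_bounded: "dl g \<in> Bd" and delta_op_bound: "bound (dl g) 1"
proof -
  have *: "dl g f \<in> H \<and> nrm (dl g f) \<le> nrm f" if f: "f \<in> H" for f
  proof -
    have bd: "L2_set (\<lambda>k. cmod (dl g f k)) F \<le> nrm f" if F: "finite F" "F \<subseteq> carrier G" for F
    proof -
      have inj: "inj_on (\<lambda>k. inv g \<otimes> k) F"
        using F g by (intro inj_onI) (metis mult_inv_cancel subsetD)
      have "L2_set (\<lambda>k. cmod (dl g f k)) F = L2_set (\<lambda>j. cmod (f j)) ((\<lambda>k. inv g \<otimes> k) ` F)"
        unfolding L2_set_def sum.reindex[OF inj] o_def
        using F g f by (intro arg_cong[of _ _ sqrt] sum.cong refl)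
          (auto simp: delta_apply norm_mult c_norm subset_iff)
      also have "\<dots> \<le> nrm f"
        by (rule L2_set_le_ell2_norm) (use F g f in auto)
      finally show ?thesis .
    qed
    have z: "\<And>k. k \<notin> carrier G \<Longrightarrow> dl g f k = 0" using f by (simp add: delta_apply)
    show ?thesis using ell2I_bounded[OF z bd] by blast
  qed
  then show B: "bound (dl g) 1" by (simp add: op_bound_def)
  show "dl g \<in> Bd"
    by (rule bounded_operatorsI[OF _ _ _ _ B])
      (use * in \<open>auto simp: delta_def ell2_add ell2_scale algebra_simps fun_eq_iff\<close>)
qed

lemma delta_unit:
  assumes "g \<in> carrier G" "h \<in> carrier G"
  shows "dl g (unit_vec h) = (\<lambda>k. c g h * unit_vec (g \<otimes> h) k)"
proof
  fix k
  have "inv g \<otimes> k = h \<longleftrightarrow> k = g \<otimes> h" if "k \<in> carrier G"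
    using assms that by (metis inv_mult_cancel mult_inv_cancel)
  then show "dl g (unit_vec h) k = c g h * unit_vec (g \<otimes> h) k"
    using assms unfolding delta_apply[OF unit_vec_ell2[OF assms(2)]] by (auto simp: unit_vec_def inv_mult_cancel)
qed

lemma delta_mult:
  assumes g: "g \<in> carrier G" and h: "h \<in> carrier G"
  shows "dl g \<star> dl h = oscale (c g h) (dl (g \<otimes> h))"
proof (rule bounded_operators_eqI[of _ "carrier G"])
  show "dl g \<star> dl h \<in> Bd" "oscale (c g h) (dl (g \<otimes> h)) \<in> Bd"
    using g h by (auto intro!: bounded_operators_compose bounded_operators_op_scale delta_bounded)
  fix f assume f: "f \<in> H"
  show "(dl g \<star> dl h) f = oscale (c g h) (dl (g \<otimes> h)) f"
  proof
    fix k
    show "(dl g \<star> dl h) f k = oscale (c g h) (dl (g \<otimes> h)) f k"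
    proof (cases "k \<in> carrier G")
      case k: True
      \<comment> \<open>Writing k = g (h j) removes all inverses from the coordinate formula; what
        is left is the cocycle identity for g, h, j.\<close>
      define j where "j = inv h \<otimes> (inv g \<otimes> k)"
      have j: "j \<in> carrier G" using g h k by (simp add: j_def)
      have kj: "k = g \<otimes> (h \<otimes> j)" using g h k by (simp add: j_def mult_inv_cancel)
      have "(dl g \<star> dl h) f k = c g (h \<otimes> j) * (c h j * f j)"
        using f g h j by (simp add: compose_def kj delta_apply_mult bounded_operators_ell2[OF delta_bounded])
      also have "\<dots> = c g h * (c (g \<otimes> h) j * f j)"
        using c_cocycle[OF g h j] by (simp add: mult_ac)
      also have "\<dots> = oscale (c g h) (dl (g \<otimes> h)) f k"
        using f g h j delta_apply_mult[of f "g \<otimes> h" j] by (simp add: op_scale_def kj m_assoc)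
      finally show ?thesis .
    qed (use f g h in \<open>simp add: compose_def op_scale_def delta_apply bounded_operators_ell2[OF delta_bounded]\<close>)
  qed
qed

lemma delta_one: "dl \<one> = (\<lambda>f\<in>H. f)"
proof -
  have "dl \<one> f = f" if f: "f \<in> H" for f
    using f by (auto simp: delta_apply c_one ell2_zero_outside)
  then show ?thesis by (auto simp: delta_def)
qed

lemma delta_adjoint:
  assumes g: "g \<in> carrier G"
  shows "op_adjoint (carrier G) (dl g) = oscale (cnj (c g (inv g))) (dl (inv g))"
proof (rule op_adjoint_eqI)
  show "oscale (cnj (c g (inv g))) (dl (inv g)) \<in> Bd"
    using g by (auto intro!: bounded_operators_op_scale delta_bounded)
  fix f h assume f: "f \<in> H" and h: "h \<in> H"
  have bij: "bij_betw (\<lambda>j. g \<otimes> j) (carrier G) (carrier G)"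
    by (rule bij_betwI[where g = "\<lambda>j. inv g \<otimes> j"]) (use g in \<open>auto simp: inv_mult_cancel mult_inv_cancel\<close>)
  have "ell2_inner (carrier G) (dl g f) h = (\<Sum>\<^sub>\<infinity>j\<in>carrier G. dl g f (g \<otimes> j) * cnj (h (g \<otimes> j)))"
    unfolding ell2_inner_def by (rule infsum_reindex_bij_betw[OF bij, symmetric])
  also have "\<dots> = ell2_inner (carrier G) f (oscale (cnj (c g (inv g))) (dl (inv g)) h)"
    unfolding ell2_inner_def
  proof (rule infsum_cong)
    fix j assume j: "j \<in> carrier G"
    have ic: "inv g \<in> carrier G" "g \<otimes> j \<in> carrier G" using g j by auto
    \<comment> \<open>The cocycle identity for the triple g, g^{-1}, g j.\<close>
    have "c g j * c (inv g) (g \<otimes> j) = c g (inv g)"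
      using c_cocycle[OF g ic] g j by (simp add: inv_mult_cancel c_one)
    then have e: "c g j = c g (inv g) * cnj (c (inv g) (g \<otimes> j))"
      using c_cnj[OF ic] by (metis mult.assoc mult.commute mult.right_neutral)
    have "dl (inv g) h j = c (inv g) (g \<otimes> j) * h (g \<otimes> j)"
      using g j h by (simp add: delta_apply)
    then have "oscale (cnj (c g (inv g))) (dl (inv g)) h j = cnj (c g (inv g)) * (c (inv g) (g \<otimes> j) * h (g \<otimes> j))"
      using h by (simp add: op_scale_def)
    then show "dl g f (g \<otimes> j) * cnj (h (g \<otimes> j)) = f j * cnj (oscale (cnj (c g (inv g))) (dl (inv g)) h j)"
      using g j f by (simp add: delta_apply_mult e mult_ac)
  qed
  finally show "ell2_inner (carrier G) (dl g f) h
      = ell2_inner (carrier G) f (oscale (cnj (c g (inv g))) (dl (inv g)) h)" .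
qed

lemma scale_scale: "oscale z (oscale w T) = oscale (z * w) T"
  by (auto simp: op_scale_def mult.assoc)

lemma scale_compose: "U \<in> Bd \<Longrightarrow> oscale z T \<star> U = oscale z (T \<star> U)"
  by (rule ext) (simp add: op_scale_def compose_def bounded_operators_ell2)

lemma compose_scale: "T \<in> Bd \<Longrightarrow> U \<in> Bd \<Longrightarrow> T \<star> oscale z U = oscale z (T \<star> U)"
  by (rule ext) (simp add: op_scale_def compose_def bounded_operators_ell2 bounded_operators_scale)

lemma compose_add: "T \<in> Bd \<Longrightarrow> U \<in> Bd \<Longrightarrow> V \<in> Bd \<Longrightarrow> T \<star> oadd U V = oadd (T \<star> U) (T \<star> V)"
  by (rule ext) (simp add: op_add_def compose_def bounded_operators_ell2 bounded_operators_add)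

lemma add_compose: "V \<in> Bd \<Longrightarrow> oadd T U \<star> V = oadd (T \<star> V) (U \<star> V)"
  by (rule ext) (simp add: op_add_def compose_def bounded_operators_ell2)

lemma compose_diff: "T \<in> Bd \<Longrightarrow> U \<in> Bd \<Longrightarrow> V \<in> Bd \<Longrightarrow> T \<star> odiff U V = odiff (T \<star> U) (T \<star> V)"
  by (rule ext) (simp add: op_diff_def compose_def bounded_operators_ell2 bounded_operators_diff)

lemma diff_compose: "V \<in> Bd \<Longrightarrow> odiff T U \<star> V = odiff (T \<star> V) (U \<star> V)"
  by (rule ext) (simp add: op_diff_def compose_def bounded_operators_ell2)

lemma scale_one: "T \<in> Bd \<Longrightarrow> oscale 1 T = T"
  by (rule bounded_operators_eqI[of _ "carrier G"]) (simp_all add: bounded_operators_op_scale, simp add: op_scale_def)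

lemma compose_id: "T \<in> Bd \<Longrightarrow> T \<star> (\<lambda>f\<in>H. f) = T"
  by (rule bounded_operators_eqI[of _ "carrier G"])
    (simp_all add: bounded_operators_compose bounded_operators_id, simp add: compose_def)

lemma id_compose: "T \<in> Bd \<Longrightarrow> (\<lambda>f\<in>H. f) \<star> T = T"
  by (rule bounded_operators_eqI[of _ "carrier G"])
    (simp_all add: bounded_operators_compose bounded_operators_id, simp add: compose_def bounded_operators_ell2)

lemma delta_unitary:
  assumes g: "g \<in> carrier G"
  shows "op_adjoint (carrier G) (dl g) \<star> dl g = (\<lambda>f\<in>H. f)"
    and "dl g \<star> op_adjoint (carrier G) (dl g) = (\<lambda>f\<in>H. f)"
proof -
  note b = delta_bounded[OF g] delta_bounded[OF inv_closed[OF g]]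
  have e: "cnj (c g (inv g)) * c g (inv g) = 1" using c_cnj g by simp
  show "op_adjoint (carrier G) (dl g) \<star> dl g = (\<lambda>f\<in>H. f)"
    unfolding delta_adjoint[OF g] using g b e
    by (simp add: scale_compose delta_mult scale_scale c_inv[OF g, symmetric] delta_one scale_one bounded_operators_id)
  show "dl g \<star> op_adjoint (carrier G) (dl g) = (\<lambda>f\<in>H. f)"
    unfolding delta_adjoint[OF g] using g b e
    by (simp add: compose_scale delta_mult scale_scale delta_one scale_one bounded_operators_id)
qed

subsection \<open>Norm closures of spans of the \<open>\<delta>\<close>\<close>

abbreviation "comb \<equiv> delta_combination G c"

lemma comb_empty: "comb {} a = zop"
  by (simp add: delta_combination_def)

lemma comb_insert:
  "finite F \<Longrightarrow> g \<notin> F \<Longrightarrow> comb (insert g F) a = oadd (oscale (a g) (dl g)) (comb F a)"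
  by (auto simp: delta_combination_def op_add_def op_scale_def)

lemma comb_bounded: "finite F \<Longrightarrow> F \<subseteq> carrier G \<Longrightarrow> comb F a \<in> Bd"
  by (induction F rule: finite_induct)
    (auto simp: comb_empty comb_insert bounded_operators_zero_op
      intro!: bounded_operators_op_add bounded_operators_op_scale delta_bounded)

text \<open>Passes from a strict inequality for \<open>op_norm\<close> to \<open>op_bound\<close>;
  strictness is regained by approximating within half of \<epsilon>.\<close>

lemma closure_iff:
  assumes Y: "Y \<subseteq> carrier G"
  shows "T \<in> cl Y \<longleftrightarrow> T \<in> Bd \<and>
    (\<forall>\<epsilon>>0. \<exists>F a. finite F \<and> F \<subseteq> Y \<and> bound (odiff T (comb F a)) \<epsilon>)"
proof
  assume T: "T \<in> cl Y"
  then have TB: "T \<in> Bd"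
    and app: "\<And>\<epsilon>. \<epsilon> > 0 \<Longrightarrow> \<exists>F a. finite F \<and> F \<subseteq> Y \<and> op_norm (carrier G) (odiff T (comb F a)) < \<epsilon>"
    by (simp_all add: delta_closure_def)
  have "\<exists>F a. finite F \<and> F \<subseteq> Y \<and> bound (odiff T (comb F a)) \<epsilon>" if e: "\<epsilon> > 0" for \<epsilon>
  proof -
    obtain F a where F: "finite F" "F \<subseteq> Y" "op_norm (carrier G) (odiff T (comb F a)) < \<epsilon>"
      using app[OF e] by auto
    have "odiff T (comb F a) \<in> Bd" using F Y by (intro bounded_operators_op_diff comb_bounded TB) auto
    then have "bound (odiff T (comb F a)) \<epsilon>"
      by (rule op_bound_mono[OF op_bound_op_norm less_imp_le[OF F(3)]])
    then show ?thesis using F by (intro exI[of _ F] exI[of _ a]) simp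
  qed
  then show "T \<in> Bd \<and> (\<forall>\<epsilon>>0. \<exists>F a. finite F \<and> F \<subseteq> Y \<and> bound (odiff T (comb F a)) \<epsilon>)"
    using TB by simp
next
  assume T: "T \<in> Bd \<and> (\<forall>\<epsilon>>0. \<exists>F a. finite F \<and> F \<subseteq> Y \<and> bound (odiff T (comb F a)) \<epsilon>)"
  have "\<exists>F a. finite F \<and> F \<subseteq> Y \<and> op_norm (carrier G) (odiff T (comb F a)) < \<epsilon>" if e: "\<epsilon> > 0" for \<epsilon>
  proof -
    obtain F a where F: "finite F" "F \<subseteq> Y" "bound (odiff T (comb F a)) (\<epsilon> / 2)"
      using conjunct2[OF T, rule_format, of "\<epsilon> / 2"] e by auto
    have "op_norm (carrier G) (odiff T (comb F a)) \<le> \<epsilon> / 2"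
      using op_norm_le[OF F(3)] e by simp
    then show ?thesis using F e by (intro exI[of _ F] exI[of _ a]) simp
  qed
  then show "T \<in> cl Y" using T by (simp add: delta_closure_def)
qed

lemma closure_approx:
  assumes "Y \<subseteq> carrier G" "T \<in> cl Y" "\<epsilon> > 0"
  obtains F a where "finite F" "F \<subseteq> Y" "bound (odiff T (comb F a)) \<epsilon>"
proof -
  have "\<exists>F a. finite F \<and> F \<subseteq> Y \<and> bound (odiff T (comb F a)) \<epsilon>"
    using assms(2,3) unfolding closure_iff[OF assms(1)] by simp
  then show ?thesis using that by auto
qed

lemma closure_bounded: "T \<in> cl Y \<Longrightarrow> T \<in> Bd"
  by (simp add: delta_closure_def)

lemma closure_mono:
  assumes "Y \<subseteq> Z" shows "cl Y \<subseteq> cl Z"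
  unfolding delta_closure_def
proof (rule Collect_mono, intro impI)
  fix T
  assume T: "T \<in> Bd \<and> (\<forall>\<epsilon>>0. \<exists>F a. finite F \<and> F \<subseteq> Y \<and> op_norm (carrier G) (odiff T (comb F a)) < \<epsilon>)"
  have "F \<subseteq> Z" if "F \<subseteq> Y" for F using that assms by (rule subset_trans)
  with T show "T \<in> Bd \<and> (\<forall>\<epsilon>>0. \<exists>F a. finite F \<and> F \<subseteq> Z \<and> op_norm (carrier G) (odiff T (comb F a)) < \<epsilon>)"
    by metis
qed

context
  fixes Y assumes Y: "Y \<subseteq> carrier G"
begin

lemma closure_limit:
  assumes T: "T \<in> Bd" and app: "\<And>\<epsilon>. \<epsilon> > 0 \<Longrightarrow> \<exists>U\<in>cl Y. bound (odiff T U) \<epsilon>"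
  shows "T \<in> cl Y"
  unfolding closure_iff[OF Y]
proof (intro conjI T allI impI)
  fix \<epsilon> :: real assume e: "\<epsilon> > 0"
  obtain U where U: "U \<in> cl Y" "bound (odiff T U) (\<epsilon> / 2)" using app[of "\<epsilon> / 2"] e by auto
  obtain F a where F: "finite F" "F \<subseteq> Y" "bound (odiff U (comb F a)) (\<epsilon> / 2)"
    by (rule closure_approx[OF Y U(1) half_gt_zero[OF e]])
  have "comb F a \<in> Bd" using F Y by (intro comb_bounded) auto
  then have "bound (odiff T (comb F a)) (\<epsilon> / 2 + \<epsilon> / 2)"
    using op_bound_diff_trans[OF T closure_bounded[OF U(1)] _ U(2) F(3)] by blast
  then show "\<exists>F a. finite F \<and> F \<subseteq> Y \<and> bound (odiff T (comb F a)) \<epsilon>" using F by auto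
qed

lemma comb_in_closure:
  assumes "finite F" "F \<subseteq> Y" shows "comb F a \<in> cl Y"
  unfolding closure_iff[OF Y]
proof (intro conjI allI impI)
  show "comb F a \<in> Bd" using assms Y by (intro comb_bounded) auto
  fix \<epsilon> :: real assume "\<epsilon> > 0"
  then have "bound (odiff (comb F a) (comb F a)) \<epsilon>"
    by (auto simp: op_bound_def op_diff_def ell2_norm_zero ell2_norm_nonneg)
  then show "\<exists>F' a'. finite F' \<and> F' \<subseteq> Y \<and> bound (odiff (comb F a) (comb F' a')) \<epsilon>"
    using assms by blast
qed

lemma zero_in_closure: "zop \<in> cl Y"
  using comb_in_closure[of "{}"] by (simp add: comb_empty)

lemma delta_in_closure: "g \<in> Y \<Longrightarrow> dl g \<in> cl Y"
proof -
  assume g: "g \<in> Y"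
  have "comb {g} (\<lambda>_. 1) = dl g" by (rule ext) (auto simp: delta_combination_def delta_def)
  then show ?thesis using comb_in_closure[of "{g}"] g by (metis empty_subsetI finite.emptyI finite.insertI insert_subset)
qed

lemma closure_scale:
  assumes T: "T \<in> cl Y" shows "oscale z T \<in> cl Y"
  unfolding closure_iff[OF Y]
proof (intro conjI allI impI)
  note TB = closure_bounded[OF T]
  show "oscale z T \<in> Bd" by (rule bounded_operators_op_scale[OF TB])
  fix \<epsilon> :: real assume e: "\<epsilon> > 0"
  define \<eta> where "\<eta> = \<epsilon> / (cmod z + 1)"
  have eta: "\<eta> > 0" using e by (simp add: \<eta>_def add_nonneg_pos)
  obtain F a where F: "finite F" "F \<subseteq> Y" "bound (odiff T (comb F a)) \<eta>"
    by (rule closure_approx[OF Y T eta])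
  have cb: "comb F a \<in> Bd" using F Y by (intro comb_bounded) auto
  have eq: "odiff (oscale z T) (comb F (\<lambda>g. z * a g)) = oscale z (odiff T (comb F a))"
    by (auto simp: op_diff_def op_scale_def delta_combination_def sum_distrib_left right_diff_distrib mult.assoc)
  have m: "cmod z * \<eta> \<le> \<epsilon>"
  proof -
    have "cmod z * \<eta> \<le> (cmod z + 1) * \<eta>" using eta by simp
    also have "\<dots> = \<epsilon>" unfolding \<eta>_def by (simp add: add_nonneg_pos less_imp_neq[symmetric])
    finally show ?thesis .
  qed
  have d: "\<And>f. f \<in> H \<Longrightarrow> odiff T (comb F a) f \<in> H"
    by (rule bounded_operators_ell2[OF bounded_operators_op_diff[OF TB cb]])
  have "bound (oscale z (odiff T (comb F a))) (cmod z * \<eta>)"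
    by (rule op_bound_scale[OF F(3) d F(3) d])
  then show "\<exists>F a. finite F \<and> F \<subseteq> Y \<and> bound (odiff (oscale z T) (comb F a)) \<epsilon>"
    using F op_bound_mono[OF _ m] unfolding eq[symmetric] by blast
qed

lemma closure_add:
  assumes T: "T \<in> cl Y" and U: "U \<in> cl Y" shows "oadd T U \<in> cl Y"
  unfolding closure_iff[OF Y]
proof (intro conjI allI impI)
  note TB = closure_bounded[OF T] note UB = closure_bounded[OF U]
  show "oadd T U \<in> Bd" by (rule bounded_operators_op_add[OF TB UB])
  fix \<epsilon> :: real assume e: "\<epsilon> > 0"
  obtain F a where F: "finite F" "F \<subseteq> Y" "bound (odiff T (comb F a)) (\<epsilon> / 2)"
    by (rule closure_approx[OF Y T half_gt_zero[OF e]])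
  obtain F' a' where F': "finite F'" "F' \<subseteq> Y" "bound (odiff U (comb F' a')) (\<epsilon> / 2)"
    by (rule closure_approx[OF Y U half_gt_zero[OF e]])
  have cb: "comb F a \<in> Bd" "comb F' a' \<in> Bd" using F F' Y by (auto intro!: comb_bounded)
  define b where "b g = (if g \<in> F then a g else 0) + (if g \<in> F' then a' g else 0)" for g
  have s: "(\<Sum>g\<in>F \<union> F'. b g * dl g f k) = (\<Sum>g\<in>F. a g * dl g f k) + (\<Sum>g\<in>F'. a' g * dl g f k)" for f k
  proof -
    have "(\<Sum>g\<in>F \<union> F'. b g * dl g f k)
        = (\<Sum>g\<in>F \<union> F'. if g \<in> F then a g * dl g f k else 0) + (\<Sum>g\<in>F \<union> F'. if g \<in> F' then a' g * dl g f k else 0)"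
      unfolding sum.distrib[symmetric] by (rule sum.cong) (auto simp: b_def algebra_simps)
    then show ?thesis using F(1) F'(1) by (simp add: sum.If_cases Int_absorb1 Un_Int_distrib2)
  qed
  have eq: "odiff (oadd T U) (comb (F \<union> F') b) = oadd (odiff T (comb F a)) (odiff U (comb F' a'))"
    by (rule ext) (simp add: op_diff_def op_add_def delta_combination_def s algebra_simps)
  have "bound (odiff (oadd T U) (comb (F \<union> F') b)) (\<epsilon> / 2 + \<epsilon> / 2)"
    unfolding eq by (rule op_bound_add[OF F(3) bounded_operators_ell2[OF bounded_operators_op_diff[OF TB cb(1)]]
          F'(3) bounded_operators_ell2[OF bounded_operators_op_diff[OF UB cb(2)]]])
  moreover have "finite (F \<union> F') \<and> F \<union> F' \<subseteq> Y" using F F' by simp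
  ultimately show "\<exists>F a. finite F \<and> F \<subseteq> Y \<and> bound (odiff (oadd T U) (comb F a)) \<epsilon>"
    by (intro exI[of _ "F \<union> F'"] exI[of _ b]) simp
qed

lemma closure_diff: "T \<in> cl Y \<Longrightarrow> U \<in> cl Y \<Longrightarrow> odiff T U \<in> cl Y"
  unfolding op_diff_conv by (intro closure_add closure_scale)

text \<open>An induction principle for a norm closure. The proof uses \<open>limit\<close> once, at
  the outside, and builds finite combinations with the other cases; applications are free to supply
  approximants from anywhere in the closure.\<close>

lemma closure_induct [consumes 1, case_names zero delta add scale limit]:
  assumes T: "T \<in> cl Y"
    and zero: "P zop"
    and delta: "\<And>g. g \<in> Y \<Longrightarrow> P (dl g)"
    and add: "\<And>T U. T \<in> cl Y \<Longrightarrow> U \<in> cl Y \<Longrightarrow> P T \<Longrightarrow> P U \<Longrightarrow> P (oadd T U)"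
    and scale: "\<And>z T. T \<in> cl Y \<Longrightarrow> P T \<Longrightarrow> P (oscale z T)"
    and limit: "\<And>T. T \<in> cl Y \<Longrightarrow> (\<And>\<epsilon>. \<epsilon> > 0 \<Longrightarrow> \<exists>U\<in>cl Y. P U \<and> bound (odiff T U) \<epsilon>) \<Longrightarrow> P T"
  shows "P T"
proof (rule limit[OF T])
  fix \<epsilon> :: real assume e: "\<epsilon> > 0"
  obtain F a where F: "finite F" "F \<subseteq> Y" "bound (odiff T (comb F a)) \<epsilon>"
    by (rule closure_approx[OF Y T e])
  have "P (comb F a)" using F(1,2)
  proof (induction F rule: finite_induct)
    case empty
    show ?case unfolding comb_empty by (rule zero)
  next
    case (insert g F)
    then show ?case
      by (simp add: comb_insert add scale delta closure_scale delta_in_closure comb_in_closure)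
  qed
  then show "\<exists>U\<in>cl Y. P U \<and> bound (odiff T U) \<epsilon>" using F comb_in_closure by blast
qed

text \<open>The bound is asked for on \<open>cl Y\<close> only, so functionals built from
  characters, which are meaningful only on the algebra, qualify.\<close>

lemma closure_functional_eq_0:
  assumes T: "T \<in> cl Y"
    and \<Phi>_add: "\<And>T U. T \<in> cl Y \<Longrightarrow> U \<in> cl Y \<Longrightarrow> \<Phi> (oadd T U) = \<Phi> T + \<Phi> U"
    and \<Phi>_scale: "\<And>z T. T \<in> cl Y \<Longrightarrow> \<Phi> (oscale z T) = z * \<Phi> T"
    and \<Phi>_bound: "\<And>T \<epsilon>. T \<in> cl Y \<Longrightarrow> \<epsilon> > 0 \<Longrightarrow> bound T \<epsilon> \<Longrightarrow> cmod (\<Phi> T) \<le> C * \<epsilon>"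
    and \<Phi>_delta: "\<And>g. g \<in> Y \<Longrightarrow> \<Phi> (dl g) = 0"
  shows "\<Phi> T = (0 :: complex)"
  using T
proof (induction T rule: closure_induct)
  case zero
  have "oscale 0 zop = zop" by (rule ext) (simp add: op_scale_def)
  with \<Phi>_scale[OF zero_in_closure, of 0] have "\<Phi> zop = 0" by simp
  then show ?case .
next
  case (limit T)
  have *: "cmod (\<Phi> T) \<le> C * \<epsilon>" if e: "\<epsilon> > 0" for \<epsilon>
  proof -
    obtain U where U: "U \<in> cl Y" "\<Phi> U = 0" "bound (odiff T U) \<epsilon>" using limit(2)[OF e] by blast
    have "\<Phi> (odiff T U) = \<Phi> T"
      unfolding op_diff_conv using limit(1) U by (simp add: \<Phi>_add \<Phi>_scale closure_scale)
    then show ?thesis using \<Phi>_bound[OF closure_diff[OF limit(1) U(1)] e U(3)] by simp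
  qed
  have lim: "((\<lambda>\<epsilon>. C * \<epsilon>) \<longlongrightarrow> C * 0) (at_right 0)" by (intro tendsto_intros)
  have "cmod (\<Phi> T) \<le> C * 0"
    by (rule tendsto_lowerbound[OF lim]) (use * in \<open>auto intro: eventually_at_rightI[of 0 1]\<close>)
  then show ?case by simp
qed (simp_all add: \<Phi>_add \<Phi>_scale \<Phi>_delta)

end

text \<open>Two inductions: over the right factor with a single \<delta> on the left, then over the
  left factor with an arbitrary right factor.\<close>

lemma closure_compose:
  assumes Y: "subgroup Y G" and T: "T \<in> cl Y" and U: "U \<in> cl Y"
  shows "T \<star> U \<in> cl Y"
proof -
  have YG: "Y \<subseteq> carrier G" by (rule subgroup.subset[OF Y])
  have 1: "dl g \<star> U \<in> cl Y" if g: "g \<in> Y" and U: "U \<in> cl Y" for g U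
    using U
  proof (induction U rule: closure_induct[OF YG, consumes 1, case_names zero delta add scale limit])
    have gG: "g \<in> carrier G" using g YG by blast
    note dB = delta_bounded[OF gG]
    {
      case zero
      have "dl g \<star> zop = zop"
        by (rule ext) (simp add: compose_def bounded_operators_zero[OF dB])
      then show ?case using zero_in_closure[OF YG] by (simp only:)
    next
      case (delta h)
      then have "h \<in> carrier G" "g \<otimes> h \<in> Y" using g YG subgroup.m_closed[OF Y] by auto
      then show ?case by (simp add: delta_mult gG closure_scale[OF YG] delta_in_closure[OF YG])
    next
      case (add T U)
      then show ?case using dB by (simp add: compose_add closure_bounded closure_add[OF YG])
    next
      case (scale z T)
      then show ?case using dB by (simp add: compose_scale closure_bounded closure_scale[OF YG])
    next
      case (limit T)
      note TB = closure_bounded[OF limit(1)]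
      show ?case
      proof (rule closure_limit[OF YG])
        show "dl g \<star> T \<in> Bd" by (rule bounded_operators_compose[OF dB TB])
        fix \<epsilon> :: real assume "\<epsilon> > 0"
        then obtain U where U: "U \<in> cl Y" "dl g \<star> U \<in> cl Y" "bound (odiff T U) \<epsilon>" using limit(2) by blast
        note UB = closure_bounded[OF U(1)]
        have "bound (dl g \<star> odiff T U) (1 * \<epsilon>)"
          by (rule op_bound_compose[OF delta_op_bound[OF gG] bounded_operators_ell2[OF dB] U(3)
                bounded_operators_ell2[OF bounded_operators_op_diff[OF TB UB]] zero_le_one])
        then have "bound (odiff (dl g \<star> T) (dl g \<star> U)) \<epsilon>" by (simp add: compose_diff dB TB UB)
        then show "\<exists>U\<in>cl Y. bound (odiff (dl g \<star> T) U) \<epsilon>" using U by blast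
      qed
    }
  qed
  note UB = closure_bounded[OF U]
  show ?thesis using T
  proof (induction T rule: closure_induct[OF YG, consumes 1, case_names zero delta add scale limit])
    case zero
    have "zop \<star> U = zop"
      by (rule ext) (simp add: compose_def bounded_operators_ell2[OF UB])
    then show ?case using zero_in_closure[OF YG] by (simp only:)
  next
    case (delta g)
    then show ?case using 1 U by blast
  next
    case (add T V)
    then show ?case using UB by (simp add: add_compose closure_add[OF YG])
  next
    case (scale z T)
    then show ?case using UB by (simp add: scale_compose closure_scale[OF YG])
  next
    case (limit T)
    note TB = closure_bounded[OF limit(1)]
    obtain C where C: "0 \<le> C" "bound U C" using bounded_operators_bound[OF UB] .
    show ?case
    proof (rule closure_limit[OF YG])
      show "T \<star> U \<in> Bd" by (rule bounded_operators_compose[OF TB UB])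
      fix \<epsilon> :: real assume e: "\<epsilon> > 0"
      define \<eta> where "\<eta> = \<epsilon> / (C + 1)"
      have eta: "\<eta> > 0" using e C by (simp add: \<eta>_def)
      obtain V where V: "V \<in> cl Y" "V \<star> U \<in> cl Y" "bound (odiff T V) \<eta>" using limit(2)[OF eta] by blast
      note VB = closure_bounded[OF V(1)]
      have "bound (odiff T V \<star> U) (\<eta> * C)"
        by (rule op_bound_compose[OF V(3) bounded_operators_ell2[OF bounded_operators_op_diff[OF TB VB]]
              C(2) bounded_operators_ell2[OF UB] less_imp_le[OF eta]])
      moreover have "\<eta> * C \<le> \<epsilon>" using C e by (simp add: \<eta>_def field_simps)
      ultimately have "bound (odiff (T \<star> U) (V \<star> U)) \<epsilon>"
        using op_bound_mono by (auto simp: diff_compose UB)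
      then show "\<exists>W\<in>cl Y. bound (odiff (T \<star> U) W) \<epsilon>" using V by blast
    qed
  qed
qed

lemma closure_adjoint:
  assumes Y: "subgroup Y G" and T: "T \<in> cl Y" shows "op_adjoint (carrier G) T \<in> cl Y"
proof -
  have YG: "Y \<subseteq> carrier G" by (rule subgroup.subset[OF Y])
  have z: "op_adjoint (carrier G) zop = zop"
    by (rule op_adjoint_eqI[OF bounded_operators_zero_op]) (simp add: ell2_inner_def)
  show ?thesis using T
  proof (induction T rule: closure_induct[OF YG, consumes 1, case_names zero delta add scale limit])
    case zero
    then show ?case using zero_in_closure[OF YG] by (simp only: z)
  next
    case (delta g)
    then have "g \<in> carrier G" "inv g \<in> Y" using YG subgroup.m_inv_closed[OF Y] by auto
    then show ?case by (simp add: delta_adjoint closure_scale[OF YG] delta_in_closure[OF YG])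
  next
    case (add T U)
    then show ?case by (simp add: op_adjoint_add closure_bounded closure_add[OF YG])
  next
    case (scale z T)
    then show ?case by (simp add: op_adjoint_scale closure_bounded closure_scale[OF YG])
  next
    case (limit T)
    note TB = closure_bounded[OF limit(1)]
    show ?case
    proof (rule closure_limit[OF YG])
      show "op_adjoint (carrier G) T \<in> Bd" by (rule op_adjoint_bounded[OF TB])
      fix \<epsilon> :: real assume e: "\<epsilon> > 0"
      obtain U where U: "U \<in> cl Y" "op_adjoint (carrier G) U \<in> cl Y" "bound (odiff T U) \<epsilon>"
        using limit(2)[OF e] by blast
      note UB = closure_bounded[OF U(1)]
      have "bound (op_adjoint (carrier G) (odiff T U)) \<epsilon>"
        using op_adjoint_op_bound[OF bounded_operators_op_diff[OF TB UB] U(3)] e by simp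
      then show "\<exists>W\<in>cl Y. bound (odiff (op_adjoint (carrier G) T) W) \<epsilon>"
        using U by (auto simp: op_adjoint_diff TB UB)
    qed
  qed
qed

lemma closure_id: "\<one> \<in> Y \<Longrightarrow> Y \<subseteq> carrier G \<Longrightarrow> (\<lambda>f\<in>H. f) \<in> cl Y"
  using delta_in_closure[of Y \<one>] by (simp add: delta_one)

text \<open>Every coordinate of (T V - V T) f is a bounded linear functional of \<open>T\<close>, so
  commutation has to be checked on the generators only.\<close>

lemma closure_commute:
  assumes Y: "Y \<subseteq> carrier G" and T: "T \<in> cl Y" and V: "V \<in> Bd"
    and comm: "\<And>y. y \<in> Y \<Longrightarrow> dl y \<star> V = V \<star> dl y"
  shows "T \<star> V = V \<star> T"
proof (rule bounded_operators_eqI[of _ "carrier G"])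
  note TB = closure_bounded[OF T]
  show "T \<star> V \<in> Bd" "V \<star> T \<in> Bd" by (auto intro!: bounded_operators_compose TB V)
  fix f assume f: "f \<in> H"
  obtain C where C: "0 \<le> C" "bound V C" using bounded_operators_bound[OF V] .
  note Vl = bounded_operators_ell2[OF V]
  have "(T \<star> V) f k - (V \<star> T) f k = 0" for k
  proof (rule closure_functional_eq_0[OF Y T, where C = "2 * C * nrm f" and \<Phi> = "\<lambda>T. (T \<star> V) f k - (V \<star> T) f k"])
    fix T U assume "T \<in> cl Y" "U \<in> cl Y"
    then show "(oadd T U \<star> V) f k - (V \<star> oadd T U) f k
        = ((T \<star> V) f k - (V \<star> T) f k) + ((U \<star> V) f k - (V \<star> U) f k)"
      using f by (simp add: compose_add[OF V] add_compose[OF V] closure_bounded) (simp add: op_add_def)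
  next
    fix z T assume "T \<in> cl Y"
    then show "(oscale z T \<star> V) f k - (V \<star> oscale z T) f k = z * ((T \<star> V) f k - (V \<star> T) f k)"
      using f by (simp add: compose_scale[OF V] scale_compose[OF V] closure_bounded)
        (simp add: op_scale_def right_diff_distrib)
  next
    fix T \<epsilon> assume T: "T \<in> cl Y" and e: "\<epsilon> > (0 :: real)" and b: "bound T \<epsilon>"
    note Tl = bounded_operators_ell2[OF closure_bounded[OF T]]
    have "cmod ((T \<star> V) f k) \<le> nrm (T (V f))"
      using f by (simp add: compose_def cmod_le_ell2_norm Tl Vl)
    also have "\<dots> \<le> \<epsilon> * (C * nrm f)"
      using op_boundD[OF b Vl[OF f]] op_boundD[OF C(2) f] e by (meson less_eq_real_def mult_left_mono order_trans)
    finally have 1: "cmod ((T \<star> V) f k) \<le> \<epsilon> * (C * nrm f)" .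
    have "cmod ((V \<star> T) f k) \<le> nrm (V (T f))"
      using f by (simp add: compose_def cmod_le_ell2_norm Tl Vl)
    also have "\<dots> \<le> C * (\<epsilon> * nrm f)"
      using op_boundD[OF C(2) Tl[OF f]] op_boundD[OF b f] C(1) by (meson mult_left_mono order_trans)
    finally have 2: "cmod ((V \<star> T) f k) \<le> C * (\<epsilon> * nrm f)" .
    show "cmod ((T \<star> V) f k - (V \<star> T) f k) \<le> 2 * C * nrm f * \<epsilon>"
      using norm_triangle_ineq4[of "(T \<star> V) f k" "(V \<star> T) f k"] 1 2 by (simp add: mult_ac)
  next
    fix g assume "g \<in> Y"
    then show "(dl g \<star> V) f k - (V \<star> dl g) f k = 0" by (simp add: comm)
  qed
  then show "(T \<star> V) f = (V \<star> T) f" by (auto simp: fun_eq_iff)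
qed

subsection \<open>Neumann series\<close>

text \<open>\<open>s\<close> is the sum of all powers of \<open>b\<close> with exponent at least 1,
  so that 1 + s inverts 1 - b. No character can take the value 1 on such a \<open>b\<close>, since
  applying it to the equation would give x s = 1 + x s.\<close>

lemma neumann:
  assumes Y: "subgroup Y G" and b: "b \<in> cl Y" and \<beta>: "bound b \<beta>" "0 \<le> \<beta>" "\<beta> < 1"
  obtains s where "s \<in> cl Y" "s = oadd b (b \<star> s)"
proof -
  have YG: "Y \<subseteq> carrier G" by (rule subgroup.subset[OF Y])
  \<comment> \<open>The sum of the geometric series in \<beta>. The property used is \<beta> +
    \<beta> K \<le> K: the iteration preserves the bound \<open>K\<close>.\<close>
  define K where "K = 1 / (1 - \<beta>)"
  have "K * (1 - \<beta>) = 1" using \<beta> by (simp add: K_def)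
  then have "K - \<beta> * K = 1" by (simp add: algebra_simps)
  then have K: "\<beta> + \<beta> * K \<le> K" "K \<ge> 0" using \<beta> by (linarith, simp add: K_def)
  note bB = closure_bounded[OF b] note bl = bounded_operators_ell2[OF bB]
  \<comment> \<open>Partial sums in Horner form. The step U \<mapsto> b + b U contracts differences
    by \<beta>, which gives the Cauchy estimate and also identifies the limit as a fixed
    point.\<close>
  define T where "T = rec_nat zop (\<lambda>_ U. oadd b (b \<star> U))"
  have T0: "T 0 = zop" and TS: "T (Suc n) = oadd b (b \<star> T n)" for n by (auto simp: T_def)
  have Tc: "T n \<in> cl Y" for n
  proof (induction n)
    case 0
    show ?case unfolding T0 by (rule zero_in_closure[OF YG])
  next
    case (Suc n)
    show ?case unfolding TS by (rule closure_add[OF YG b closure_compose[OF Y b Suc]])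
  qed
  note TB = closure_bounded[OF Tc] note Tl = bounded_operators_ell2[OF TB]
  have bT: "bound (T n) K" for n
  proof (induction n)
    case 0
    show ?case unfolding T0 by (rule op_bound_mono[OF op_bound_zero_op K(2)])
  next
    case (Suc n)
    have "bound (oadd b (b \<star> T n)) (\<beta> + \<beta> * K)"
      by (rule op_bound_add[OF \<beta>(1) bl op_bound_compose[OF \<beta>(1) bl Suc Tl \<beta>(2)]
            bounded_operators_ell2[OF bounded_operators_compose[OF bB TB]]])
    then show ?case unfolding TS using op_bound_mono K(1) by blast
  qed
  have step: "odiff (oadd b (b \<star> V)) (oadd b (b \<star> U)) = b \<star> odiff V U" if "V \<in> Bd" "U \<in> Bd" for U V
    by (rule ext) (use that in \<open>simp add: op_diff_def op_add_def compose_def bounded_operators_diff[OF bB] bounded_operators_ell2\<close>)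
  have stepb: "bound (odiff (oadd b (b \<star> V)) (oadd b (b \<star> U))) (\<beta> * e)"
    if "V \<in> Bd" "U \<in> Bd" "bound (odiff V U) e" for U V e
    unfolding step[OF that(1,2)]
    by (rule op_bound_compose[OF \<beta>(1) bl that(3) bounded_operators_ell2[OF bounded_operators_op_diff[OF that(1,2)]] \<beta>(2)])
  have Cauchy: "bound (odiff (T (n + m)) (T n)) (K * \<beta> ^ n)" for m n
  proof (induction n)
    case 0
    have "odiff (T m) zop = T m"
      by (rule bounded_operators_eqI[OF bounded_operators_op_diff[OF TB bounded_operators_zero_op] TB])
        (simp add: op_diff_def)
    then show ?case using bT[of m] by (simp only: T0 add_0 power_0 mult_1_right)
  next
    case (Suc n)
    show ?case using stepb[OF TB TB Suc] by (simp add: TS mult_ac)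
  qed
  have lim: "(\<lambda>n. K * \<beta> ^ n) \<longlonglongrightarrow> 0"
    using tendsto_mult_right_zero[OF LIMSEQ_realpow_zero[OF \<beta>(2,3)]] .
  obtain s where s: "s \<in> Bd" "\<And>n. bound (odiff s (T n)) (K * \<beta> ^ n)"
    using bounded_operators_complete[OF TB Cauchy lim] by blast
  have small: "\<exists>n. K * \<beta> ^ n \<le> \<epsilon>" if "\<epsilon> > 0" for \<epsilon>
    using order_tendstoD(2)[OF lim that] by (auto simp: eventually_sequentially intro: less_imp_le)
  have sc: "s \<in> cl Y"
  proof (rule closure_limit[OF YG s(1)])
    fix \<epsilon> :: real assume "\<epsilon> > 0"
    then show "\<exists>U\<in>cl Y. bound (odiff s U) \<epsilon>" using small s(2) Tc op_bound_mono by meson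
  qed
  have bsB: "oadd b (b \<star> s) \<in> Bd" by (intro bounded_operators_op_add bounded_operators_compose bB s)
  have "s = oadd b (b \<star> s)"
  proof (rule op_eq_if_bounds[OF s(1) bsB, where C = 2])
    fix \<epsilon> :: real assume e: "\<epsilon> > 0"
    obtain n where n: "K * \<beta> ^ n \<le> \<epsilon>" using small[OF e] by blast
    have p: "K * \<beta> ^ n \<ge> 0" using K \<beta> by simp
    have "bound (odiff s (T (Suc n))) (K * \<beta> ^ Suc n)" by (rule s(2))
    moreover have "bound (odiff (T (Suc n)) (oadd b (b \<star> s))) (\<beta> * (K * \<beta> ^ n))"
      unfolding TS by (rule stepb[OF TB s(1) op_bound_diff_sym[OF s(1) TB s(2)]])
    ultimately have "bound (odiff s (oadd b (b \<star> s))) (K * \<beta> ^ Suc n + \<beta> * (K * \<beta> ^ n))"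
      by (rule op_bound_diff_trans[OF s(1) TB bsB])
    moreover have "K * \<beta> ^ Suc n + \<beta> * (K * \<beta> ^ n) \<le> 2 * \<epsilon>"
      using mult_right_mono[of \<beta> 1 "K * \<beta> ^ n"] \<beta> p n by (simp add: mult_ac)
    ultimately show "bound (odiff s (oadd b (b \<star> s))) (2 * \<epsilon>)" by (rule op_bound_mono)
  qed
  then show ?thesis using that sc by blast
qed

end

subsection \<open>The conditional expectation\<close>

context twisted_group begin

abbreviation "TA \<equiv> twisted_reduced_algebra G c"

lemma TA_simps:
  "carrier TA = cl (carrier G)" "monoid.mult TA = compose H" "monoid.one TA = (\<lambda>f\<in>H. f)"
  "ring.zero TA = zop" "ring.add TA = op_add (carrier G)" "module.smult TA = op_scale (carrier G)"
  "adj TA = op_adjoint (carrier G)"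
  by (simp_all add: twisted_reduced_algebra_def)

lemma one_G: "\<one> \<in> carrier G" by (rule one_closed)

lemma unit_one: "unit_vec \<one> \<in> H" by (rule unit_vec_ell2[OF one_G])

definition coef :: "'g operator \<Rightarrow> 'g \<Rightarrow> complex" where
  "coef T k = T (unit_vec \<one>) k"

lemma coef_bound:
  assumes "T \<in> Bd" "bound T \<epsilon>" "0 \<le> \<epsilon>" "h \<in> carrier G" shows "cmod (T (unit_vec h) k) \<le> \<epsilon>"
proof -
  have u: "unit_vec h \<in> H" by (rule unit_vec_ell2[OF assms(4)])
  have "cmod (T (unit_vec h) k) \<le> nrm (T (unit_vec h))"
    by (rule cmod_le_ell2_norm[OF bounded_operators_ell2[OF assms(1) u]])
  also have "\<dots> \<le> \<epsilon> * nrm (unit_vec h)" by (rule op_boundD[OF assms(2) u])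
  also have "\<dots> \<le> \<epsilon> * 1" by (rule mult_left_mono[OF unit_vec_norm[OF assms(4)] assms(3)])
  finally show ?thesis by simp
qed

text \<open>The columns of the matrix of an element of the algebra are phase-shifted translates of the
  column at the identity, so the element is determined by its coefficients.\<close>

lemma coef_shift:
  assumes T: "T \<in> cl (carrier G)" and h: "h \<in> carrier G" and k: "k \<in> carrier G"
  shows "T (unit_vec h) (k \<otimes> h) = c k h * coef T k"
proof -
  have u: "unit_vec h \<in> H" "unit_vec \<one> \<in> H" using h by (auto intro: unit_vec_ell2)
  have "T (unit_vec h) (k \<otimes> h) - c k h * coef T k = 0"
  proof (rule closure_functional_eq_0[OF subset_refl T, where C = 2])
    fix T U
    show "oadd T U (unit_vec h) (k \<otimes> h) - c k h * coef (oadd T U) k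
        = (T (unit_vec h) (k \<otimes> h) - c k h * coef T k) + (U (unit_vec h) (k \<otimes> h) - c k h * coef U k)"
      using u by (simp add: coef_def op_add_def algebra_simps)
  next
    fix z T
    show "oscale z T (unit_vec h) (k \<otimes> h) - c k h * coef (oscale z T) k
        = z * (T (unit_vec h) (k \<otimes> h) - c k h * coef T k)"
      using u by (simp add: coef_def op_scale_def algebra_simps)
  next
    fix T \<epsilon> assume T: "T \<in> cl (carrier G)" and e: "\<epsilon> > (0 :: real)" "bound T \<epsilon>"
    have 1: "cmod (T (unit_vec h) (k \<otimes> h)) \<le> \<epsilon>"
      by (rule coef_bound[OF closure_bounded[OF T] e(2) less_imp_le[OF e(1)] h])
    have 2: "cmod (c k h * coef T k) \<le> \<epsilon>"
      using coef_bound[OF closure_bounded[OF T] e(2) less_imp_le[OF e(1)] one_closed, of k] h k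
      by (simp add: norm_mult c_norm coef_def)
    show "cmod (T (unit_vec h) (k \<otimes> h) - c k h * coef T k) \<le> 2 * \<epsilon>"
      using norm_triangle_ineq4[of "T (unit_vec h) (k \<otimes> h)" "c k h * coef T k"] 1 2 by simp
  next
    fix g assume g: "g \<in> carrier G"
    have "k \<otimes> h = g \<otimes> h \<longleftrightarrow> k = g" using g h k by (metis right_cancel)
    then show "dl g (unit_vec h) (k \<otimes> h) - c k h * coef (dl g) k = 0"
      unfolding coef_def delta_unit[OF g h] delta_unit[OF g one_closed] using g by (auto simp: c_one unit_vec_def)
  qed
  then show ?thesis by simp
qed

lemma coef_eq_0I:
  assumes T: "T \<in> cl (carrier G)" and z: "\<And>k. k \<in> carrier G \<Longrightarrow> coef T k = 0"
  shows "T = zop"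
proof (rule bounded_operators_eq_0I[OF closure_bounded[OF T]], rule ext)
  fix h j assume h: "h \<in> carrier G"
  note u = unit_vec_ell2[OF h]
  show "T (unit_vec h) j = 0"
  proof (cases "j \<in> carrier G")
    case True
    then have "j = (j \<otimes> inv h) \<otimes> h" using h by (simp add: m_assoc)
    then show ?thesis using coef_shift[OF T h, of "j \<otimes> inv h"] z True h by simp
  qed (rule ell2_zero_outside[OF bounded_operators_ell2[OF closure_bounded[OF T] u]])
qed

lemma coef_delta_compose:
  assumes T: "T \<in> Bd" and h: "h \<in> carrier G" and k: "k \<in> carrier G"
  shows "coef (dl h \<star> T) k = c h (inv h \<otimes> k) * coef T (inv h \<otimes> k)"
  using h k unit_vec_ell2[OF one_closed] bounded_operators_ell2[OF T]
  by (simp add: coef_def compose_def delta_apply)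

subsection \<open>Commuting elements and the cocycle\<close>

text \<open>For group elements this means that \<delta>_g and \<delta>_h commute as operators, which
  explains why it passes to products and inverses.\<close>

definition sym_comm :: "'g \<Rightarrow> 'g \<Rightarrow> bool" where
  "sym_comm g h \<longleftrightarrow> g \<otimes> h = h \<otimes> g \<and> c g h = c h g"

lemma sym_comm_sym: "sym_comm g h \<Longrightarrow> sym_comm h g"
  by (simp add: sym_comm_def)

lemma sym_comm_mult:
  assumes g: "g \<in> carrier G" and h: "h \<in> carrier G" and k: "k \<in> carrier G"
    and gh: "sym_comm g h" and gk: "sym_comm g k"
  shows "sym_comm g (h \<otimes> k)"
proof -
  have e: "g \<otimes> h = h \<otimes> g" "c g h = c h g" "g \<otimes> k = k \<otimes> g" "c g k = c k g"
    using gh gk by (auto simp: sym_comm_def)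
  have "g \<otimes> (h \<otimes> k) = (g \<otimes> h) \<otimes> k" using g h k by (simp add: m_assoc)
  also have "\<dots> = h \<otimes> (g \<otimes> k)" unfolding e using g h k by (simp add: m_assoc e)
  also have "\<dots> = (h \<otimes> k) \<otimes> g" unfolding e using g h k by (simp add: m_assoc)
  finally have 1: "g \<otimes> (h \<otimes> k) = (h \<otimes> k) \<otimes> g" .
  \<comment> \<open>The factor \<open>g\<close> wanders to the right one place at a time: the
    cocycle identity is used for g,h,k, then h,g,k, then h,k,g.\<close>
  have "c g (h \<otimes> k) * c h k = c (g \<otimes> h) k * c g h" by (rule c_cocycle[OF g h k])
  also have "\<dots> = c (h \<otimes> g) k * c h g" by (simp add: e(1,2))
  also have "\<dots> = c h (g \<otimes> k) * c g k" by (rule c_cocycle[OF h g k, symmetric])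
  also have "\<dots> = c h (k \<otimes> g) * c k g" by (simp add: e(3,4))
  also have "\<dots> = c (h \<otimes> k) g * c h k" by (rule c_cocycle[OF h k g])
  finally have 2: "c g (h \<otimes> k) = c (h \<otimes> k) g" using c_nonzero[OF h k] by simp
  show ?thesis using 1 2 by (simp add: sym_comm_def)
qed

lemma sym_comm_inv:
  assumes g: "g \<in> carrier G" and h: "h \<in> carrier G" and gh: "sym_comm g h"
  shows "sym_comm g (inv h)"
proof -
  have e: "g \<otimes> h = h \<otimes> g" "c g h = c h g" using gh by (auto simp: sym_comm_def)
  have ih: "inv h \<in> carrier G" using h by simp
  have 1: "g \<otimes> inv h = inv h \<otimes> g"
  proof -
    have "g \<otimes> inv h = inv h \<otimes> (h \<otimes> g) \<otimes> inv h" using g h by (simp add: inv_mult_cancel)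
    also have "\<dots> = inv h \<otimes> (g \<otimes> h) \<otimes> inv h" by (simp add: e(1))
    also have "\<dots> = inv h \<otimes> g" using g h by (simp add: m_assoc)
    finally show ?thesis .
  qed
  \<comment> \<open>Cocycle identities for the triples g,h^{-1},h and h^{-1},h,g and h^{-1},g,h; the
    products that collapse to the unit leave the common value c(h^{-1},h).\<close>
  have "c (g \<otimes> inv h) h * c g (inv h) = c (inv h) h"
    using c_cocycle[OF g ih h] g h by (simp add: c_one)
  also have "\<dots> = c (inv h) (h \<otimes> g) * c h g"
    using c_cocycle[OF ih h g] g h by (simp add: c_one)
  also have "\<dots> = c (inv h) (g \<otimes> h) * c g h" by (simp add: e)
  also have "\<dots> = c (g \<otimes> inv h) h * c (inv h) g" using c_cocycle[OF ih g h] by (simp add: 1)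
  finally have 2: "c g (inv h) = c (inv h) g" using c_nonzero[OF _ h] g h by simp
  show ?thesis using 1 2 by (simp add: sym_comm_def)
qed

lemma sym_comm_generate:
  assumes g: "g \<in> carrier G" and Y: "Y \<subseteq> carrier G" and gY: "\<And>y. y \<in> Y \<Longrightarrow> sym_comm g y"
    and h: "h \<in> generate G Y"
  shows "sym_comm g h"
  using h
proof (induction h rule: generate.induct)
  case one
  then show ?case using g by (simp add: sym_comm_def c_one)
next
  case (incl h)
  then show ?case by (rule gY)
next
  case (inv h)
  then show ?case using sym_comm_inv[OF g _ gY] Y by blast
next
  case (eng h k)
  then show ?case using sym_comm_mult[OF g] generate_in_carrier[OF Y] by blast
qed

text \<open>\<open>sym_comm_generate\<close> is applied in each variable in turn, so it is enough to
  test generators. This allows \<open>S\<close> to be enlarged by a single element.\<close>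

lemma symmetric_abelian_subgroup_generate:
  assumes Y: "Y \<subseteq> carrier G" and YY: "\<And>y z. y \<in> Y \<Longrightarrow> z \<in> Y \<Longrightarrow> sym_comm y z"
  shows "symmetric_abelian_subgroup G c (generate G Y)"
proof -
  have sub: "subgroup (generate G Y) G" by (rule generate_is_subgroup[OF Y])
  have 1: "sym_comm y h" if "y \<in> Y" "h \<in> generate G Y" for y h
    using sym_comm_generate[OF _ Y YY that(2)] that(1) Y by blast
  have 2: "sym_comm h k" if "h \<in> generate G Y" "k \<in> generate G Y" for h k
    using sym_comm_generate[OF generate_in_carrier[OF Y that(1)] Y sym_comm_sym[OF 1[OF _ that(1)]] that(2)] .
  interpret S: group "G\<lparr>carrier := generate G Y\<rparr>" by (rule subgroup_imp_group[OF sub])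
  have "comm_group (G\<lparr>carrier := generate G Y\<rparr>)"
    by (rule S.group_comm_groupI) (use 2 in \<open>simp add: sym_comm_def\<close>)
  then show ?thesis using sub 2 by (auto simp: symmetric_abelian_subgroup_def sym_comm_def)
qed

end

section \<open>Coset blocks of the subgroup and compression to them\<close>

locale twisted_pair = twisted_group G c + normal S G
  for G :: "('g, 'm) monoid_scheme" (structure) and c :: "'g \<Rightarrow> 'g \<Rightarrow> complex" and S :: "'g set" +
  assumes S_comm: "s \<in> S \<Longrightarrow> t \<in> S \<Longrightarrow> sym_comm s t"
begin

lemma S_sub: "S \<subseteq> carrier G" by (rule subset)

lemma S_subgroup: "subgroup S G" by (rule subgroup_axioms)

lemma carrier_subgroup: "subgroup (carrier G) G" by (rule subgroup_self)

lemma cl_S_sub: "b \<in> cl S \<Longrightarrow> b \<in> cl (carrier G)"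
  using closure_mono[OF S_sub] by blast

lemma rcos_eq: "k \<in> carrier G \<Longrightarrow> j \<in> S #> k \<Longrightarrow> S #> j = S #> k"
  using repr_independence[OF _ _ S_subgroup] by metis

lemma rcos_mem: "k \<in> carrier G \<Longrightarrow> k \<in> S #> k"
  by (rule rcos_self[OF _ S_subgroup])

lemma one_in_rcos: assumes k: "k \<in> carrier G" shows "\<one> \<in> S #> k \<longleftrightarrow> k \<in> S"
proof
  assume "\<one> \<in> S #> k"
  then have "S #> k = S" using rcos_eq[OF k] coset_mult_one[OF S_sub] by metis
  then show "k \<in> S" using rcos_mem[OF k] by simp
next
  assume "k \<in> S"
  then have "S #> k = S" using coset_join2[OF k S_subgroup] by simp
  then show "\<one> \<in> S #> k" using subgroup.one_closed[OF S_subgroup] by simp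
qed

text \<open>Compression of an operator to the diagonal blocks given by the cosets of \<open>S\<close>.\<close>

definition expect :: "'g operator \<Rightarrow> 'g operator" where
  "expect T = (\<lambda>f\<in>H. \<lambda>k. if k \<in> carrier G then T (restr (S #> k) f) k else 0)"

lemma expect_norm:
  assumes T: "T \<in> Bd" and C: "bound T C" "0 \<le> C" and f: "f \<in> H"
  shows "expect T f \<in> H \<and> nrm (expect T f) \<le> C * nrm f"
proof -
  note Tl = bounded_operators_ell2[OF T]
  have bd: "L2_set (\<lambda>k. cmod (expect T f k)) F \<le> C * nrm f" if F: "finite F" "F \<subseteq> carrier G" for F
  proof -
    define Q where "Q = (\<lambda>k. S #> k) ` F"
    \<comment> \<open>Grouped by cosets: on the coset \<open>q\<close> the compressed operator acts
      as \<open>T\<close> on the restriction of \<open>f\<close> to \<open>q\<close>, so each group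
      is controlled by \<open>T\<close> alone and the groups add up by Pythagoras.\<close>
    have "(\<Sum>k\<in>F. (cmod (expect T f k))\<^sup>2)
        = (\<Sum>q\<in>Q. \<Sum>k\<in>{k \<in> F. S #> k = q}. (cmod (expect T f k))\<^sup>2)"
      unfolding Q_def by (rule sum.image_gen[OF F(1)])
    also have "\<dots> \<le> (\<Sum>q\<in>Q. C\<^sup>2 * (nrm (restr q f))\<^sup>2)"
    proof (rule sum_mono)
      fix q assume "q \<in> Q"
      have rq: "restr q f \<in> H" by (rule restr_ell2[OF f])
      have "(\<Sum>k\<in>{k \<in> F. S #> k = q}. (cmod (expect T f k))\<^sup>2)
          = (\<Sum>k\<in>{k \<in> F. S #> k = q}. (cmod (T (restr q f) k))\<^sup>2)"
        by (rule sum.cong) (use F f in \<open>auto simp: expect_def\<close>)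
      also have "\<dots> \<le> (nrm (T (restr q f)))\<^sup>2"
        unfolding ell2_norm_power2[OF Tl[OF rq]]
        by (rule finite_sum_le_infsum) (use F Tl[OF rq] in \<open>auto simp: ell2_def\<close>)
      also have "\<dots> \<le> (C * nrm (restr q f))\<^sup>2"
        by (intro power_mono op_boundD[OF C(1) rq] ell2_norm_nonneg)
      finally show "(\<Sum>k\<in>{k \<in> F. S #> k = q}. (cmod (expect T f k))\<^sup>2) \<le> C\<^sup>2 * (nrm (restr q f))\<^sup>2"
        by (simp add: power_mult_distrib)
    qed
    also have "\<dots> \<le> C\<^sup>2 * (nrm f)\<^sup>2"
    proof -
      have "disjoint Q"
        unfolding disjoint_def
      proof (intro ballI impI)
        fix p q assume "p \<in> Q" "q \<in> Q" "p \<noteq> q"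
        then obtain j k where "j \<in> carrier G" "k \<in> carrier G" "p = S #> j" "q = S #> k"
          using F unfolding Q_def by blast
        then show "p \<inter> q = {}" using rcos_eq \<open>p \<noteq> q\<close> by blast
      qed
      then show ?thesis
        unfolding sum_distrib_left[symmetric]
        by (intro mult_left_mono sum_restr_norm_le[OF f]) (use F in \<open>auto simp: Q_def\<close>)
    qed
    finally have "(\<Sum>k\<in>F. (cmod (expect T f k))\<^sup>2) \<le> (C * nrm f)\<^sup>2" by (simp add: power_mult_distrib)
    then show ?thesis
      unfolding L2_set_def by (intro real_le_lsqrt mult_nonneg_nonneg[OF C(2) ell2_norm_nonneg])
  qed
  have z: "\<And>k. k \<notin> carrier G \<Longrightarrow> expect T f k = 0" using f by (simp add: expect_def)
  show ?thesis using ell2I_bounded[OF z bd] by blast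
qed

lemma
  assumes T: "T \<in> Bd"
  shows expect_op_bound: "bound T C \<Longrightarrow> 0 \<le> C \<Longrightarrow> bound (expect T) C"
    and expect_bounded: "expect T \<in> Bd"
proof -
  show b: "bound (expect T) C" if "bound T C" "0 \<le> C" for C
    unfolding op_bound_def using expect_norm[OF T that] by blast
  obtain C where C: "0 \<le> C" "bound T C" using bounded_operators_bound[OF T] .
  show "expect T \<in> Bd"
    by (rule bounded_operatorsI[OF _ _ _ _ b[OF C(2,1)]])
      (use expect_norm[OF T C(2,1)] in \<open>auto simp: expect_def ell2_add ell2_scale restr_add restr_scale
        bounded_operators_add[OF T] bounded_operators_scale[OF T] restr_ell2 fun_eq_iff\<close>)
qed

lemma expect_apply: "f \<in> H \<Longrightarrow> k \<in> carrier G \<Longrightarrow> expect T f k = T (restr (S #> k) f) k"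
  by (simp add: expect_def)

lemma expect_add: "expect (oadd T U) = oadd (expect T) (expect U)"
  by (rule ext) (auto simp: expect_def op_add_def restr_ell2 fun_eq_iff)

lemma expect_scale: "expect (oscale z T) = oscale z (expect T)"
  by (rule ext) (auto simp: expect_def op_scale_def restr_ell2 fun_eq_iff)

lemma expect_diff: "expect (odiff T U) = odiff (expect T) (expect U)"
  by (rule ext) (auto simp: expect_def op_diff_def restr_ell2 fun_eq_iff)

lemma expect_zero: "expect zop = zop"
  by (rule ext) (auto simp: expect_def restr_ell2 fun_eq_iff)

lemma expect_delta:
  assumes g: "g \<in> carrier G" shows "expect (dl g) = (if g \<in> S then dl g else zop)"
proof (rule bounded_operators_eqI[OF expect_bounded[OF delta_bounded[OF g]]])
  show "(if g \<in> S then dl g else zop) \<in> Bd"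
    by (cases "g \<in> S") (simp_all only: if_True if_False delta_bounded[OF g] bounded_operators_zero_op)
  fix f assume f: "f \<in> H"
  have "expect (dl g) f k = (if g \<in> S then dl g else zop) f k" for k
  proof (cases "k \<in> carrier G")
    case k: True
    define j where "j = inv g \<otimes> k"
    have j: "j \<in> carrier G" and kj: "k = g \<otimes> j" using g k by (auto simp: j_def mult_inv_cancel)
    \<comment> \<open>The coordinate k = g j of \<delta>_g f depends on f j only, which survives the
      compression exactly when \<open>j\<close> and g j share a coset.\<close>
    have "j \<in> S #> k \<longleftrightarrow> g \<in> S"
    proof
      assume "g \<in> S"
      then have "k \<in> S #> j" by (auto simp: kj r_coset_def)
      then have "S #> k = S #> j" by (rule rcos_eq[OF j])
      then show "j \<in> S #> k" using rcos_mem[OF j] by simp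
    next
      assume "j \<in> S #> k"
      then have "S #> j = S #> k" by (rule rcos_eq[OF k])
      then have "k \<in> S #> j" using rcos_mem[OF k] by simp
      then obtain s where s: "s \<in> S" "g \<otimes> j = s \<otimes> j" by (auto simp: kj r_coset_def)
      then have "g = s" using g j S_sub by (metis right_cancel subsetD)
      then show "g \<in> S" using s by simp
    qed
    then show ?thesis using f g j restr_ell2[OF f] by (auto simp: expect_apply kj delta_apply_mult restr_def)
  qed (use f in \<open>simp add: expect_def delta_apply\<close>)
  then show "expect (dl g) f = (if g \<in> S then dl g else zop) f" by (rule ext)
qed

lemma expect_mem:
  assumes T: "T \<in> cl (carrier G)" shows "expect T \<in> cl S"
  using T
proof (induction T rule: closure_induct[OF subset_refl, consumes 1, case_names zero delta add scale limit])
  case zero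
  show ?case unfolding expect_zero by (rule zero_in_closure[OF S_sub])
next
  case (delta g)
  then show ?case
    using zero_in_closure[OF S_sub] delta_in_closure[OF S_sub] by (simp only: expect_delta split: if_split) blast
next
  case (add T U)
  then show ?case unfolding expect_add by (intro closure_add[OF S_sub])
next
  case (scale z T)
  then show ?case unfolding expect_scale by (intro closure_scale[OF S_sub])
next
  case (limit T)
  note TB = closure_bounded[OF limit(1)]
  show ?case
  proof (rule closure_limit[OF S_sub expect_bounded[OF TB]])
    fix \<epsilon> :: real assume e: "\<epsilon> > 0"
    obtain U where U: "U \<in> cl (carrier G)" "expect U \<in> cl S" "bound (odiff T U) \<epsilon>"
      using limit(2)[OF e] by blast
    have "bound (odiff (expect T) (expect U)) \<epsilon>"
      unfolding expect_diff[symmetric]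
      by (rule expect_op_bound[OF bounded_operators_op_diff[OF TB closure_bounded[OF U(1)]] U(3) less_imp_le[OF e]])
    then show "\<exists>V\<in>cl S. bound (odiff (expect T) V) \<epsilon>" using U(2) by (rule bexI)
  qed
qed

lemma expect_id:
  assumes T: "T \<in> cl S" shows "expect T = T"
  using T
proof (induction T rule: closure_induct[OF S_sub, consumes 1, case_names zero delta add scale limit])
  case zero
  show ?case by (rule expect_zero)
next
  case (delta g)
  then show ?case using S_sub by (auto simp: expect_delta)
next
  case (add T U)
  then show ?case by (simp add: expect_add)
next
  case (scale z T)
  then show ?case by (simp add: expect_scale)
next
  case (limit T)
  note TB = closure_bounded[OF limit(1)]
  show ?case
  proof (rule op_eq_if_bounds[OF expect_bounded[OF TB] TB, where C = 2])
    fix \<epsilon> :: real assume e: "\<epsilon> > 0"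
    obtain U where U: "U \<in> cl S" "expect U = U" "bound (odiff T U) \<epsilon>" using limit(2)[OF e] by blast
    note UB = closure_bounded[OF U(1)]
    have "bound (odiff (expect T) (expect U)) \<epsilon>"
      unfolding expect_diff[symmetric]
      by (rule expect_op_bound[OF bounded_operators_op_diff[OF TB UB] U(3) less_imp_le[OF e]])
    then have "bound (odiff (expect T) U) \<epsilon>" unfolding U(2) .
    from op_bound_diff_trans[OF expect_bounded[OF TB] UB TB this op_bound_diff_sym[OF TB UB U(3)]]
    show "bound (odiff (expect T) T) (2 * \<epsilon>)" by simp
  qed
qed

lemma block_diagonal:
  assumes b: "b \<in> cl S" and f: "f \<in> H" and k: "k \<in> carrier G"
  shows "b f k = b (restr (S #> k) f) k"
  using expect_apply[OF f k, of b] unfolding expect_id[OF b] .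

text \<open>Elements of the diagonal algebra leave every block invariant.
  \<open>block_diagonal\<close> yields left linearity of the expectation, this commutation with
  block projections yields right linearity.\<close>

lemma restr_block:
  assumes b: "b \<in> cl S" and f: "f \<in> H" and k: "k \<in> carrier G"
  shows "restr (S #> k) (b f) = b (restr (S #> k) f)"
proof
  fix j
  note bB = closure_bounded[OF b]
  note rk = restr_ell2[OF f, of "S #> k"]
  show "restr (S #> k) (b f) j = b (restr (S #> k) f) j"
  proof (cases "j \<in> carrier G")
    case j: True
    show ?thesis
    proof (cases "j \<in> S #> k")
      case True
      then show ?thesis using block_diagonal[OF b f j] rcos_eq[OF k True] by (simp add: restr_def)
    next
      case False
      have "(S #> j) \<inter> (S #> k) = {}" using False rcos_eq[OF j] rcos_eq[OF k] rcos_mem[OF j] by blast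
      then have "restr (S #> j) (restr (S #> k) f) = (\<lambda>_. 0)" by (auto simp: restr_def fun_eq_iff)
      then show ?thesis
        using block_diagonal[OF b rk j] False by (simp add: restr_def bounded_operators_zero[OF bB])
    qed
  next
    case False
    then have "j \<notin> S #> k" using r_coset_subset_G[OF S_sub k] by blast
    then show ?thesis
      using ell2_zero_outside[OF bounded_operators_ell2[OF bB rk] False] by (simp add: restr_def)
  qed
qed

lemma expect_left:
  assumes b: "b \<in> cl S" and T: "T \<in> Bd" shows "expect (b \<star> T) = b \<star> expect T"
proof (rule bounded_operators_eqI[of _ "carrier G"])
  note bB = closure_bounded[OF b]
  show "expect (b \<star> T) \<in> Bd" by (rule expect_bounded[OF bounded_operators_compose[OF bB T]])
  show "b \<star> expect T \<in> Bd" by (rule bounded_operators_compose[OF bB expect_bounded[OF T]])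
  fix f assume f: "f \<in> H"
  note Ef = bounded_operators_ell2[OF expect_bounded[OF T] f]
  show "expect (b \<star> T) f = (b \<star> expect T) f"
  proof
    fix k
    show "expect (b \<star> T) f k = (b \<star> expect T) f k"
    proof (cases "k \<in> carrier G")
      case k: True
      define h where "h = T (restr (S #> k) f)"
      have h: "h \<in> H" unfolding h_def by (rule bounded_operators_ell2[OF T restr_ell2[OF f]])
      have r: "restr (S #> k) (expect T f) = restr (S #> k) h"
      proof
        fix j
        show "restr (S #> k) (expect T f) j = restr (S #> k) h j"
        proof (cases "j \<in> S #> k")
          case True
          then have "j \<in> carrier G" using r_coset_subset_G[OF S_sub k] by blast
          then show ?thesis using True rcos_eq[OF k True] f by (simp add: restr_def h_def expect_apply)
        qed (simp add: restr_def)
      qed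
      have "expect (b \<star> T) f k = b h k"
        using f k restr_ell2[OF f] by (simp add: expect_apply compose_def h_def)
      also have "\<dots> = b (restr (S #> k) (expect T f)) k" unfolding r by (rule block_diagonal[OF b h k])
      also have "\<dots> = b (expect T f) k" by (rule block_diagonal[OF b Ef k, symmetric])
      finally show ?thesis using f by (simp add: compose_def)
    next
      case False
      then show ?thesis
        using f ell2_zero_outside[OF bounded_operators_ell2[OF bB Ef] False]
        by (simp add: compose_def) (simp add: expect_def)
    qed
  qed
qed

lemma expect_right:
  assumes b: "b \<in> cl S" and T: "T \<in> Bd" shows "expect (T \<star> b) = expect T \<star> b"
proof (rule ext)
  fix f
  note bB = closure_bounded[OF b]
  show "expect (T \<star> b) f = (expect T \<star> b) f"
  proof (cases "f \<in> H")
    case f: True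
    note bf = bounded_operators_ell2[OF bB f]
    show ?thesis
      by (rule ext) (simp add: expect_def compose_def f bf restr_ell2[OF f] restr_block[OF b f])
  qed (simp add: expect_def compose_def)
qed

lemma coef_expect: "k \<in> carrier G \<Longrightarrow> T \<in> Bd \<Longrightarrow> coef (expect T) k = (if k \<in> S then coef T k else 0)"
proof -
  assume k: "k \<in> carrier G" and T: "T \<in> Bd"
  have "restr (S #> k) (unit_vec \<one>) = (if k \<in> S then unit_vec \<one> else (\<lambda>_. 0))"
    using one_in_rcos[OF k] by (auto simp: restr_def unit_vec_def fun_eq_iff)
  then show ?thesis
    using k unit_one by (simp add: coef_def expect_apply bounded_operators_zero[OF T])
qed

text \<open>The expectation keeps the coefficients on \<open>S\<close> and erases the others. If
  there are no others, T minus its expectation has only zero coefficients and vanishes by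
  \<open>coef_eq_0I\<close>.\<close>

lemma mem_cl_S_iff:
  assumes T: "T \<in> cl (carrier G)"
  shows "T \<in> cl S \<longleftrightarrow> (\<forall>k\<in>carrier G - S. coef T k = 0)"
proof
  assume "T \<in> cl S"
  then show "\<forall>k\<in>carrier G - S. coef T k = 0"
    using coef_expect[OF _ closure_bounded[OF T]] expect_id by fastforce
next
  assume z: "\<forall>k\<in>carrier G - S. coef T k = 0"
  note TB = closure_bounded[OF T] note ET = expect_mem[OF T]
  note EB = closure_bounded[OF ET]
  have "odiff T (expect T) = zop"
  proof (rule coef_eq_0I)
    show "odiff T (expect T) \<in> cl (carrier G)"
      by (rule closure_diff[OF subset_refl T cl_S_sub[OF ET]])
    fix k assume k: "k \<in> carrier G"
    have "coef (odiff T (expect T)) k = coef T k - coef (expect T) k"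
      using unit_one by (simp add: coef_def op_diff_def)
    then show "coef (odiff T (expect T)) k = 0" using z k by (simp add: coef_expect[OF k TB])
  qed
  then have "T f = expect T f" if "f \<in> H" for f
    using fun_cong[of "odiff T (expect T)" zop f] that by (simp add: op_diff_def fun_eq_iff)
  then have "T = expect T" by (rule bounded_operators_eqI[OF TB EB])
  then show "T \<in> cl S" using ET by simp
qed

subsection \<open>The diagonal is maximal abelian\<close>

text \<open>Both sides are the coordinate at t k of the commuting operators applied to the unit
  vector at the identity. Consequently the modulus of the coefficient function is constant on orbits
  of conjugation by \<open>S\<close>.\<close>

lemma coef_conj:
  assumes V: "V \<in> cl (carrier G)" and t: "t \<in> S" and comm: "dl t \<star> V = V \<star> dl t" and k: "k \<in> carrier G"
  shows "c t k * coef V k = c (t \<otimes> k \<otimes> inv t) t * coef V (t \<otimes> k \<otimes> inv t)"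
proof -
  have tG: "t \<in> carrier G" using t S_sub by blast
  note VB = closure_bounded[OF V] note u = unit_one note ut = unit_vec_ell2[OF tG]
  have "c t k * coef V k = (dl t \<star> V) (unit_vec \<one>) (t \<otimes> k)"
    using u k tG by (simp add: compose_def coef_def delta_apply_mult bounded_operators_ell2[OF VB])
  also have "\<dots> = V (unit_vec t) (t \<otimes> k)"
    unfolding comm using u tG by (simp add: compose_def delta_unit c_one)
  also have "t \<otimes> k = (t \<otimes> k \<otimes> inv t) \<otimes> t" using k tG by (simp add: m_assoc)
  also have "V (unit_vec t) \<dots> = c (t \<otimes> k \<otimes> inv t) t * coef V (t \<otimes> k \<otimes> inv t)"
    by (rule coef_shift[OF V tG]) (use k tG in simp)
  finally show ?thesis .
qed

text \<open>Pigeonhole: with N the orbit size, the N + 1 conjugates by the powers of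
  \<open>t\<close> from 0 to N cannot be distinct, and the difference of two coinciding exponents is
  a power of \<open>t\<close> commuting with \<open>k\<close>, of exponent between 1 and N.\<close>

lemma centralizing_of_finite_orbit:
  assumes k: "k \<in> carrier G" and fin: "finite ((\<lambda>t. t \<otimes> k \<otimes> inv t) ` S)"
  shows "centralizing G S (card ((\<lambda>t. t \<otimes> k \<otimes> inv t) ` S)) k"
  unfolding centralizing_def
proof
  fix t assume t: "t \<in> S"
  let ?O = "(\<lambda>t. t \<otimes> k \<otimes> inv t) ` S"
  let ?f = "\<lambda>i :: nat. t [^] i \<otimes> k \<otimes> inv (t [^] i)"
  have tG: "t \<in> carrier G" using t S_sub by blast
  have pS: "t [^] i \<in> S" for i :: nat
    using t by (induction i) (auto intro: subgroup.one_closed[OF S_subgroup] subgroup.m_closed[OF S_subgroup])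
  have "?f ` {0..card ?O} \<subseteq> ?O" using pS by blast
  then have "card (?f ` {0..card ?O}) \<le> card ?O" by (rule card_mono[OF fin])
  then have "\<not> inj_on ?f {0..card ?O}" by (intro pigeonhole) simp
  then obtain i0 j0 where ij0: "i0 \<le> card ?O" "j0 \<le> card ?O" "i0 \<noteq> j0" "?f i0 = ?f j0"
    by (auto simp: inj_on_def)
  define i where "i = min i0 j0"
  define j where "j = max i0 j0"
  have ij: "i < j" "j \<le> card ?O" using ij0(1-3) by (auto simp: i_def j_def)
  have fij: "?f i = ?f j"
  proof (cases "i0 < j0")
    case True
    then show ?thesis unfolding i_def j_def using ij0(4) by (simp only: min_absorb1 max_absorb2 less_imp_le)
  next
    case False
    then show ?thesis unfolding i_def j_def using ij0(4) by (simp only: min_absorb2 max_absorb1 not_less)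
  qed
  define m where "m = j - i"
  have m: "m \<in> {1..card ?O}" using ij by (auto simp: m_def)
  define a where "a = t [^] i"
  define b where "b = t [^] m"
  have ab: "a \<in> carrier G" "b \<in> carrier G" using tG by (auto simp: a_def b_def)
  have tj: "t [^] j = a \<otimes> b" using tG ij by (simp add: a_def b_def m_def nat_pow_mult)
  have "a \<otimes> k \<otimes> inv a = a \<otimes> (b \<otimes> k \<otimes> inv b) \<otimes> inv a"
    using fij ab k unfolding tj a_def[symmetric] by (simp add: m_assoc inv_mult_group)
  then have "inv a \<otimes> (a \<otimes> k \<otimes> inv a) \<otimes> a = inv a \<otimes> (a \<otimes> (b \<otimes> k \<otimes> inv b) \<otimes> inv a) \<otimes> a" by simp
  then have kb: "k = b \<otimes> k \<otimes> inv b" using ab k by (simp add: m_assoc inv_mult_cancel)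
  have "k \<otimes> b = b \<otimes> k \<otimes> inv b \<otimes> b" using arg_cong[OF kb, of "\<lambda>y. y \<otimes> b"] .
  also have "\<dots> = b \<otimes> k" using ab k by (simp add: m_assoc)
  finally show "\<exists>j\<in>{1..card ?O}. k \<otimes> t [^] j = t [^] j \<otimes> k" using m by (auto simp: b_def)
qed

text \<open>A nonzero coefficient at \<open>k\<close> outside \<open>S\<close> recurs in modulus
  along the orbit of \<open>k\<close>, so the orbit is finite by square-summability. Immediate
  centralizing makes \<open>k\<close> commute with \<open>S\<close>, and \<open>coef_conj\<close>
  then gives c(t,k) = c(k,t). So \<open>k\<close> could be added to \<open>S\<close>, contradicting
  maximality.\<close>

lemma commutant_subset:
  assumes max: "maximal_symmetric_abelian_subgroup G c S" and imm: "immediately_centralizing G S"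
    and V: "V \<in> cl (carrier G)" and comm: "\<And>t. t \<in> S \<Longrightarrow> dl t \<star> V = V \<star> dl t"
  shows "V \<in> cl S"
  unfolding mem_cl_S_iff[OF V]
proof (intro ballI, rule ccontr)
  fix k assume "k \<in> carrier G - S" and nz: "coef V k \<noteq> 0"
  then have k: "k \<in> carrier G" and kS: "k \<notin> S" by auto
  let ?O = "(\<lambda>t. t \<otimes> k \<otimes> inv t) ` S"
  have OG: "?O \<subseteq> carrier G" using k S_sub by auto
  have mod: "cmod (coef V j) = cmod (coef V k)" if j: "j \<in> ?O" for j
  proof -
    obtain t where t: "t \<in> S" "j = t \<otimes> k \<otimes> inv t" using j by blast
    have tG: "t \<in> carrier G" using t S_sub by blast
    show ?thesis
      using arg_cong[OF coef_conj[OF V t(1) comm[OF t(1)] k], of cmod] tG k t(2)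
      by (simp add: norm_mult c_norm)
  qed
  note VB = closure_bounded[OF V]
  have Vl: "V (unit_vec \<one>) \<in> H" by (rule bounded_operators_ell2[OF VB unit_one])
  have fin: "finite ?O"
  proof (rule ccontr)
    assume inf: "infinite ?O"
    define C where "C = (nrm (V (unit_vec \<one>)))\<^sup>2"
    have "\<exists>n :: nat. C < real n * (cmod (coef V k))\<^sup>2" using nz by (intro ex_less_of_nat_mult) simp
    then obtain n :: nat where n: "C < real n * (cmod (coef V k))\<^sup>2" by blast
    obtain F where F: "finite F" "card F = n" "F \<subseteq> ?O" using infinite_arbitrarily_large[OF inf] by blast
    have "real n * (cmod (coef V k))\<^sup>2 = (\<Sum>j\<in>F. (cmod (coef V j))\<^sup>2)"
      using F mod by (simp add: subset_iff)
    also have "\<dots> \<le> C"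
      unfolding C_def ell2_norm_power2[OF Vl] coef_def
      by (rule finite_sum_le_infsum) (use F OG Vl in \<open>auto simp: ell2_def\<close>)
    finally show False using n by simp
  qed
  have "\<one> \<otimes> k \<otimes> inv \<one> \<in> ?O" using subgroup.one_closed[OF S_subgroup] by (rule imageI)
  \<comment> \<open>Immediate centralizing speaks of positive exponents bounds only; the orbit
    contains \<open>k\<close> itself.\<close>
  then have card: "card ?O \<ge> 1" using fin by (metis One_nat_def Suc_leI card_gt_0_iff empty_iff)
  have "centralizing G S 1 k"
    using imm card k centralizing_of_finite_orbit[OF k fin] unfolding immediately_centralizing_def by blast
  then have kt: "k \<otimes> t = t \<otimes> k" if "t \<in> S" for t
    using that S_sub by (auto simp: centralizing_def)
  have sk: "sym_comm t k" if t: "t \<in> S" for t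
  proof -
    have tG: "t \<in> carrier G" using t S_sub by blast
    have "t \<otimes> k \<otimes> inv t = k" using kt[OF t] tG k by (metis m_assoc inv_closed r_inv r_one)
    then have "c t k * coef V k = c k t * coef V k" using coef_conj[OF V t comm[OF t] k] by simp
    then show ?thesis using nz kt[OF t] by (simp add: sym_comm_def)
  qed
  have "symmetric_abelian_subgroup G c (generate G (insert k S))"
  proof (rule symmetric_abelian_subgroup_generate)
    show "insert k S \<subseteq> carrier G" using k S_sub by simp
    fix y z assume "y \<in> insert k S" "z \<in> insert k S"
    then show "sym_comm y z" using sk S_comm sym_comm_sym by (auto simp: sym_comm_def)
  qed
  moreover have "insert k S \<subseteq> generate G (insert k S)" by (auto intro: generate.incl)
  ultimately have "generate G (insert k S) = S"
    using max unfolding maximal_symmetric_abelian_subgroup_def by blast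
  then show False using kS generate.incl[of k "insert k S" G] by simp
qed

subsection \<open>Characters of the diagonal\<close>

text \<open>\<open>closure_commute\<close> twice, first with a generator as the fixed operator, then
  with an arbitrary element of the closure.\<close>

lemma closure_S_comm:
  assumes a: "a \<in> cl S" and b: "b \<in> cl S" shows "a \<star> b = b \<star> a"
proof (rule closure_commute[OF S_sub a closure_bounded[OF b]])
  fix s assume s: "s \<in> S"
  have sG: "s \<in> carrier G" using s S_sub by blast
  have "b \<star> dl s = dl s \<star> b"
  proof (rule closure_commute[OF S_sub b delta_bounded[OF sG]])
    fix t assume t: "t \<in> S"
    have tG: "t \<in> carrier G" using t S_sub by blast
    show "dl t \<star> dl s = dl s \<star> dl t"
      using S_comm[OF s t] by (simp add: delta_mult sG tG sym_comm_def)
  qed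
  then show "dl s \<star> b = b \<star> dl s" by simp
qed

lemma star_pair: "star_pair TA (cl S)"
proof -
  note B = closure_bounded
  have "monoid TA"
    by (rule monoid.intro; unfold TA_simps)
      (auto intro: closure_compose[OF carrier_subgroup] closure_id[OF one_G subset_refl]
        simp: compose_assoc_op B compose_id id_compose)
  moreover have "star_pair_axioms TA (cl S)"
  proof (rule star_pair_axioms.intro; unfold TA_simps)
    show "cl S \<subseteq> cl (carrier G)" by (rule closure_mono[OF S_sub])
    show "(\<lambda>f\<in>H. f) \<in> cl S" by (rule closure_id[OF subgroup.one_closed[OF S_subgroup] S_sub])
  qed (blast intro: closure_add[OF S_sub] closure_scale[OF S_sub] closure_compose[OF S_subgroup]
      closure_adjoint[OF S_subgroup] closure_S_comm closure_scale[OF subset_refl]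
      closure_adjoint[OF carrier_subgroup] scale_compose compose_scale scale_scale scale_one compose_add
      add_compose op_adjoint_compose op_adjoint_adjoint op_adjoint_scale B)+
  ultimately show ?thesis by (rule star_pair.intro)
qed

text \<open>Automatic continuity: if |x b| exceeded \<beta>, dividing \<open>b\<close> by x b would
  give an element of bound below 1 on which \<open>x\<close> takes the value 1, and
  \<open>neumann\<close> turns this into x s = 1 + x s.\<close>

lemma char_contractive:
  assumes x: "x \<in> characters TA (cl S)" and b: "b \<in> cl S" and \<beta>: "bound b \<beta>" "0 \<le> \<beta>"
  shows "cmod (x b) \<le> \<beta>"
proof (rule ccontr)
  interpret P: star_pair TA "cl S" by (rule star_pair)
  assume "\<not> cmod (x b) \<le> \<beta>"
  then have gt: "\<beta> < cmod (x b)" by simp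
  then have nz: "x b \<noteq> 0" using \<beta>(2) by auto
  define z where "z = 1 / x b"
  have zb: "oscale z b \<in> cl S" by (rule closure_scale[OF S_sub b])
  note bl = bounded_operators_ell2[OF closure_bounded[OF b]]
  have "bound (oscale z b) (cmod z * \<beta>)" by (rule op_bound_scale[OF \<beta>(1) bl \<beta>(1) bl])
  moreover have "cmod z * \<beta> < 1" using gt nz by (simp add: z_def norm_divide)
  ultimately obtain s where s: "s \<in> cl S" "s = oadd (oscale z b) (oscale z b \<star> s)"
    using neumann[OF S_subgroup zb, of "cmod z * \<beta>"] \<beta>(2) by auto
  have xz: "x (oscale z b) = 1"
    using P.char_smult[OF x b, of z] nz by (simp add: TA_simps z_def)
  have "x s = x (oadd (oscale z b) (oscale z b \<star> s))" using s(2) by simp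
  also have "\<dots> = x (oscale z b) + x (oscale z b) * x s"
    using P.char_add[OF x zb, of "oscale z b \<star> s"] P.char_mult[OF x zb s(1)] P.mult_B[OF zb s(1)]
    by (simp add: TA_simps)
  finally show False unfolding xz by simp
qed

section \<open>The twisted group algebra satisfies the abstract hypotheses\<close>

lemma delta_conj:
  assumes g: "g \<in> carrier G" and b: "b \<in> cl S" shows "dl g \<star> (b \<star> dl (inv g)) \<in> cl S"
  using b
proof (induction b rule: closure_induct[OF S_sub, consumes 1, case_names zero delta add scale limit])
  have ig: "inv g \<in> carrier G" using g by simp
  note gB = delta_bounded[OF g] note iB = delta_bounded[OF ig]
  note B = closure_bounded
  {
    case zero
    have "dl g \<star> (zop \<star> dl (inv g)) = zop"
      by (rule ext) (simp add: compose_def bounded_operators_ell2[OF iB] bounded_operators_zero[OF gB])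
    then show ?case using zero_in_closure[OF S_sub] by (simp only:)
  next
    case (delta s)
    have sG: "s \<in> carrier G" using delta S_sub by blast
    \<comment> \<open>Normality of \<open>S\<close>: conjugating a generator gives a phase multiple
      of another generator.\<close>
    have "g \<otimes> (s \<otimes> inv g) \<in> S" using inv_op_closed2[OF g delta] g sG by (simp add: m_assoc)
    then show ?case
      using g sG ig gB by (simp add: delta_mult compose_scale delta_bounded scale_scale
          closure_scale[OF S_sub] delta_in_closure[OF S_sub])
  next
    case (add T U)
    then show ?case using gB iB
      by (simp add: add_compose compose_add B bounded_operators_compose closure_add[OF S_sub])
  next
    case (scale z T)
    then show ?case using gB iB
      by (simp add: scale_compose compose_scale B bounded_operators_compose closure_scale[OF S_sub])
  next
    case (limit T)
    note TB = B[OF limit(1)]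
    show ?case
    proof (rule closure_limit[OF S_sub])
      show "dl g \<star> (T \<star> dl (inv g)) \<in> Bd"
        by (rule bounded_operators_compose[OF gB bounded_operators_compose[OF TB iB]])
      fix \<epsilon> :: real assume e: "\<epsilon> > 0"
      obtain U where U: "U \<in> cl S" "dl g \<star> (U \<star> dl (inv g)) \<in> cl S" "bound (odiff T U) \<epsilon>"
        using limit(2)[OF e] by blast
      note UB = B[OF U(1)] note DB = bounded_operators_op_diff[OF TB UB]
      have "bound (dl g \<star> (odiff T U \<star> dl (inv g))) (1 * (\<epsilon> * 1))"
        by (rule op_bound_compose[OF delta_op_bound[OF g] bounded_operators_ell2[OF gB]
              op_bound_compose[OF U(3) bounded_operators_ell2[OF DB] delta_op_bound[OF ig]
                bounded_operators_ell2[OF iB] less_imp_le[OF e]]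
              bounded_operators_ell2[OF bounded_operators_compose[OF DB iB]] zero_le_one])
      then have "bound (odiff (dl g \<star> (T \<star> dl (inv g))) (dl g \<star> (U \<star> dl (inv g)))) \<epsilon>"
        by (simp add: diff_compose[OF iB] compose_diff gB iB TB UB bounded_operators_compose)
      then show "\<exists>V\<in>cl S. bound (odiff (dl g \<star> (T \<star> dl (inv g))) V) \<epsilon>" using U(2) by (rule bexI)
    qed
  }
qed

lemma delta_normalizer:
  assumes g: "g \<in> carrier G" shows "dl g \<in> normalizers TA (cl S)"
  unfolding normalizers_def TA_simps
proof (intro CollectI conjI ballI)
  have ig: "inv g \<in> carrier G" using g by simp
  note gB = delta_bounded[OF g] note iB = delta_bounded[OF ig]
  show "dl g \<in> cl (carrier G)" by (rule delta_in_closure[OF subset_refl g])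
  fix b assume b: "b \<in> cl S"
  note bB = closure_bounded[OF b]
  show "dl g \<star> b \<star> op_adjoint (carrier G) (dl g) \<in> cl S"
    using delta_conj[OF g b] gB iB bB
    by (simp add: delta_adjoint[OF g] compose_scale bounded_operators_compose compose_assoc_op closure_scale[OF S_sub])
  show "op_adjoint (carrier G) (dl g) \<star> b \<star> dl g \<in> cl S"
    using delta_conj[OF ig b] gB iB bB g
    by (simp add: delta_adjoint[OF g] scale_compose bounded_operators_compose compose_assoc_op closure_scale[OF S_sub])
qed

lemma weyl_expectation:
  assumes max: "maximal_symmetric_abelian_subgroup G c S" and imm: "immediately_centralizing G S"
  shows "weyl_expectation TA (cl S) S G dl expect"
proof -
  interpret P: star_pair TA "cl S" by (rule star_pair)
  note B = closure_bounded
  have fam: "normalizer_family TA (cl S) S G dl"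
  proof (intro normalizer_family.intro star_pair normalizer_family_axioms.intro normal_axioms)
    show "dl g \<in> normalizers TA (cl S)" if "g \<in> carrier G" for g by (rule delta_normalizer[OF that])
    show "\<exists>z. cmod z = 1 \<and> dl g \<otimes>\<^bsub>TA\<^esub> dl h = z \<odot>\<^bsub>TA\<^esub> dl (g \<otimes> h)"
      if "g \<in> carrier G" "h \<in> carrier G" for g h
      using that by (intro exI[of _ "c g h"]) (simp add: TA_simps delta_mult c_norm)
    show "dl s \<in> cl S" if "s \<in> S" for s by (rule delta_in_closure[OF S_sub that])
  qed (simp_all add: TA_simps delta_unitary)
  have "weyl_expectation_axioms TA (cl S) S G dl expect"
  proof (rule weyl_expectation_axioms.intro; (unfold TA_simps)?)
    fix a assume a: "a \<in> cl (carrier G)"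
    show "expect a \<in> cl S" by (rule expect_mem[OF a])
    show "expect (b \<star> a) = b \<star> expect a" "expect (a \<star> b) = expect a \<star> b" if "b \<in> cl S" for b
      using expect_left[OF that B[OF a]] expect_right[OF that B[OF a]] by auto
    show "a \<in> cl S" if z: "\<And>k. k \<in> carrier G - S \<Longrightarrow> expect (op_adjoint (carrier G) (dl k) \<star> a) = zop"
      unfolding mem_cl_S_iff[OF a]
    proof
      fix k assume k: "k \<in> carrier G - S"
      then have kG: "k \<in> carrier G" "inv k \<in> carrier G" by auto
      \<comment> \<open>Up to unimodular factors the coefficient of \<open>a\<close> at
        \<open>k\<close> is that of \<open>T\<close> at the identity, which lies in \<open>S\<close>
        and is therefore retained by the expectation.\<close>
      define T where "T = op_adjoint (carrier G) (dl k) \<star> a"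
      have "T \<in> Bd" unfolding T_def by (intro bounded_operators_compose op_adjoint_bounded delta_bounded kG B[OF a])
      then have "coef T \<one> = coef (expect T) \<one>"
        using subgroup.one_closed[OF S_subgroup] by (simp add: coef_expect)
      also have "\<dots> = 0" unfolding T_def z[OF k] coef_def using unit_one by simp
      finally have "coef (oscale (cnj (c k (inv k))) (dl (inv k) \<star> a)) \<one> = 0"
        unfolding T_def delta_adjoint[OF kG(1)] scale_compose[OF B[OF a]] .
      then have "coef (dl (inv k) \<star> a) \<one> = 0"
        using unit_one c_nonzero[OF kG] by (simp add: coef_def op_scale_def)
      then show "coef a k = 0"
        using coef_delta_compose[OF B[OF a] kG(2) one_G] kG c_nonzero[OF kG(2,1)] by simp
    qed
    show "a \<in> cl S" if "\<And>b. b \<in> cl S \<Longrightarrow> b \<star> a = a \<star> b"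
      by (rule commutant_subset[OF max imm a]) (rule that[OF delta_in_closure[OF S_sub]])
    show "x (expect (op_adjoint (carrier G) a \<star> a)) = 0"
      if x: "x \<in> characters TA (cl S)"
        and z: "\<And>g. g \<in> carrier G \<Longrightarrow> x (expect (op_adjoint (carrier G) (dl g) \<star> a)) = 0" for x
    proof -
      obtain C where C: "0 \<le> C" "bound a C" using bounded_operators_bound[OF B[OF a]] .
      note aB = B[OF a]
      have Em: "expect (T \<star> a) \<in> cl S" if "T \<in> cl (carrier G)" for T
        by (rule expect_mem[OF closure_compose[OF carrier_subgroup that a]])
      \<comment> \<open>The functional T \<mapsto> x(E(T a)) is linear, bounded by contractivity of
        \<open>x\<close> and \<open>E\<close>, and zero on generators; its value at the adjoint of
        \<open>a\<close> is the one claimed to vanish.\<close>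
      show ?thesis
      proof (rule closure_functional_eq_0[OF subset_refl closure_adjoint[OF carrier_subgroup a],
            where \<Phi> = "\<lambda>T. x (expect (T \<star> a))" and C = C])
        show "x (expect (oadd T U \<star> a)) = x (expect (T \<star> a)) + x (expect (U \<star> a))"
          if "T \<in> cl (carrier G)" "U \<in> cl (carrier G)" for T U
          using P.char_add[OF x Em[OF that(1)] Em[OF that(2)]]
          by (simp add: add_compose[OF aB] expect_add TA_simps)
        show "x (expect (oscale w T \<star> a)) = w * x (expect (T \<star> a))" if "T \<in> cl (carrier G)" for w T
          using P.char_smult[OF x Em[OF that], of w]
          by (simp add: scale_compose[OF aB] expect_scale TA_simps)
        show "cmod (x (expect (T \<star> a))) \<le> C * \<epsilon>"
          if T: "T \<in> cl (carrier G)" and e: "\<epsilon> > 0" "bound T \<epsilon>" for T \<epsilon>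
        proof -
          have "bound (T \<star> a) (\<epsilon> * C)"
            by (rule op_bound_compose[OF e(2) bounded_operators_ell2[OF B[OF T]] C(2)
                  bounded_operators_ell2[OF aB] less_imp_le[OF e(1)]])
          then have "bound (expect (T \<star> a)) (\<epsilon> * C)"
            by (rule expect_op_bound[OF bounded_operators_compose[OF B[OF T] aB]]) (use e C in simp)
          then have "cmod (x (expect (T \<star> a))) \<le> \<epsilon> * C"
            by (rule char_contractive[OF x Em[OF T]]) (use e C in simp)
          then show ?thesis by (simp add: mult.commute)
        qed
        show "x (expect (dl g \<star> a)) = 0" if g: "g \<in> carrier G" for g
        proof -
          have ig: "inv g \<in> carrier G" using g by simp
          have "dl (inv (inv g)) \<star> a \<in> cl (carrier G)"
            using g by (intro closure_compose[OF carrier_subgroup] delta_in_closure[OF subset_refl] a) simp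
          note E1 = expect_mem[OF this]
          \<comment> \<open>The hypothesis concerns adjoints of generators; the adjoint of the
            generator at g^{-1} is a phase times the generator at g.\<close>
          have "x (oscale (cnj (c (inv g) (inv (inv g)))) (expect (dl (inv (inv g)) \<star> a))) = 0"
            using z[OF ig] unfolding delta_adjoint[OF ig] scale_compose[OF aB] expect_scale .
          then have "cnj (c (inv g) (inv (inv g))) * x (expect (dl (inv (inv g)) \<star> a)) = 0"
            using P.char_smult[OF x E1] by (simp add: TA_simps)
          then show ?thesis using c_nonzero[OF ig, of g] g by simp
        qed
      qed
    qed
  next
    fix b assume b: "b \<in> cl S"
    show "expect b = b" by (rule expect_id[OF b])
    fix k assume k: "k \<in> carrier G - S" and kb: "dl k \<star> b \<in> cl S"
    have kG: "k \<in> carrier G" using k by blast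
    show "b = zop"
    proof (rule coef_eq_0I[OF cl_S_sub[OF b]])
      fix j assume j: "j \<in> carrier G"
      show "coef b j = 0"
      proof (cases "j \<in> S")
        case True
        \<comment> \<open>Translation by \<open>k\<close> carries the coefficient of
          \<open>b\<close> at \<open>j\<close> in \<open>S\<close> to a place outside
          \<open>S\<close>, where elements of the diagonal algebra have none.\<close>
        have "k \<otimes> j \<notin> S"
        proof
          assume "k \<otimes> j \<in> S"
          then have "k \<otimes> j \<otimes> inv j \<in> S"
            using subgroup.m_closed[OF S_subgroup] subgroup.m_inv_closed[OF S_subgroup True] by blast
          then show False using k j by (simp add: m_assoc)
        qed
        then have "coef (dl k \<star> b) (k \<otimes> j) = 0"
          using kb mem_cl_S_iff[OF cl_S_sub[OF kb]] kG j by simp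
        then show ?thesis
          using coef_delta_compose[OF B[OF b] kG, of "k \<otimes> j"] kG j c_nonzero[OF kG j]
          by (simp add: inv_mult_cancel)
      next
        case False
        then show ?thesis using b j mem_cl_S_iff[OF cl_S_sub[OF b]] by blast
      qed
    qed
  next
    show "oscale z zop = zop" for z by (rule ext) (simp add: op_scale_def)
  qed
  then show ?thesis by (intro weyl_expectation.intro fam)
qed

end

theorem theorem5p5:
  fixes G :: "('g, 'm) monoid_scheme"
    and c :: "'g \<Rightarrow> 'g \<Rightarrow> complex"
    and S :: "'g set"
    and r :: "'g set \<Rightarrow> 'g"
    and A :: "'g operator star_algebra"
    and B :: "'g operator set"
  assumes "group G"
    and "countable (carrier G)"
    and "two_cocycle G c"
    and "maximal_symmetric_abelian_subgroup G c S"
    and "S \<lhd> G"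
    and "immediately_centralizing G S"
    and A_eq: "A = twisted_reduced_algebra G c"
    and B_eq: "B = delta_closure G c S"
    and representatives: "\<And>q. q \<in> carrier (G Mod S) \<Longrightarrow> r q \<in> q"
    and "topologically_free (G Mod S) (spectrum A B) (coset_action G c S)"
  shows "homeomorphic_map
    (prod_topology (transformation_groupoid_top (G Mod S) (spectrum A B)) circle_top)
    (weyl_twist_top A B)
    (\<lambda>((q, x), z). weyl_twist_class A B (coset_action G c S q x, z \<odot>\<^bsub>A\<^esub> delta G c (r q), x))"
proof -
  have tg: "twisted_group G c"
    using assms(1,3) by (simp add: twisted_group_def twisted_group_axioms_def)
  have sym: "symmetric_abelian_subgroup G c S"
    using assms(4) by (simp add: maximal_symmetric_abelian_subgroup_def)
  interpret twisted_pair G c S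
  proof (intro twisted_pair.intro tg assms(5) twisted_pair_axioms.intro)
    fix s t assume st: "s \<in> S" "t \<in> S"
    interpret C: comm_group "G\<lparr>carrier := S\<rparr>" using sym by (simp add: symmetric_abelian_subgroup_def)
    have "s \<otimes>\<^bsub>G\<^esub> t = t \<otimes>\<^bsub>G\<^esub> s" using C.m_comm[of s t] st by simp
    then show "twisted_group.sym_comm G c s t"
      using sym st by (simp add: twisted_group.sym_comm_def[OF tg] symmetric_abelian_subgroup_def)
  qed
  interpret W: weyl_expectation A B S G "delta G c" expect
    unfolding A_eq B_eq by (rule weyl_expectation[OF assms(4,6)])
  \<comment> \<open>Both are the same description over a coset, once written for a general pair and
    once for the group algebra.\<close>
  have act: "W.coset_act = coset_action G c S"
    unfolding W.coset_act_def[abs_def] coset_action_def[abs_def] unfolding A_eq B_eq by (rule refl)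
  interpret W: weyl_section A B S G "delta G c" r
    by unfold_locales (use representatives assms(10) in \<open>simp_all add: act\<close>)
  show ?thesis using W.homeomorphic_map_twist unfolding W.\<psi>_def act .
qed

end
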